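(* Let $(t_\ast,\mathbf x_\ast)\in\mathcal E$ be an equilibrium on the horizon for $g^{\rm ext}$ which is mapped to a root $(t_\ast,\mathbf Y_0)$, with $\mathbf Y_0$ nonzero, of the balance law $-\frac1k\Lambda_\alpha\mathbf Y_0+f_{\alpha,k}(t_\ast,\mathbf Y_0)=0$ through $\mathbf Y_0=r_{\mathbf x_\ast}^{\Lambda_\alpha}\mathbf x_\ast$ and $\mathbf x_\ast=r_{\mathbf Y_0}^{-\Lambda_\alpha}\mathbf Y_0$, where $r_{\mathbf x_\ast}=(kC_\ast)^{-1/k}>0$ and $r_{\mathbf Y_0}=p_\alpha(\mathbf Y_0)>0$. Suppose that the order/residual assumption (R) of the context holds. When all the eigenpairs of the blow-up power-determining matrix $A^{\rm ext}$ associated with $(t_\ast,\mathbf Y_0)$ are determined, all the eigenpairs of $Dg^{\rm ext}_\ast$ are constructed through correspondence (I). Similarly, if all the eigenpairs of $Dg^{\rm ext}_\ast$ are determined, then all the eigenpairs of $A^{\rm ext}$ are constructed through correspondence (II). (I) From $A^{\rm ext}$ to $Dg^{\rm ext}_\ast$. (a) Transversal pair: the eigenvalue $1$ of $A^{\rm ext}$ with eigenvector $\mathbf v^{\rm ext}_{0,\alpha}$ corresponds to the eigenvalue $-C_\ast$ of $Dg^{\rm ext}_\ast$, with eigenvector $\mathbf v^{\rm ext}_{\ast,\alpha}$ if $k>1$ and $\tilde{\mathbf v}^{\rm ext}_{\ast,\alpha}$ if $k=1$. (b) Tangential pair (nonautonomous): the eigenvalue $0$ of $A^{\rm ext}$ with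 eigenvector $\begin{pmatrix}1\\ -A^{-1}D_tf_{\alpha,k}(t_\ast,\mathbf Y_0)\end{pmatrix}$ corresponds to the eigenvalue $0$ of $Dg^{\rm ext}_\ast$ with eigenvector $r_{\mathbf Y_0}^{-\Lambda^{\rm ext}_\alpha}\begin{pmatrix}1\\ -A^{-1}D_tf_{\alpha,k}(t_\ast,\mathbf Y_0)\end{pmatrix}$. (c) Tangential pairs: an eigenvalue $\tilde\lambda$ of $A^{\rm ext}$ with (generalized) eigenvector $\begin{pmatrix}0\\ \tilde{\mathbf U}\end{pmatrix}$ corresponds to the eigenvalue $\lambda=r_{\mathbf Y_0}^{-k}\tilde\lambda$ of $Dg^{\rm ext}_\ast$ with (generalized) eigenvector $(I-P^{\rm ext}_\ast)\,r_{\mathbf Y_0}^{-\Lambda^{\rm ext}_\alpha}\begin{pmatrix}0\\ \tilde{\mathbf U}\end{pmatrix}$. (II) From $Dg^{\rm ext}_\ast$ to $A^{\rm ext}$. (a) Transversal pair: the eigenvalue $-C_\ast$ of $Dg^{\rm ext}_\ast$, with eigenvector $\mathbf v^{\rm ext}_{\ast,\alpha}$ if $k>1$ and $\tilde{\mathbf v}^{\rm ext}_{\ast,\alpha}$ if $k=1$, corresponds to the eigenvalue $1$ of $A^{\rm ext}$ with eigenvector $\mathbf v^{\rm ext}_{0,\alpha}$. (b) Tangential pair (nonautonomous): the eigenvalue $0$ of $Dg^{\rm ext}_\ast$ with eigenvector $\begin{pmatrix}1\\ -((D_{\mathbf x}g)_\ast)^{-1}(D_tg)_\ast\end{pmatrix}$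 corresponds to the eigenvalue $0$ of $A^{\rm ext}$ with eigenvector $r_{\mathbf x_\ast}^{\Lambda^{\rm ext}_\alpha}\begin{pmatrix}1\\ -((D_{\mathbf x}g)_\ast)^{-1}(D_tg)_\ast\end{pmatrix}$. (c) Tangential pairs: an eigenvalue $\lambda$ of $Dg^{\rm ext}_\ast$ with (generalized) eigenvector $(I-P^{\rm ext}_\ast)\begin{pmatrix}0\\ \tilde{\mathbf u}\end{pmatrix}$ corresponds to the eigenvalue $\tilde\lambda=r_{\mathbf x_\ast}^k\lambda$ of $A^{\rm ext}$ with (generalized) eigenvector $r_{\mathbf x_\ast}^{\Lambda^{\rm ext}_\alpha}(A_g^{\rm ext}-kC_\ast I)\begin{pmatrix}0\\ \tilde{\mathbf u}\end{pmatrix}$. Moreover, the Jordan structure associated with eigenvalues, namely the number of Jordan blocks and their size, is identical except for $kC_\ast\in{\rm Spec}(A_g^{\rm ext})$, if it exists, and $1\in{\rm Spec}(A^{\rm ext})$.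
   Context: Vector field. $n\ge1$, $f:\mathbb R\times\tilde U\to\mathbb R^n$ is $C^r$, $r\ge1$; the ODE $\mathbf y'=f(t,\mathbf y)$ is written in extended form $(t,\mathbf y)'=f^{\rm ext}(t,\mathbf y)=(1,f(t,\mathbf y))^T$, with $f_0\equiv1$. Let $\alpha=(0,\alpha_1,\dots,\alpha_n)$ be nonnegative integers, not all zero, $I_\alpha=\{i:\alpha_i>0\}$, $\Lambda_\alpha={\rm diag}(\alpha_1,\dots,\alpha_n)$, $\Lambda_\alpha^{\rm ext}={\rm diag}(0,\alpha_1,\dots,\alpha_n)$, $s^{\Lambda_\alpha}={\rm diag}(s^{\alpha_1},\dots,s^{\alpha_n})$ and similarly $s^{\Lambda_\alpha^{\rm ext}}$. $\tilde U$ is the set of $\mathbf y$ with $y_i\in\mathbb R$ arbitrary for $i\in I_\alpha$ and the remaining coordinates in some open set. $f$ is asymptotically quasi-homogeneous of type $\alpha$ and order $k+1$ ($k>0$): there is $f_{\alpha,k}=(f_{1;\alpha,k},\dots,f_{n;\alpha,k})^T$ with $f_{i;\alpha,k}(t,s^{\Lambda_\alpha}\mathbf y)=s^{k+\alpha_i}f_{i;\alpha,k}(t,\mathbf y)$ for all $s>0$, and $f_i(t,s^{\Lambda_\alpha}\mathbf y)-s^{k+\alpha_i}f_{i;\alpha,k}(t,\mathbf y)=o(s^{k+\alpha_i})$ as $s\to\infty$, uniformly on $\sum_{i\in I_\alpha}y_i^2=1$ with $t$ and the coordinates $y_j$, $j\notin I_\alpha$, in any compact set. Put $f_{0;\alpha,k}\equiv0$,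 $f^{\rm ext}_{\alpha,k}=(0,f_{\alpha,k})^T$, $f_{i;\rm res}=f_i-f_{i;\alpha,k}$. Embedding and desingularized vector field. $c$ is the least common multiple of $\alpha_i$ ($i\in I_\alpha$), $\beta_i=c/\alpha_i$ for $i\in I_\alpha$ and $\beta_i=0$ otherwise; $p_\alpha(\mathbf x)=(\sum_{i\in I_\alpha}x_i^{2\beta_i})^{1/2c}$; $\kappa_\alpha(\mathbf x)=(1-p_\alpha(\mathbf x)^{2c})^{-1}$; the embedding is $y_j=\kappa_\alpha(\mathbf x)^{\alpha_j}x_j$, $t$ unchanged. $\mathcal D=\{(t,\mathbf x):p_\alpha(\mathbf x)<1\}$; the horizon is $\mathcal E=\{(t,\mathbf x):p_\alpha(\mathbf x)=1\}$. $\tilde f_j(t,\mathbf x)=\kappa_\alpha^{-(k+\alpha_j)}f_j(t,\kappa_\alpha^{\Lambda_\alpha}\mathbf x)$, $j=0,\dots,n$ (so $\tilde f_0=\kappa_\alpha^{-k}$), extended continuously to $\mathcal E$; $\tilde f_{i;\rm res}$ is defined from $f_{i;\rm res}$ in the same way; $\tilde f=(\tilde f_1,\dots,\tilde f_n)^T$, $\tilde f^{\rm ext}=(\tilde f_0,\tilde f)^T$. $G(t,\mathbf x)=\sum_{j\in I_\alpha}\frac{x_j^{2\beta_j-1}}{\alpha_j}\tilde f_j(t,\mathbf x)$. The desingularized vector field on $\mathcal D\cup\mathcal E$ is $$\frac{d}{d\tau}\begin{pmatrix}t\\ \mathbf x\end{pmatrix}=g^{\rm ext}(t,\mathbf x)=\begin{pmatrix}g_0\\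 g\end{pmatrix}=\Big(1-\tfrac{2c-1}{2c}(1-p_\alpha(\mathbf x)^{2c})\Big)\tilde f^{\rm ext}(t,\mathbf x)-G(t,\mathbf x)\Lambda_\alpha^{\rm ext}\begin{pmatrix}t\\ \mathbf x\end{pmatrix},$$ which is smooth up to $\mathcal E$ when $k\ge1$. Assumption (R): $k\ge1$, and there is $\epsilon>0$ such that, as $(t,\mathbf x)$ approaches $\mathcal E$, $\tilde f_{i;\rm res}(t,\mathbf x)=O(\kappa_\alpha(\mathbf x)^{-(1+\epsilon)})$ and $\partial\tilde f_{i;\rm res}/\partial x_l(t,\mathbf x)=o(\kappa_\alpha(\mathbf x)^{1+\epsilon})$ for $i=1,\dots,n$, $l=0,\dots,n$ (with $x_0=t$). Notation at an equilibrium $(t_\ast,\mathbf x_\ast)\in\mathcal E$ of $g^{\rm ext}$. A subscript $\ast$ means evaluation at $(t_\ast,\mathbf x_\ast)$; $I=I_{n+1}$ is the identity matrix; $C_\ast=G(t_\ast,\mathbf x_\ast)$; $Dg^{\rm ext}_\ast$ is the Jacobian of $g^{\rm ext}$ in $(t,\mathbf x)$; $(D_{\mathbf x}g)_\ast,(D_tg)_\ast$ are the $\mathbf x$- and $t$-derivatives of $g$. $(D_{\mathbf x}p_\alpha)_\ast^T=\frac1c(\beta_1x_{\ast,1}^{2\beta_1-1},\dots,\beta_nx_{\ast,n}^{2\beta_n-1})$ (entries with $\alpha_i=0$ are $0$), $(Dp_\alpha)_\ast=(0,(D_{\mathbf x}p_\alpha)_\ast^T)^T$. $\mathbf v_{\ast,\alpha}=\Lambda_\alpha\mathbf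 x_\ast$, $\mathbf v^{\rm ext}_{\ast,\alpha}=(0,\mathbf v_{\ast,\alpha})^T$, $P^{\rm ext}_\ast=\mathbf v^{\rm ext}_{\ast,\alpha}(Dp_\alpha)_\ast^T$ (the projection onto ${\rm span}\{\mathbf v^{\rm ext}_{\ast,\alpha}\}$ along the tangent space $T_{(t_\ast,\mathbf x_\ast)}\mathcal E$). $$A_g^{\rm ext}=-C_\ast\Lambda_\alpha^{\rm ext}+\begin{pmatrix}0&\mathbf 0^T\\ (D_t\tilde f)_\ast&(D_{\mathbf x}\tilde f)_\ast\end{pmatrix}=\begin{pmatrix}0&\mathbf 0^T\\ (D_t\tilde f)_\ast&A_g\end{pmatrix},$$ $$A^{\rm ext}=-\tfrac1k\Lambda_\alpha^{\rm ext}+Df^{\rm ext}_{\alpha,k}(t_\ast,\mathbf Y_0)=\begin{pmatrix}0&\mathbf 0^T\\ D_tf_{\alpha,k}(t_\ast,\mathbf Y_0)&A\end{pmatrix},\qquad \mathbf v^{\rm ext}_{0,\alpha}=\begin{pmatrix}0\\ \Lambda_\alpha\mathbf Y_0\end{pmatrix},$$ where $D$ is the derivative in $(t,\mathbf y)$. For $k=1$, $$\tilde{\mathbf v}^{\rm ext}_{\ast,\alpha}=\begin{pmatrix}1\\ \{\frac{C_\ast}{2c}+d(A_g+C_\ast I_n)^{INV}\}\mathbf v_{\ast,\alpha}-(A_g+C_\ast I_n)^{INV}(D_tg)_\ast\end{pmatrix},\quad d=\frac{(D_{\mathbf x}p_\alpha)_\ast^T(A_g+C_\ast I_n)^{INV}(D_tg)_\ast}{(D_{\mathbf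 x}p_\alpha)_\ast^T(A_g+C_\ast I_n)^{INV}\mathbf v_{\ast,\alpha}}$$ whenever the denominator of $d$ does not vanish, where $(A_g+C_\ast I_n)^{INV}$ denotes the inverse of $A_g+C_\ast I_n$ restricted to the invariant subspace spanned by eigenvectors associated with ${\rm Spec}(A_g)\setminus\{-C_\ast\}$ (the usual inverse if $-C_\ast\notin{\rm Spec}(A_g)$). For $Dg^{\rm ext}_\ast$, "tangential" (generalized) eigenvectors are those in $T_{(t_\ast,\mathbf x_\ast)}\mathcal E$ and "transversal" ones are those transversal to it; the same names are used for the corresponding eigenvectors of $A^{\rm ext}$.
   Formalization: (I)(b),(II)(b): vectors replaced by (I-P)- resp. (A_g-kC)-images; literal ones iff tangential; A, D_xg invertible. k=1: where INV applies. (c): nonzero images. (II) complete at 1 if kC not in Spec(Dg). Jordan blocks of Dg at -C: A's plus a 1-block. *)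

theory Defs
  imports
    "Jordan_Normal_Form.Jordan_Normal_Form"
    "HOL-Library.Landau_Symbols"
    "HOL-Analysis.Analysis"
begin

no_notation Matrix.vec_index (infixl \<open>$\<close> 100)
hide_type (open) Matrix.vec
hide_const (open) Matrix.mat Matrix.vec Matrix.row Matrix.col Determinant.det

section \<open>Extended vectors and matrices\<close>

text \<open>
  The extended phase space \<open>\<real>\<^sup>n\<^sup>+\<^sup>1\<close> is \<open>real ^ ('n option)\<close>: the index \<open>None\<close> plays the role
  of the index 0 (time), and \<open>Some i\<close> that of the spatial index \<open>i\<close>.
\<close>

definition ext :: "'a \<Rightarrow> 'a ^ 'n \<Rightarrow> 'a ^ ('n::finite option)" where
  "ext t x = (\<chi> i. case i of None \<Rightarrow> t | Some j \<Rightarrow> x $ j)"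

definition spat :: "'a ^ ('n::finite option) \<Rightarrow> 'a ^ 'n" where
  "spat z = (\<chi> j. z $ Some j)"

definition block_xx :: "'a ^ ('n::finite option) ^ ('n option) \<Rightarrow> 'a ^ 'n ^ 'n" where
  "block_xx M = (\<chi> i j. M $ Some i $ Some j)"

definition block_xt :: "'a ^ ('n::finite option) ^ ('n option) \<Rightarrow> 'a ^ 'n" where
  "block_xt M = (\<chi> i. M $ Some i $ None)"

text \<open>The block matrix with vanishing time row, \<open>(0, 0; a, M)\<close>.\<close>

definition lower_block :: "'a::zero ^ 'n \<Rightarrow> 'a ^ 'n ^ 'n \<Rightarrow> 'a ^ ('n::finite option) ^ ('n option)" where
  "lower_block a M = (\<chi> i j. case i of None \<Rightarrow> 0
     | Some i' \<Rightarrow> (case j of None \<Rightarrow> a $ i' | Some j' \<Rightarrow> M $ i' $ j'))"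

definition diagm :: "('i \<Rightarrow> 'a::zero) \<Rightarrow> 'a ^ 'i ^ 'i" where
  "diagm d = (\<chi> i j. if i = j then d i else 0)"

text \<open>\<open>diag_powr s a\<close> is \<open>diag (s\<^sup>a\<^sup>i)\<close>; it is only used for \<open>s > 0\<close>.\<close>

definition diag_powr :: "real \<Rightarrow> ('i \<Rightarrow> real) \<Rightarrow> real ^ 'i ^ 'i" where
  "diag_powr s a = diagm (\<lambda>i. s powr a i)"

definition outer :: "'a::times ^ 'i \<Rightarrow> 'a ^ 'j \<Rightarrow> 'a ^ 'j ^ 'i" where
  "outer v w = (\<chi> i j. v $ i * w $ j)"

definition cvec :: "real ^ 'i \<Rightarrow> complex ^ 'i" where
  "cvec v = (\<chi> i. complex_of_real (v $ i))"

abbreviation cmat :: "real ^ 'j ^ 'i \<Rightarrow> complex ^ 'j::finite ^ 'i::finite" where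
  "cmat \<equiv> map_matrix complex_of_real"

text \<open>The bilinear (not sesquilinear) pairing \<open>w\<^sup>T u\<close>.\<close>

definition bdot :: "'a::comm_semiring_1 ^ 'i::finite \<Rightarrow> 'a ^ 'i \<Rightarrow> 'a" where
  "bdot w u = (\<Sum>i\<in>UNIV. w $ i * u $ i)"

section \<open>Eigenpairs, generalized eigenvectors, Jordan blocks\<close>

definition eigenpair :: "complex ^ 'i ^ 'i \<Rightarrow> complex \<Rightarrow> complex ^ 'i::finite \<Rightarrow> bool" where
  "eigenpair M l v \<longleftrightarrow> v \<noteq> 0 \<and> M *v v = l *s v"

definition spec :: "complex ^ 'i ^ 'i \<Rightarrow> complex set" where
  "spec M = {l. \<exists>v :: complex ^ 'i::finite. eigenpair M l v}"

text \<open>Generalized eigenvectors of order at most \<open>m\<close>; those with \<open>m = 1\<close> are the eigenvectors.\<close>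

definition gen_eigenvector :: "complex ^ 'i ^ 'i \<Rightarrow> complex \<Rightarrow> nat \<Rightarrow> complex ^ 'i::finite \<Rightarrow> bool" where
  "gen_eigenvector M l m v \<longleftrightarrow> m \<ge> 1 \<and> v \<noteq> 0 \<and> ((\<lambda>w. (M - mat l) *v w) ^^ m) v = 0"

text \<open>
  The matrix over \<open>{0..<n}\<close> obtained by enumerating the finite index type; Jordan normal forms do
  not depend on the enumeration.
\<close>

definition jnf_mat :: "complex ^ 'i ^ 'i \<Rightarrow> complex Matrix.mat" where
  "jnf_mat M = Matrix.mat CARD('i::finite) CARD('i)
     (\<lambda>(a, b). M $ from_nat_into UNIV a $ from_nat_into UNIV b)"

text \<open>
  \<open>reduced_space M l\<close> is the sum of the generalized eigenspaces of \<open>M\<close> for the eigenvalues other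
  than \<open>l\<close>, and \<open>reduced_inverse M l\<close> is the inverse of the restriction of \<open>M - l I\<close> to it.
  For \<open>l\<close> not an eigenvalue this is the whole space and the usual inverse; outside of
  \<open>reduced_space M l\<close> the value of \<open>reduced_inverse M l\<close> is meaningless.
\<close>

definition reduced_space :: "complex ^ 'i ^ 'i \<Rightarrow> complex \<Rightarrow> (complex ^ 'i::finite) set" where
  "reduced_space M l = vec.span {v. \<exists>l' m. l' \<noteq> l \<and> gen_eigenvector M l' m v}"

definition reduced_inverse :: "complex ^ 'i ^ 'i \<Rightarrow> complex \<Rightarrow> complex ^ 'i \<Rightarrow> complex ^ 'i::finite" where
  "reduced_inverse M l y = (THE u. u \<in> reduced_space M l \<and> (M - mat l) *v u = y)"

section \<open>Asymptotically quasi-homogeneous vector fields\<close>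

text \<open>The type \<open>(0, \<alpha>\<^sub>1, \<dots>, \<alpha>\<^sub>n)\<close>, as real exponents.\<close>

definition alpha_ext :: "('n \<Rightarrow> nat) \<Rightarrow> 'n option \<Rightarrow> real" where
  "alpha_ext \<alpha> i = (case i of None \<Rightarrow> 0 | Some j \<Rightarrow> real (\<alpha> j))"

definition I_set :: "('n \<Rightarrow> nat) \<Rightarrow> 'n set" where
  "I_set \<alpha> = {i. \<alpha> i > 0}"

text \<open>\<open>U\<close> is open and is a cylinder: the coordinates in \<open>I_set \<alpha>\<close> are arbitrary.\<close>

definition phase_domain :: "('n \<Rightarrow> nat) \<Rightarrow> (real ^ 'n::finite) set \<Rightarrow> bool" where
  "phase_domain \<alpha> U \<longleftrightarrow> open U \<and>
     (\<forall>y\<in>U. \<forall>y'. (\<forall>j. j \<notin> I_set \<alpha> \<longrightarrow> y' $ j = y $ j) \<longrightarrow> y' \<in> U)"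

definition C1_on :: "'a::real_normed_vector set \<Rightarrow> ('a \<Rightarrow> 'b::real_normed_vector) \<Rightarrow> bool" where
  "C1_on S F \<longleftrightarrow> (\<exists>F'. (\<forall>z\<in>S. (F has_derivative blinfun_apply (F' z)) (at z)) \<and> continuous_on S F')"

text \<open>
  In the asymptotic condition, \<open>K\<close> ranges over the compact subsets of \<open>\<real> \<times> U\<close>. As the unit sphere
  in the coordinates of \<open>I_set \<alpha>\<close> is compact, this is the same as letting \<open>t\<close> and the remaining
  coordinates range over compact sets.
\<close>

definition asymp_quasi_homogeneous ::
  "('n \<Rightarrow> nat) \<Rightarrow> real \<Rightarrow> (real ^ 'n::finite) set \<Rightarrow>
   (real \<Rightarrow> real ^ 'n \<Rightarrow> real ^ 'n) \<Rightarrow> (real \<Rightarrow> real ^ 'n \<Rightarrow> real ^ 'n) \<Rightarrow> bool" where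
  "asymp_quasi_homogeneous \<alpha> k U f f\<alpha> \<longleftrightarrow>
     (\<forall>t. \<forall>y\<in>U. \<forall>s>0. \<forall>i.
        f\<alpha> t (diag_powr s (\<lambda>i. real (\<alpha> i)) *v y) $ i = s powr (k + real (\<alpha> i)) * f\<alpha> t y $ i) \<and>
     (\<forall>K i. compact K \<longrightarrow> K \<subseteq> UNIV \<times> U \<longrightarrow>
        uniform_limit (K \<inter> {(t, y). (\<Sum>j\<in>I_set \<alpha>. (y $ j)\<^sup>2) = 1})
          (\<lambda>s (t, y). (f t (diag_powr s (\<lambda>i. real (\<alpha> i)) *v y) $ i
                          - s powr (k + real (\<alpha> i)) * f\<alpha> t y $ i) / s powr (k + real (\<alpha> i)))
          (\<lambda>_. 0) at_top)"

section \<open>Embedding and desingularized vector field\<close>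

definition c_lcm :: "('n \<Rightarrow> nat) \<Rightarrow> nat" where
  "c_lcm \<alpha> = Lcm (\<alpha> ` I_set \<alpha>)"

definition beta :: "('n \<Rightarrow> nat) \<Rightarrow> 'n \<Rightarrow> nat" where
  "beta \<alpha> i = (if i \<in> I_set \<alpha> then c_lcm \<alpha> div \<alpha> i else 0)"

definition p_alpha :: "('n \<Rightarrow> nat) \<Rightarrow> real ^ 'n::finite \<Rightarrow> real" where
  "p_alpha \<alpha> x = (\<Sum>i\<in>I_set \<alpha>. x $ i ^ (2 * beta \<alpha> i)) powr (1 / (2 * real (c_lcm \<alpha>)))"

definition kappa :: "('n \<Rightarrow> nat) \<Rightarrow> real ^ 'n::finite \<Rightarrow> real" where
  "kappa \<alpha> x = 1 / (1 - p_alpha \<alpha> x ^ (2 * c_lcm \<alpha>))"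

definition domD :: "('n \<Rightarrow> nat) \<Rightarrow> (real ^ 'n::finite) set \<Rightarrow> (real ^ ('n option)) set" where
  "domD \<alpha> U = {z. spat z \<in> U \<and> p_alpha \<alpha> (spat z) < 1}"

definition horizon :: "('n \<Rightarrow> nat) \<Rightarrow> (real ^ 'n::finite) set \<Rightarrow> (real ^ ('n option)) set" where
  "horizon \<alpha> U = {z. spat z \<in> U \<and> p_alpha \<alpha> (spat z) = 1}"

definition f_ext :: "(real \<Rightarrow> real ^ 'n \<Rightarrow> real ^ 'n) \<Rightarrow> real ^ ('n::finite option) \<Rightarrow> real ^ ('n option)" where
  "f_ext f z = ext 1 (f (z $ None) (spat z))"

definition f\<alpha>_ext :: "(real \<Rightarrow> real ^ 'n \<Rightarrow> real ^ 'n) \<Rightarrow> real ^ ('n::finite option) \<Rightarrow> real ^ ('n option)" where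
  "f\<alpha>_ext f\<alpha> z = ext 0 (f\<alpha> (z $ None) (spat z))"

text \<open>\<open>\<kappa>\<^sup>-\<^sup>(\<^sup>k\<^sup>+\<^sup>\<alpha>\<^sup>j\<^sup>) F\<^sub>j(t, \<kappa>\<^sup>\<Lambda> x)\<close> on \<open>domD \<alpha> U\<close>, for an extended field \<open>F\<close>.\<close>

definition rescaled :: "('n \<Rightarrow> nat) \<Rightarrow> real \<Rightarrow> (real ^ ('n::finite option) \<Rightarrow> real ^ ('n option)) \<Rightarrow>
    real ^ ('n option) \<Rightarrow> real ^ ('n option)" where
  "rescaled \<alpha> k F z = (\<chi> j. kappa \<alpha> (spat z) powr (- (k + alpha_ext \<alpha> j))
      * F (diag_powr (kappa \<alpha> (spat z)) (alpha_ext \<alpha>) *v z) $ j)"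

text \<open>The continuous extension to the horizon is given by the limit from the inside.\<close>

definition f_tilde :: "('n \<Rightarrow> nat) \<Rightarrow> real \<Rightarrow> (real ^ 'n) set \<Rightarrow> (real \<Rightarrow> real ^ 'n \<Rightarrow> real ^ 'n) \<Rightarrow>
    real ^ ('n::finite option) \<Rightarrow> real ^ ('n option)" where
  "f_tilde \<alpha> k U f z = (if z \<in> domD \<alpha> U then rescaled \<alpha> k (f_ext f) z
      else Lim (at z within domD \<alpha> U) (rescaled \<alpha> k (f_ext f)))"

definition f_tilde_res :: "('n \<Rightarrow> nat) \<Rightarrow> real \<Rightarrow> (real \<Rightarrow> real ^ 'n \<Rightarrow> real ^ 'n) \<Rightarrow>
    (real \<Rightarrow> real ^ 'n \<Rightarrow> real ^ 'n) \<Rightarrow> real ^ ('n::finite option) \<Rightarrow> real ^ ('n option)" where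
  "f_tilde_res \<alpha> k f f\<alpha> = rescaled \<alpha> k (\<lambda>z. f_ext f z - f\<alpha>_ext f\<alpha> z)"

definition G :: "('n \<Rightarrow> nat) \<Rightarrow> real \<Rightarrow> (real ^ 'n) set \<Rightarrow> (real \<Rightarrow> real ^ 'n \<Rightarrow> real ^ 'n) \<Rightarrow>
    real ^ ('n::finite option) \<Rightarrow> real" where
  "G \<alpha> k U f z = (\<Sum>j\<in>I_set \<alpha>. spat z $ j ^ (2 * beta \<alpha> j - 1) / real (\<alpha> j) * f_tilde \<alpha> k U f z $ Some j)"

definition g_ext :: "('n \<Rightarrow> nat) \<Rightarrow> real \<Rightarrow> (real ^ 'n) set \<Rightarrow> (real \<Rightarrow> real ^ 'n \<Rightarrow> real ^ 'n) \<Rightarrow>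
    real ^ ('n::finite option) \<Rightarrow> real ^ ('n option)" where
  "g_ext \<alpha> k U f z =
     (let c = real (c_lcm \<alpha>) in
      (1 - (2 * c - 1) / (2 * c) * (1 - p_alpha \<alpha> (spat z) ^ (2 * c_lcm \<alpha>))) *\<^sub>R f_tilde \<alpha> k U f z
      - G \<alpha> k U f z *\<^sub>R (diagm (alpha_ext \<alpha>) *v z))"

text \<open>
  The asymptotic bounds on the residual field are required at each point of the horizon, with a common
  exponent; \<open>d\<close> is the partial derivative in the direction of the coordinate \<open>l\<close>, with
  \<open>l = None\<close> for time.
\<close>

definition residual_assumption :: "('n \<Rightarrow> nat) \<Rightarrow> real \<Rightarrow> (real ^ 'n) set \<Rightarrow>
    (real \<Rightarrow> real ^ 'n \<Rightarrow> real ^ 'n) \<Rightarrow> (real \<Rightarrow> real ^ 'n \<Rightarrow> real ^ 'n::finite) \<Rightarrow> bool" where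
  "residual_assumption \<alpha> k U f f\<alpha> \<longleftrightarrow> k \<ge> 1 \<and>
     (\<exists>\<epsilon>>0. \<forall>z0\<in>horizon \<alpha> U. \<forall>i.
        (\<lambda>z. f_tilde_res \<alpha> k f f\<alpha> z $ Some i)
            \<in> O[at z0 within domD \<alpha> U](\<lambda>z. kappa \<alpha> (spat z) powr (- (1 + \<epsilon>))) \<and>
        (\<forall>l. \<exists>d. (\<forall>\<^sub>F z in at z0 within domD \<alpha> U.
                    ((\<lambda>s. f_tilde_res \<alpha> k f f\<alpha> (z + s *\<^sub>R axis l 1) $ Some i)
                       has_real_derivative d z) (at 0)) \<and>
                d \<in> o[at z0 within domD \<alpha> U](\<lambda>z. kappa \<alpha> (spat z) powr (1 + \<epsilon>))))"

section \<open>Linearization at the horizon\<close>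

text \<open>The gradient of \<open>p_alpha \<alpha>\<close> at a point where \<open>p_alpha \<alpha> x = 1\<close>.\<close>

definition Dx_p :: "('n \<Rightarrow> nat) \<Rightarrow> real ^ 'n \<Rightarrow> real ^ 'n" where
  "Dx_p \<alpha> x = (\<chi> i. real (beta \<alpha> i) * x $ i ^ (2 * beta \<alpha> i - 1) / real (c_lcm \<alpha>))"

text \<open>
  The spatial part of the transversal eigenvector for \<open>k = 1\<close>, with \<open>C = C\<^sub>*\<close>, \<open>w = (D\<^sub>x p)\<^sub>*\<close>,
  \<open>v = v\<^sub>*\<close>, \<open>b = (D\<^sub>t g)\<^sub>*\<close>. It is defined if the restricted inverse applies to \<open>v\<close> and \<open>b\<close>, i.e. if
  both lie in the invariant subspace, and if the denominator of \<open>d\<close> does not vanish.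
\<close>

definition tilde_v_defined ::
  "real ^ 'n ^ 'n \<Rightarrow> real \<Rightarrow> real ^ 'n \<Rightarrow> real ^ 'n \<Rightarrow> real ^ 'n::finite \<Rightarrow> bool" where
  "tilde_v_defined Ag C w v b \<longleftrightarrow>
     (let l = complex_of_real (- C) in
      cvec v \<in> reduced_space (cmat Ag) l \<and> cvec b \<in> reduced_space (cmat Ag) l \<and>
      bdot (cvec w) (reduced_inverse (cmat Ag) l (cvec v)) \<noteq> 0)"

definition tilde_v ::
  "nat \<Rightarrow> real ^ 'n ^ 'n \<Rightarrow> real \<Rightarrow> real ^ 'n \<Rightarrow> real ^ 'n \<Rightarrow> real ^ 'n \<Rightarrow> complex ^ ('n::finite option)" where
  "tilde_v c Ag C w v b =
     (let T = reduced_inverse (cmat Ag) (complex_of_real (- C));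
          d = bdot (cvec w) (T (cvec b)) / bdot (cvec w) (T (cvec v))
      in ext 1 (complex_of_real (C / (2 * real c)) *s cvec v + d *s T (cvec v) - T (cvec b)))"

end

theory Submission
  imports Defs "Jordan_Normal_Form.Jordan_Normal_Form_Uniqueness"
begin

no_notation Matrix.vec_index (infixl \<open>$\<close> 100)
no_notation Matrix.scalar_prod (infix \<open>\<bullet>\<close> 70)
hide_type (open) Matrix.vec
hide_const (open) Matrix.mat Matrix.vec Matrix.row Matrix.col Determinant.det

text \<open>
  Write \<open>q = p\<^sup>2\<^sup>c\<close>, so that \<open>\<kappa> = 1 / (1 - q)\<close>, let \<open>v\<close> and \<open>w\<close> be the extended vectors \<open>\<Lambda> x\<^sub>*\<close> and
  \<open>D p\<close> at the equilibrium, and let \<open>P = v w\<^sup>T\<close>. Then \<open>w\<^sup>T v = 1\<close>.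
  
  The analytic part computes the linearization at the horizon. Inside the domain the rescaled field is
  the sum of the quasi-homogeneous field \<open>f\<^sub>\<alpha>\<close> and of a residual part, and the residual part is
  \<open>O((1 - q)\<^sup>1\<^sup>+\<^sup>\<epsilon>)\<close>. It therefore vanishes on the horizon together with its first derivative, and the
  spatial components of the rescaled field have the value and the derivative of \<open>f\<^sub>\<alpha>\<close> there
  (\<open>f_tilde_horizon\<close>, \<open>f_tilde_has_derivative\<close>). Its time component is \<open>(1 - q)\<^sup>k\<close>, whose derivative
  at the horizon is zero for \<open>k > 1\<close> and \<open>- 2 c w\<^sup>T\<close> for \<open>k = 1\<close>. With \<open>B = A\<^sub>g\<^sup>e\<^sup>x\<^sup>t\<close>, \<open>J = Dg\<^sup>e\<^sup>x\<^sup>t\<close> and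
  \<open>e\<^sub>0\<close> the time direction, the product rule gives (\<open>g_has_derivative\<close>)
  
    \<open>J = (I - P) B - C P - [k = 1] 2 c e\<^sub>0 w\<^sup>T\<close>.
  
  The domain with its horizon is a set with boundary, so that these derivatives determine the Jacobians
  only after a uniqueness argument (\<open>derivative_unique_of_cone\<close>, \<open>jacobian_within_DE\<close>).
  
  Quasi-homogeneity enters twice. Euler's identity gives \<open>B v = k C v\<close> (\<open>B_vE\<close>), and moving the base
  point from \<open>x\<^sub>*\<close> to \<open>Y\<^sub>0\<close> along the dilation \<open>R = r\<^sup>\<Lambda>\<close> gives \<open>A\<^sup>e\<^sup>x\<^sup>t = (k C)\<^sup>-\<^sup>1 R B R\<^sup>-\<^sup>1\<close>
  (\<open>Ae_dilate\<close>). The balance law forces \<open>r\<^sup>k k C = 1\<close>, and so \<open>C > 0\<close>.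
  
  The rest is linear algebra for a pair of matrices with
  
    \<open>B v = k C v\<close>,   \<open>J (I - P) = (I - P) B\<close>,   \<open>w\<^sup>T J = - C w\<^sup>T\<close>.
  
  They say that \<open>J\<close> acts on the hyperplane \<open>w\<^sup>T u = 0\<close> as \<open>B\<close> acts on the quotient by \<open>v\<close>, and as \<open>- C\<close> on the
  quotient by that hyperplane: the eigenvalue \<open>k C\<close> of \<open>B\<close> is exchanged for \<open>- C\<close>. This is the locale
  \<open>deflation\<close>. The projection \<open>I - P\<close> carries generalized eigenvectors of \<open>B\<close> to those of \<open>J\<close>. In the
  other direction a generalized eigenvector \<open>(I - P) u\<close> of \<open>J\<close> only determines \<open>u\<close> up to multiples of \<open>v\<close>,
  and the factor \<open>B - k C\<close> in correspondence (II) removes this ambiguity, as it annihilates \<open>v\<close>.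
  Away from \<open>k C\<close> and \<open>- C\<close> the projection is a bijection between generalized eigenspaces, and at \<open>- C\<close>
  the transversal eigenvector adds one dimension to each of them. As the dimensions of the kernels of
  \<open>(M - l)\<^sup>m\<close> determine the Jordan blocks, this settles the Jordan structure.
\<close>

section \<open>Jordan blocks from dimensions of generalized eigenspaces\<close>

text \<open>
  The enumeration of the index type behind \<open>jnf_mat\<close>, applied to vectors. It identifies the kernel of a
  matrix over a finite index type with the kernel of its enumerated copy, and the library computes the
  number of Jordan blocks from dimensions of such kernels.
\<close>

definition jnf_vec :: "complex ^ 'i \<Rightarrow> complex Matrix.vec" where
  "jnf_vec v = Matrix.vec CARD('i::finite) (\<lambda>a. v $ from_nat_into UNIV a)"

lemma bij_enum: "bij_betw (from_nat_into UNIV) {..<CARD('i::finite)} (UNIV :: 'i set)"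
  by (rule bij_betw_from_nat_into_finite) simp

lemma sum_enum: "(\<Sum>a<CARD('i::finite). h (from_nat_into UNIV a :: 'i)) = (\<Sum>i\<in>UNIV. h i)"
  using sum.reindex_bij_betw[OF bij_enum] .

lemma enum_surj: obtains a where "a < CARD('i::finite)" "i = (from_nat_into UNIV a :: 'i)"
proof -
  have "i \<in> from_nat_into UNIV ` {..<CARD('i)}"
    using bij_enum[where 'i='i] by (simp add: bij_betw_def)
  then show ?thesis using that by auto
qed

lemma jnf_vec_carrier [simp]: "jnf_vec (v :: complex ^ 'i::finite) \<in> carrier_vec CARD('i)"
  and dim_jnf_vec [simp]: "dim_vec (jnf_vec v) = CARD('i)"
  and jnf_vec_index [simp]: "a < CARD('i) \<Longrightarrow> vec_index (jnf_vec v) a = v $ from_nat_into UNIV a"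
  by (auto simp: jnf_vec_def)

lemma jnf_vec_surj:
  assumes "x \<in> carrier_vec CARD('i::finite)"
  obtains v :: "complex ^ 'i" where "x = jnf_vec v"
proof
  let ?v = "(\<chi> i. vec_index x (the_inv_into {..<CARD('i)} (from_nat_into UNIV) i)) :: complex ^ 'i"
  show "x = jnf_vec ?v"
    using assms by (intro eq_vecI) (auto simp: the_inv_into_f_f[OF bij_betw_imp_inj_on[OF bij_enum]])
qed

lemma jnf_vec_inj: "inj (jnf_vec :: complex ^ 'i::finite \<Rightarrow> _)"
proof (rule injI)
  fix v w :: "complex ^ 'i" assume *: "jnf_vec v = jnf_vec w"
  have "v $ i = w $ i" for i
    by (rule enum_surj[of i]) (metis * jnf_vec_index)
  then show "v = w" by (simp add: vec_eq_iff)
qed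

lemma jnf_vec_0: "jnf_vec (0 :: complex ^ 'i::finite) = 0\<^sub>v CARD('i)"
  by (intro eq_vecI) auto

lemma jnf_mat_carrier [simp]: "jnf_mat (M :: complex ^ 'i ^ 'i::finite) \<in> carrier_mat CARD('i) CARD('i)"
  by (simp add: jnf_mat_def)

lemma jnf_mat_mult_vec: "jnf_mat M *\<^sub>v jnf_vec v = jnf_vec (M *v v)"
  for M :: "complex ^ 'i ^ 'i::finite"
proof (rule eq_vecI)
  fix a assume "a < dim_vec (jnf_vec (M *v v))"
  then have a: "a < CARD('i)" by simp
  have "vec_index (jnf_mat M *\<^sub>v jnf_vec v) a
      = (\<Sum>b<CARD('i). M $ from_nat_into UNIV a $ from_nat_into UNIV b * v $ from_nat_into UNIV b)"
    using a by (auto simp: jnf_mat_def scalar_prod_def lessThan_atLeast0)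
  also have "\<dots> = (M *v v) $ from_nat_into UNIV a"
    by (simp add: matrix_vector_mult_def sum_enum[of "\<lambda>i. M $ from_nat_into UNIV a $ i * v $ i"])
  finally show "vec_index (jnf_mat M *\<^sub>v jnf_vec v) a = vec_index (jnf_vec (M *v v)) a"
    using a by simp
qed (simp add: jnf_mat_def)

lemma jnf_mat_mult: "jnf_mat M * jnf_mat N = jnf_mat (M ** N)"
  for M N :: "complex ^ 'i ^ 'i::finite"
proof (rule eq_matI)
  fix a b assume "a < dim_row (jnf_mat (M ** N))" "b < dim_col (jnf_mat (M ** N))"
  then have ab: "a < CARD('i)" "b < CARD('i)" by (auto simp: jnf_mat_def)
  have "(jnf_mat M * jnf_mat N) $$ (a, b)
     = (\<Sum>c<CARD('i). M $ from_nat_into UNIV a $ from_nat_into UNIV c * N $ from_nat_into UNIV c $ from_nat_into UNIV b)"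
    using ab by (auto simp: jnf_mat_def scalar_prod_def lessThan_atLeast0)
  also have "\<dots> = (M ** N) $ from_nat_into UNIV a $ from_nat_into UNIV b"
    by (simp add: matrix_matrix_mult_def
        sum_enum[of "\<lambda>i. M $ from_nat_into UNIV a $ i * N $ i $ from_nat_into UNIV b"])
  finally show "(jnf_mat M * jnf_mat N) $$ (a, b) = jnf_mat (M ** N) $$ (a, b)"
    using ab by (simp add: jnf_mat_def)
qed (auto simp: jnf_mat_def)

lemma jnf_mat_1: "jnf_mat (mat 1 :: complex ^ 'i ^ 'i::finite) = 1\<^sub>m CARD('i)"
proof (rule eq_matI)
  fix a b assume "a < dim_row (1\<^sub>m CARD('i) :: complex Matrix.mat)" "b < dim_col (1\<^sub>m CARD('i) :: complex Matrix.mat)"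
  then have ab: "a < CARD('i)" "b < CARD('i)" by auto
  then have "(from_nat_into UNIV a = (from_nat_into UNIV b :: 'i)) = (a = b)"
    using bij_betw_imp_inj_on[OF bij_enum[where 'i='i]] by (auto simp: inj_on_def)
  then show "jnf_mat (mat 1 :: complex ^ 'i ^ 'i) $$ (a, b) = 1\<^sub>m CARD('i) $$ (a, b)"
    using ab by (simp add: jnf_mat_def mat_def)
qed (auto simp: jnf_mat_def)

lemma char_matrix_jnf_mat: "char_matrix (jnf_mat M) l = jnf_mat (M - mat l)"
  for M :: "complex ^ 'i ^ 'i::finite"
proof (rule eq_matI)
  fix a b assume "a < dim_row (jnf_mat (M - mat l))" "b < dim_col (jnf_mat (M - mat l))"
  then have ab: "a < CARD('i)" "b < CARD('i)" by (auto simp: jnf_mat_def)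
  then have "(from_nat_into UNIV a = (from_nat_into UNIV b :: 'i)) = (a = b)"
    using bij_betw_imp_inj_on[OF bij_enum[where 'i='i]] by (auto simp: inj_on_def)
  then show "char_matrix (jnf_mat M) l $$ (a, b) = jnf_mat (M - mat l) $$ (a, b)"
    using ab by (simp add: char_matrix_def jnf_mat_def mat_def)
qed (auto simp: jnf_mat_def char_matrix_def)

lemma kernel_dim_jnf_mat: "kernel_dim (jnf_mat M) = vec.dim {v. M *v v = 0}"
  for M :: "complex ^ 'i ^ 'i::finite"
proof -
  interpret K: kernel "CARD('i)" "CARD('i)" "jnf_mat M" by unfold_locales simp
  obtain B where B: "B \<subseteq> {v. M *v v = 0}" "vec.independent B" "{v. M *v v = 0} \<subseteq> vec.span B"
    "card B = vec.dim {v. M *v v = 0}"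
    using vec.basis_exists by blast
  have fin: "finite B" using B(2) by (rule vec.finiteI_independent)
  have inj: "inj_on jnf_vec B" using jnf_vec_inj inj_on_subset by blast
  have sub: "jnf_vec ` B \<subseteq> mat_kernel (jnf_mat M)"
    using B(1) by (auto intro!: mat_kernelI[OF jnf_mat_carrier] simp: jnf_mat_mult_vec jnf_vec_0)
  have comb: "K.lincomb a (jnf_vec ` B) = jnf_vec (\<Sum>b\<in>B. a (jnf_vec b) *s b)" for a
  proof (rule eq_vecI)
    have "K.lincomb a (jnf_vec ` B) \<in> carrier_vec CARD('i)"
      by (metis K.Ker.lincomb_closed[OF sub] K.A mat_kernelD(1) Pi_UNIV UNIV_I)
    then show "dim_vec (K.lincomb a (jnf_vec ` B)) = dim_vec (jnf_vec (\<Sum>b\<in>B. a (jnf_vec b) *s b))"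
      by auto
    fix i assume "i < dim_vec (jnf_vec (\<Sum>b\<in>B. a (jnf_vec b) *s b))"
    then have i: "i < CARD('i)" by simp
    show "vec_index (K.lincomb a (jnf_vec ` B)) i = vec_index (jnf_vec (\<Sum>b\<in>B. a (jnf_vec b) *s b)) i"
      using i by (simp add: K.lincomb_index[OF i sub] sum.reindex[OF inj] sum_component)
  qed
  have "K.basis (jnf_vec ` B)"
    unfolding K.Ker.basis_def
  proof (intro conjI sub)
    show "K.lin_indpt (jnf_vec ` B)"
    proof (rule K.Ker.finite_lin_indpt2[OF _ sub])
      fix a assume "K.lincomb a (jnf_vec ` B) = 0\<^sub>v CARD('i)"
      then have "(\<Sum>b\<in>B. a (jnf_vec b) *s b) = 0"
        unfolding comb jnf_vec_0[symmetric] using jnf_vec_inj by (auto dest: injD)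
      then show "\<forall>v\<in>jnf_vec ` B. a v = 0"
        using B(2) fin vec.independentD[OF B(2) fin subset_refl, of "\<lambda>b. a (jnf_vec b)"] by blast
    qed (use fin in auto)
    show "K.span (jnf_vec ` B) = mat_kernel (jnf_mat M)"
    proof
      show "K.span (jnf_vec ` B) \<subseteq> mat_kernel (jnf_mat M)"
        using K.Ker.span_closed[OF sub] by blast
      show "mat_kernel (jnf_mat M) \<subseteq> K.span (jnf_vec ` B)"
      proof
        fix x assume "x \<in> mat_kernel (jnf_mat M)"
        then have x: "x \<in> carrier_vec CARD('i)" "jnf_mat M *\<^sub>v x = 0\<^sub>v CARD('i)"
          using mat_kernelD[OF jnf_mat_carrier] by blast+
        obtain v :: "complex ^ 'i" where v: "x = jnf_vec v" using jnf_vec_surj[OF x(1)] .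
        have "M *v v = 0"
          using x(2) jnf_vec_inj by (auto simp: v jnf_mat_mult_vec jnf_vec_0[symmetric] dest: injD)
        then have "v \<in> vec.span B" using B(3) by blast
        then obtain u where u: "v = (\<Sum>b\<in>B. u b *s b)"
          unfolding vec.span_finite[OF fin] by blast
        have "x = K.lincomb (\<lambda>y. u (the_inv_into B jnf_vec y)) (jnf_vec ` B)"
          unfolding comb v u by (intro arg_cong[of _ _ jnf_vec] sum.cong refl) (simp add: the_inv_into_f_f[OF inj])
        then show "x \<in> K.span (jnf_vec ` B)"
          unfolding K.Ker.span_def using fin by blast
      qed
    qed
  qed
  then have "K.dim = card (jnf_vec ` B)" using fin by (intro K.Ker.dim_basis) auto
  then show ?thesis using B(4) by (simp add: card_image[OF inj])
qed

primrec mpow :: "complex ^ 'i ^ 'i \<Rightarrow> nat \<Rightarrow> complex ^ 'i ^ 'i::finite" where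
  "mpow M 0 = mat 1"
| "mpow M (Suc j) = mpow M j ** M"

lemma jnf_mat_power: "jnf_mat M ^\<^sub>m j = jnf_mat (mpow M j)"
  by (induction j) (simp_all add: jnf_mat_1 jnf_mat_mult, simp add: jnf_mat_def)

lemma mpow_vec: "mpow M j *v v = ((\<lambda>w. M *v w) ^^ j) v"
  by (induction j arbitrary: v) (simp_all add: funpow_Suc_right matrix_vector_mul_assoc[symmetric] del: funpow.simps)

definition gen_eigenspace :: "complex ^ 'i ^ 'i \<Rightarrow> complex \<Rightarrow> nat \<Rightarrow> (complex ^ 'i::finite) set" where
  "gen_eigenspace M l m = {v. ((\<lambda>w. (M - mat l) *v w) ^^ m) v = 0}"

lemma dim_gen_eigenspace_jnf_mat: "dim_gen_eigenspace (jnf_mat M) l m = vec.dim (gen_eigenspace M l m)"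
  by (simp add: dim_gen_eigenspace_def char_matrix_jnf_mat jnf_mat_power kernel_dim_jnf_mat mpow_vec
      gen_eigenspace_def)

text \<open>
  The number of blocks of size \<open>m\<close> is the negative second difference of the kernel dimensions
  \<open>dim ker (M - l)\<^sup>m\<close>. The natural subtraction is harmless, as these dimensions are increasing and concave in \<open>m\<close>.
\<close>

lemma count_jordan_blocks:
  assumes "jordan_nf (jnf_mat M) bs"
  shows "count_list bs (m, l) = (if m = 0 then 0 else
     2 * vec.dim (gen_eigenspace M l m) - vec.dim (gen_eigenspace M l (m - 1)) - vec.dim (gen_eigenspace M l (Suc m)))"
proof (cases "m = 0")
  case True
  then show ?thesis using assms by (force simp: jordan_nf_def count_list_0_iff)
next
  case False
  then show ?thesis
    using compute_nr_of_jordan_blocks[OF assms False, of l]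
    by (simp add: compute_nr_of_jordan_blocks_def dim_gen_eigenspace_jnf_mat count_list_eq_length_filter)
qed

section \<open>Generalized eigenspaces\<close>

abbreviation shift :: "complex ^ 'i ^ 'i \<Rightarrow> complex \<Rightarrow> complex ^ 'i \<Rightarrow> complex ^ 'i::finite" where
  "shift M l \<equiv> (\<lambda>w. (M - mat l) *v w)"

lemma mat_mult_vec: "mat l *v u = l *s u" for u :: "'a::semiring_1 ^ 'i::finite"
  by (simp add: vec_eq_iff matrix_vector_mult_def mat_def if_distrib[of "\<lambda>x. x * _"] cong: if_cong)

lemma shift_apply: "shift M l u = M *v u - l *s u"
  by (simp add: matrix_vector_mult_diff_rdistrib mat_mult_vec)

lemma linear_shift_power: "Vector_Spaces.linear (*s) (*s) (shift M l ^^ m)"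
proof (induction m)
  case 0
  show ?case by (simp add: vec.linear_id[unfolded id_def])
next
  case (Suc m)
  show ?case
    using Vector_Spaces.linear_compose[OF Suc matrix_vector_mul_linear_gen[of "M - mat l"]]
    by (simp add: comp_def)
qed

lemma shift_power_simps:
  "(shift M l ^^ m) 0 = 0"
  "(shift M l ^^ m) (u + u') = (shift M l ^^ m) u + (shift M l ^^ m) u'"
  "(shift M l ^^ m) (u - u') = (shift M l ^^ m) u - (shift M l ^^ m) u'"
  "(shift M l ^^ m) (a *s u) = a *s (shift M l ^^ m) u"
  by (rule vec.linear_0[OF linear_shift_power] vec.linear_add[OF linear_shift_power]
      vec.linear_diff[OF linear_shift_power] vec.linear_scale[OF linear_shift_power])+

lemma gen_eigenspace_iff: "u \<in> gen_eigenspace M l m \<longleftrightarrow> (shift M l ^^ m) u = 0"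
  by (simp add: gen_eigenspace_def)

lemma gen_eigenvector_iff: "gen_eigenvector M l m u \<longleftrightarrow> m \<ge> 1 \<and> u \<noteq> 0 \<and> u \<in> gen_eigenspace M l m"
  by (simp add: gen_eigenvector_def gen_eigenspace_def)

lemma subspace_gen_eigenspace: "vec.subspace (gen_eigenspace M l m)"
  by (auto simp: vec.subspace_def gen_eigenspace_iff shift_power_simps)

lemma gen_eigenspace_Suc: "u \<in> gen_eigenspace M l m \<Longrightarrow> u \<in> gen_eigenspace M l (Suc m)"
  by (simp add: gen_eigenspace_iff)

lemma funpow_intertwine:
  assumes "\<And>x. h (f x) = g (h x)"
  shows "h ((f ^^ m) x) = (g ^^ m) (h x)"
  by (induction m) (simp_all add: assms)

lemma shift_power_eigenvector:
  assumes "M *v u = \<nu> *s u"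
  shows "(shift M l ^^ m) u = (\<nu> - l) ^ m *s u"
proof (induction m)
  case (Suc m)
  have "shift M l u = (\<nu> - l) *s u"
    by (simp only: shift_apply assms vec.scale_left_diff_distrib)
  moreover have "(shift M l ^^ Suc m) u = (\<nu> - l) ^ m *s shift M l u"
    by (simp add: Suc vec.scale)
  ultimately show ?case by (simp only: vector_smult_assoc power_Suc2)
qed simp

lemma eigenvector_gen_eigenspace: "M *v u = l *s u \<Longrightarrow> u \<in> gen_eigenspace M l (Suc m)"
  using shift_power_eigenvector[of M u l "Suc m" l] by (simp add: gen_eigenspace_iff del: funpow.simps)

lemma eigenvector_in_gen_eigenspace:
  assumes "u \<in> gen_eigenspace M l m" "M *v u = \<nu> *s u" "\<nu> \<noteq> l"
  shows "u = 0"
  using assms(1,3) by (simp add: gen_eigenspace_iff shift_power_eigenvector[OF assms(2)])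

lemma dim_linear_bij:
  assumes "Vector_Spaces.linear (*s) (*s) (h :: complex ^ 'i::finite \<Rightarrow> complex ^ 'j::finite)"
    and "vec.subspace V" "inj_on h V" "h ` V = W"
  shows "vec.dim W = vec.dim V"
proof -
  have "vec.span V = V" using assms(2) by (simp only: vec.span_eq_iff)
  with assms(3) have "inj_on h (vec.span V)" by (simp only:)
  then show ?thesis using vec.dim_image_eq[OF assms(1), of V] assms(4) by simp
qed

text \<open>
  The relation \<open>X = s h Y h\<^sup>-\<^sup>1\<close>. It multiplies the spectrum by \<open>s\<close> and leaves the sizes of the Jordan blocks
  unchanged.
\<close>

locale scaled_conjugation =
  fixes X Y :: "complex ^ 'i ^ 'i::finite" and h h' :: "complex ^ 'i \<Rightarrow> complex ^ 'i" and s :: complex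
  assumes lin: "Vector_Spaces.linear (*s) (*s) h"
    and inv: "h' (h u) = u" "h (h' u) = u"
    and conj: "X *v h u = s *s h (Y *v u)"
    and s: "s \<noteq> 0"
begin

lemma shift_conj: "shift X (s * l) (h u) = s *s h (shift Y l u)"
  by (simp add: shift_apply conj vec.linear_diff[OF lin] vec.linear_scale[OF lin]
      vec.scale_right_diff_distrib)

lemma shift_power_conj: "(shift X (s * l) ^^ m) (h u) = s ^ m *s h ((shift Y l ^^ m) u)"
proof (induction m)
  case (Suc m)
  have "(shift X (s * l) ^^ Suc m) (h u) = s ^ m *s shift X (s * l) (h ((shift Y l ^^ m) u))"
    using Suc by (simp add: vec.scale)
  also have "\<dots> = s ^ Suc m *s h ((shift Y l ^^ Suc m) u)"
    by (simp only: shift_conj vector_smult_assoc power_Suc2 funpow.simps comp_apply)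
  finally show ?case .
qed simp

lemma h_eq_0 [simp]: "h u = 0 \<longleftrightarrow> u = 0"
  by (metis inv(1) vec.linear_0[OF lin])

lemma gen_eigenspace_conj: "h u \<in> gen_eigenspace X (s * l) m \<longleftrightarrow> u \<in> gen_eigenspace Y l m"
  using s by (simp add: gen_eigenspace_iff shift_power_conj)

lemma gen_eigenvector_conj: "gen_eigenvector X (s * l) m (h u) \<longleftrightarrow> gen_eigenvector Y l m u"
  by (simp add: gen_eigenvector_iff gen_eigenspace_conj)

lemma eigenpair_conj: "eigenpair X (s * l) (h u) \<longleftrightarrow> eigenpair Y l u"
proof -
  have "X *v h u = (s * l) *s h u \<longleftrightarrow> s *s (h (Y *v u) - h (l *s u)) = 0"
    by (simp add: conj vec.linear_scale[OF lin] vec.scale_right_diff_distrib)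
  also have "\<dots> \<longleftrightarrow> Y *v u - l *s u = 0"
    using s h_eq_0 vec.linear_diff[OF lin, symmetric] by simp
  finally show ?thesis by (simp add: eigenpair_def)
qed

lemma dim_gen_eigenspace_conj: "vec.dim (gen_eigenspace X (s * l) m) = vec.dim (gen_eigenspace Y l m)"
proof (rule dim_linear_bij[OF lin subspace_gen_eigenspace])
  show "inj_on h (gen_eigenspace Y l m)" by (metis inj_onI inv(1))
  show "h ` gen_eigenspace Y l m = gen_eigenspace X (s * l) m"
  proof
    show "h ` gen_eigenspace Y l m \<subseteq> gen_eigenspace X (s * l) m" by (auto simp: gen_eigenspace_conj)
    show "gen_eigenspace X (s * l) m \<subseteq> h ` gen_eigenspace Y l m"
      by (metis gen_eigenspace_conj image_eqI inv(2) subsetI)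
  qed
qed

end

section \<open>The inverse on the sum of the other generalized eigenspaces\<close>

text \<open>
  On a generalized eigenvector \<open>v\<close> for \<open>l' \<noteq> l\<close>, write \<open>(M - l) v = (l' - l) v + (M - l') v\<close>. The last term
  is a generalized eigenvector of smaller order and has a preimage by induction, hence so does \<open>v\<close>.
\<close>

lemma reduced_space_surj:
  assumes "y \<in> reduced_space M l"
  shows "\<exists>u\<in>reduced_space M l. shift M l u = y"
proof -
  let ?W = "reduced_space M l"
  have gen: "\<exists>u\<in>?W. shift M l u = v" if "l' \<noteq> l" "v \<in> gen_eigenspace M l' m" for l' m v
    using that(2)
  proof (induction m arbitrary: v)
    case 0
    then show ?case using vec.span_zero by (intro bexI[of _ 0]) (auto simp: gen_eigenspace_def reduced_space_def)
  next
    case (Suc m)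
    have v: "v \<in> ?W"
    proof (cases "v = 0")
      case True then show ?thesis by (simp add: reduced_space_def vec.span_zero)
    next
      case False
      then have "gen_eigenvector M l' (Suc m) v" using Suc.prems by (simp add: gen_eigenvector_iff)
      then show ?thesis unfolding reduced_space_def using that(1) by (intro vec.span_base) blast
    qed
    have "shift M l' v \<in> gen_eigenspace M l' m"
      using Suc.prems by (simp add: gen_eigenspace_iff funpow_Suc_right del: funpow.simps)
    then obtain u where u: "u \<in> ?W" "shift M l u = shift M l' v" using Suc.IH by blast
    have "shift M l ((1 / (l' - l)) *s (v - u)) = (1 / (l' - l)) *s (shift M l v - shift M l u)"
      using shift_power_simps(3,4)[where M=M and l=l and m=1] by simp
    also have "shift M l v - shift M l u = (l' - l) *s v"
      unfolding u(2) by (simp add: shift_apply vec.scale_left_diff_distrib)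
    also have "(1 / (l' - l)) *s \<dots> = v" using that(1) by (simp only: vector_smult_assoc) simp
    finally show ?case
      using v u(1) unfolding reduced_space_def
      by (intro bexI[of _ "(1 / (l' - l)) *s (v - u)"] vec.span_scale vec.span_diff) auto
  qed
  have "y \<in> vec.span {v. \<exists>l' m. l' \<noteq> l \<and> gen_eigenvector M l' m v}"
    using assms by (simp only: reduced_space_def)
  then show ?thesis
  proof (induction rule: vec.span_induct_alt)
    case base
    show ?case by (intro bexI[of _ 0]) (auto simp: reduced_space_def vec.span_zero)
  next
    case (step a x z)
    from step(1) obtain l' m where "l' \<noteq> l" "x \<in> gen_eigenspace M l' m"
      unfolding gen_eigenvector_iff by blast
    then obtain u where u: "u \<in> ?W" "shift M l u = x" using gen by blast
    from step(2) obtain u' where u': "u' \<in> ?W" "shift M l u' = z" by blast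
    have "a *s u + u' \<in> ?W"
      using u u' unfolding reduced_space_def by (intro vec.span_add vec.span_scale)
    moreover have "shift M l (a *s u + u') = a *s x + z"
      using u u' shift_power_simps(2,4)[where M=M and l=l and m=1] by simp
    ultimately show ?case by blast
  qed
qed

text \<open>
  In finite dimension a surjective endomorphism is injective: the image of a basis still spans, so that
  it has the same cardinality and is independent.
\<close>

lemma reduced_space_inj: "inj_on (shift M l) (reduced_space M l)"
proof -
  let ?W = "reduced_space M l"
  have W: "vec.subspace ?W" "vec.span ?W = ?W" by (simp_all add: reduced_space_def vec.span_span)
  obtain A where A: "A \<subseteq> ?W" "vec.independent A" "?W \<subseteq> vec.span A" "card A = vec.dim ?W"
    using vec.basis_exists by blast
  have span_A: "vec.span A = ?W" using A(1,3) W by (metis vec.span_mono subset_antisym)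
  have fin: "finite A" using A(2) by (rule vec.finiteI_independent)
  have lin: "Vector_Spaces.linear (*s) (*s) (shift M l)" by (rule matrix_vector_mul_linear_gen)
  have "?W \<subseteq> vec.span (shift M l ` A)"
    using reduced_space_surj by (force simp: vec.linear_span_image[OF lin] span_A)
  then have "vec.dim ?W \<le> card (shift M l ` A)" using fin by (intro vec.dim_le_card) auto
  then have card: "card (shift M l ` A) = card A" using A(4) card_image_le[OF fin] by (metis le_antisym)
  then have inj: "inj_on (shift M l) A" using fin by (simp add: inj_on_iff_eq_card)
  have "vec.independent (shift M l ` A)"
  proof (rule vec.card_le_dim_spanning[of _ "vec.span (shift M l ` A)"])
    show "card (shift M l ` A) \<le> vec.dim (vec.span (shift M l ` A))"
      using vec.dim_subset[OF \<open>?W \<subseteq> vec.span (shift M l ` A)\<close>] card A(4) by simp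
  qed (use fin in \<open>auto simp: vec.span_superset\<close>)
  then show ?thesis
    using vec.linear_inj_on_span_iff_independent_image[OF lin, of A] inj by (simp add: span_A)
qed

lemma reduced_inverse:
  assumes "y \<in> reduced_space M l"
  shows "reduced_inverse M l y \<in> reduced_space M l" "shift M l (reduced_inverse M l y) = y"
proof -
  have "\<exists>!u. u \<in> reduced_space M l \<and> shift M l u = y"
    using reduced_space_surj[OF assms] inj_onD[OF reduced_space_inj[of M l]] by blast
  from theI'[OF this] show "reduced_inverse M l y \<in> reduced_space M l" "shift M l (reduced_inverse M l y) = y"
    unfolding reduced_inverse_def by auto
qed

section \<open>Deflating an eigenvalue\<close>

lemma bdot_simps:
  "bdot w 0 = (0 :: complex)"
  "bdot w (u + u') = bdot w u + bdot w u'"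
  "bdot w (u - u') = bdot w u - bdot w u'"
  "bdot w (a *s u) = a * bdot w u"
  for w :: "complex ^ 'i::finite"
  by (simp_all add: bdot_def sum.distrib sum_subtractf sum_distrib_left algebra_simps)

text \<open>
  The eigenvalue \<open>\<mu>\<close> of \<open>B\<close> along \<open>v\<close> is replaced by the eigenvalue \<open>\<kappa>\<close> of \<open>J\<close> transversal to the hyperplane
  \<open>w\<^sup>T u = 0\<close>. The assumptions fix \<open>J\<close> on the hyperplane and on the quotient by it only, which leaves the
  direction of the transversal eigenvector free and covers \<open>k > 1\<close> and \<open>k = 1\<close> alike.
\<close>

locale deflation =
  fixes B J :: "complex ^ 'i ^ 'i::finite" and v w :: "complex ^ 'i" and \<mu> \<kappa> :: complex
  assumes wv: "bdot w v = 1"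
    and Bv: "B *v v = \<mu> *s v"
    and J_proj: "J *v (u - bdot w u *s v) = B *v u - bdot w (B *v u) *s v"
    and wJ: "bdot w (J *v u) = \<kappa> * bdot w u"
    and neq: "\<kappa> \<noteq> \<mu>"
begin

definition proj :: "complex ^ 'i \<Rightarrow> complex ^ 'i" where
  "proj u = u - bdot w u *s v"

lemma proj_simps [simp]:
  "proj 0 = 0" "proj (u + u') = proj u + proj u'" "proj (u - u') = proj u - proj u'"
  "proj (a *s u) = a *s proj u" "proj v = 0" "bdot w (proj u) = 0"
  by (simp_all add: proj_def bdot_simps wv vec.scale_left_distrib vec.scale_left_diff_distrib
      vec.scale_right_diff_distrib)

lemma linear_proj: "Vector_Spaces.linear (*s) (*s) proj"
  by unfold_locales (simp_all add: vec.scale_right_distrib vec.scale_left_distrib)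

lemma proj_id: "bdot w u = 0 \<Longrightarrow> proj u = u"
  by (simp add: proj_def)

lemma proj_eq_0_iff: "proj u = 0 \<longleftrightarrow> (\<exists>s. u = s *s v)"
  by (metis proj_def proj_simps(4,5) eq_iff_diff_eq_0 vec.scale_zero_right)

lemma v_nz: "v \<noteq> 0"
  using wv by (auto simp: bdot_simps)

lemma proj_shift: "shift J l (proj u) = proj (shift B l u)"
proof -
  have "J *v proj u = proj (B *v u)" unfolding proj_def by (rule J_proj)
  then show ?thesis by (simp only: shift_apply proj_simps)
qed

lemma proj_shift_power: "(shift J l ^^ m) (proj u) = proj ((shift B l ^^ m) u)"
  by (rule funpow_intertwine[symmetric]) (simp only: proj_shift)

lemma w_shift_power: "bdot w ((shift J l ^^ m) u) = (\<kappa> - l) ^ m * bdot w u"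
  by (induction m) (simp_all add: shift_apply bdot_simps wJ left_diff_distrib)

lemma gen_eigenspace_proj: "u \<in> gen_eigenspace B l m \<Longrightarrow> proj u \<in> gen_eigenspace J l m"
  by (simp add: gen_eigenspace_iff proj_shift_power)

text \<open>
  As \<open>w\<close> is a left eigenvector, \<open>w\<^sup>T (J - l)\<^sup>m u = (\<kappa> - l)\<^sup>m w\<^sup>T u\<close>.
\<close>

lemma gen_eigenspace_tangential:
  assumes "u \<in> gen_eigenspace J l m" "l \<noteq> \<kappa>"
  shows "bdot w u = 0"
  using w_shift_power[where l=l and m=m and u=u] assms by (simp add: gen_eigenspace_iff bdot_simps)

text \<open>
  The range of \<open>J - \<kappa>\<close> lies in the hyperplane \<open>w\<^sup>T u = 0\<close>, which does not contain \<open>v\<close>. Hence \<open>J - \<kappa>\<close> is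
  not surjective and has a kernel, also where the explicit transversal eigenvector is undefined.
\<close>

lemma kappa_eigenvalue: "\<kappa> \<in> spec J"
proof -
  have "\<not> surj ((*v) (J - mat \<kappa>))"
  proof
    assume "surj ((*v) (J - mat \<kappa>))"
    then obtain u where "shift J \<kappa> u = v" by (metis surjD)
    then have "bdot w (shift J \<kappa> u) = 1" by (simp only: wv)
    then show False by (simp add: shift_apply bdot_simps wJ)
  qed
  then have "\<not> inj ((*v) (J - mat \<kappa>))"
    using vec.linear_injective_imp_surjective[OF matrix_vector_mul_linear_gen] by blast
  then obtain a b where "a \<noteq> b" "shift J \<kappa> a = shift J \<kappa> b" by (auto simp: inj_def)
  then have "a - b \<noteq> 0" "shift J \<kappa> (a - b) = 0" by (simp_all add: vec.diff)
  then have "eigenpair J \<kappa> (a - b)" by (simp only: eigenpair_def shift_apply) simp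
  then show ?thesis by (auto simp: spec_def)
qed

text \<open>
  For a tangential \<open>u\<close> the vector \<open>(B - l)\<^sup>m u\<close> is a multiple of \<open>v\<close>. If \<open>l \<noteq> \<mu>\<close>, subtracting a multiple of \<open>v\<close>
  from \<open>u\<close> corrects it. If \<open>l = \<mu>\<close>, one more application of \<open>B - l\<close> annihilates it, at the price of raising
  the order.
\<close>

lemma lift_gen_eigenspace:
  assumes "u \<in> gen_eigenspace J l m" "bdot w u = 0"
  shows "\<exists>U m'. U \<in> gen_eigenspace B l m' \<and> proj U = u \<and> (l \<noteq> \<mu> \<longrightarrow> m' = m)"
proof -
  have "proj ((shift B l ^^ m) u) = 0"
    using assms by (simp add: gen_eigenspace_iff proj_shift_power[symmetric] proj_id)
  then obtain s where s: "(shift B l ^^ m) u = s *s v" by (auto simp: proj_eq_0_iff)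
  show ?thesis
  proof (cases "l = \<mu>")
    case True
    have "(shift B l ^^ Suc m) u = 0"
      by (simp add: s vec.scale) (simp add: shift_apply Bv True)
    then show ?thesis using True assms(2) by (auto simp: gen_eigenspace_iff proj_id simp del: funpow.simps)
  next
    case False
    let ?U = "u - (s / (\<mu> - l) ^ m) *s v"
    have "(shift B l ^^ m) ?U = 0"
      using False
      by (simp only: shift_power_simps s shift_power_eigenvector[OF Bv] vector_smult_assoc) simp
    moreover have "proj ?U = u" using assms(2) by (simp add: proj_id)
    ultimately show ?thesis unfolding gen_eigenspace_iff by blast
  qed
qed

text \<open>
  The kernel of the projection is spanned by \<open>v\<close>, which belongs to the eigenvalue \<open>\<mu> \<noteq> l\<close>.
\<close>

lemma proj_inj_on: "l \<noteq> \<mu> \<Longrightarrow> inj_on proj (gen_eigenspace B l m)"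
proof (rule inj_onI)
  fix x y assume l: "l \<noteq> \<mu>" and xy: "x \<in> gen_eigenspace B l m" "y \<in> gen_eigenspace B l m" "proj x = proj y"
  then have "proj (x - y) = 0" by simp
  then obtain s where s: "x - y = s *s v" unfolding proj_eq_0_iff by blast
  have "x - y \<in> gen_eigenspace B l m" using xy by (simp add: gen_eigenspace_iff shift_power_simps)
  moreover have "B *v (x - y) = \<mu> *s (x - y)"
    unfolding s by (simp add: vec.scale Bv vector_smult_assoc mult.commute)
  ultimately have "x - y = 0" using l eigenvector_in_gen_eigenspace[of "x - y" B l m \<mu>] by blast
  then show "x = y" by simp
qed

lemma proj_image:
  assumes "l \<noteq> \<mu>"
  shows "proj ` gen_eigenspace B l m = gen_eigenspace J l m \<inter> {u. bdot w u = 0}"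
  using gen_eigenspace_proj lift_gen_eigenspace assms by fastforce

lemma dim_gen_eigenspace_eq:
  assumes "l \<noteq> \<mu>" "l \<noteq> \<kappa>"
  shows "vec.dim (gen_eigenspace J l m) = vec.dim (gen_eigenspace B l m)"
  using assms gen_eigenspace_tangential
  by (intro dim_linear_bij[OF linear_proj subspace_gen_eigenspace proj_inj_on])
    (auto simp: proj_image)

text \<open>
  A transversal eigenvector \<open>t\<close> splits every generalized eigenspace of \<open>J\<close> for \<open>\<kappa>\<close> into \<open>t\<close> and a tangential part.
\<close>

lemma gen_eigenspace_transversal_split:
  assumes t: "J *v t = \<kappa> *s t" "bdot w t \<noteq> 0" and u: "u \<in> gen_eigenspace J \<kappa> m"
  shows "u - (bdot w u / bdot w t) *s t \<in> gen_eigenspace J \<kappa> m \<inter> {u. bdot w u = 0}"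
proof (cases m)
  case 0
  with u have "u = 0" by (simp add: gen_eigenspace_def)
  then show ?thesis using 0 by (simp add: gen_eigenspace_def bdot_simps)
next
  case (Suc m')
  have "t \<in> gen_eigenspace J \<kappa> m" unfolding Suc by (rule eigenvector_gen_eigenspace[OF t(1)])
  then show ?thesis
    using u t(2) by (simp add: gen_eigenspace_iff shift_power_simps bdot_simps)
qed

text \<open>
  The tangential part is isomorphic to the generalized eigenspace of \<open>B\<close>, because \<open>\<kappa> \<noteq> \<mu>\<close>. Without an
  eigenvector \<open>t\<close> the blocks for \<open>\<kappa>\<close> could be longer instead of more numerous.
\<close>

lemma dim_gen_eigenspace_transversal:
  assumes t: "J *v t = \<kappa> *s t" "bdot w t \<noteq> 0"
  shows "vec.dim (gen_eigenspace J \<kappa> (Suc m)) = Suc (vec.dim (gen_eigenspace B \<kappa> (Suc m)))"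
proof -
  let ?T = "gen_eigenspace J \<kappa> (Suc m) \<inter> {u. bdot w u = 0}"
  have T: "vec.subspace ?T"
    using subspace_gen_eigenspace[of J \<kappa> "Suc m"] by (auto simp: vec.subspace_def bdot_simps)
  have span_T: "vec.span ?T = ?T" using T by (simp only: vec.span_eq_iff)
  have tJ: "t \<in> gen_eigenspace J \<kappa> (Suc m)" by (rule eigenvector_gen_eigenspace[OF t(1)])
  have "vec.dim ?T = vec.dim (gen_eigenspace B \<kappa> (Suc m))"
    using neq by (intro dim_linear_bij[OF linear_proj subspace_gen_eigenspace proj_inj_on proj_image]) auto
  moreover have "vec.dim (insert t ?T) = Suc (vec.dim ?T)"
    unfolding vec.dim_insert span_T using t(2) by simp
  moreover have "vec.span (insert t ?T) = gen_eigenspace J \<kappa> (Suc m)"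
  proof
    show "vec.span (insert t ?T) \<subseteq> gen_eigenspace J \<kappa> (Suc m)"
      by (rule vec.span_minimal[OF _ subspace_gen_eigenspace]) (use tJ in auto)
    show "gen_eigenspace J \<kappa> (Suc m) \<subseteq> vec.span (insert t ?T)"
      using gen_eigenspace_transversal_split[OF t] unfolding vec.span_insert span_T by blast
  qed
  ultimately show ?thesis by (metis vec.dim_span)
qed

end

section \<open>Matrices with vanishing time row\<close>

text \<open>
  The time row of \<open>B\<close> vanishes, but that of \<open>J\<close> need not: for \<open>k = 1\<close> it is a multiple of \<open>w\<^sup>T\<close>.
\<close>

locale time_deflation = deflation B J v w \<mu> \<kappa>
  for B J :: "complex ^ ('n::finite option) ^ ('n option)" and v w \<mu> \<kappa> +
  assumes row: "(B *v u) $ None = 0"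
    and vt: "v $ None = 0" and wt: "w $ None = 0"
    and \<mu>_nz: "\<mu> \<noteq> 0"
    and \<kappa>_nz: "\<kappa> \<noteq> 0"
begin

lemma ext_0_iff: "u $ None = 0 \<longleftrightarrow> (\<exists>u'. u = ext 0 u')"
  by (auto simp: ext_def vec_eq_iff split: option.splits intro!: exI[of _ "spat u"])
     (simp add: spat_def)

text \<open>
  The time component of \<open>(B - l)\<^sup>m u\<close> is \<open>(- l)\<^sup>m\<close> times that of \<open>u\<close>. This is why generalized eigenvectors
  of the form \<open>(0, U)\<close> suffice for nonzero eigenvalues, and why one additional vector with time component
  1 suffices for the eigenvalue 0.
\<close>

lemma gen_eigenspace_time:
  assumes "u \<in> gen_eigenspace B l m" "l \<noteq> 0"
  shows "u $ None = 0"
proof -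
  have "((shift B l ^^ m) u) $ None = (- l) ^ m * u $ None"
    by (induction m) (simp_all add: shift_apply row)
  then show ?thesis using assms by (simp add: gen_eigenspace_iff)
qed

lemma proj_time [simp]: "proj u $ None = u $ None"
  by (simp add: proj_def vt)

lemma eigenpair_proj_zero:
  assumes "B *v a = 0" "a $ None = 1"
  shows "eigenpair J 0 (proj a)" "eigenpair J 0 a \<longleftrightarrow> bdot w a = 0"
proof -
  have nz: "proj a \<noteq> 0" "a \<noteq> 0" using assms(2) by (auto dest: arg_cong[of _ _ "\<lambda>u. u $ None"])
  have "J *v proj a = 0"
    using proj_shift[of 0 a] assms(1) by (simp add: shift_apply)
  then show *: "eigenpair J 0 (proj a)" using nz by (simp add: eigenpair_def)
  show "eigenpair J 0 a \<longleftrightarrow> bdot w a = 0"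
    using * proj_id[of a] wJ[of a] \<kappa>_nz by (auto simp: eigenpair_def bdot_simps)
qed

lemma gen_eigenvector_proj:
  assumes "gen_eigenvector B l m u" "u \<notin> vec.span {v}"
  shows "gen_eigenvector J l m (proj u)"
proof -
  have "proj u \<noteq> 0" using assms(2) by (auto simp: proj_eq_0_iff vec.span_singleton)
  then show ?thesis using assms(1) gen_eigenspace_proj by (simp add: gen_eigenvector_iff)
qed

text \<open>
  The completeness of correspondence (I). A generalized eigenvector of \<open>J\<close> is made tangential by
  subtracting a multiple of the transversal eigenvector \<open>t\<close>, lifted to \<open>B\<close>, and then freed of its time
  component with the help of the kernel vector \<open>a\<close>.
\<close>

lemma gen_eigenspace_J_span:
  assumes u: "u \<in> gen_eigenspace J l m"
    and a: "l = 0 \<Longrightarrow> B *v a = 0 \<and> a $ None = 1"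
    and t: "l = \<kappa> \<Longrightarrow> J *v t = \<kappa> *s t \<and> bdot w t \<noteq> 0"
  shows "u \<in> vec.span {u'. (l = \<kappa> \<and> u' = t) \<or> (l = 0 \<and> u' = proj a) \<or>
     (\<exists>m' U'. gen_eigenvector B l m' (ext 0 U') \<and> ext 0 U' \<notin> vec.span {v} \<and> u' = proj (ext 0 U'))}"
    (is "_ \<in> vec.span ?Z")
proof -
  have lifted: "proj U \<in> vec.span ?Z" if U: "U \<in> gen_eigenspace B l m" "U $ None = 0" for U m
  proof (cases "proj U = 0")
    case True
    then show ?thesis using vec.span_zero by simp
  next
    case False
    then have U_nz: "U \<notin> vec.span {v}" "U \<noteq> 0" by (auto simp: vec.span_singleton)
    have "m \<noteq> 0" using U(1) U_nz by (intro notI) (simp add: gen_eigenspace_def)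
    then have "gen_eigenvector B l m U" using U(1) U_nz by (simp add: gen_eigenvector_iff)
    moreover obtain U' where "U = ext 0 U'" using U(2) ext_0_iff by blast
    ultimately have "proj U \<in> ?Z" using U_nz by blast
    then show ?thesis by (rule vec.span_base)
  qed
  have tangential: "u \<in> vec.span ?Z" if u_T: "u \<in> gen_eigenspace J l m" "bdot w u = 0" for u
  proof -
    obtain U m' where U: "U \<in> gen_eigenspace B l m'" "proj U = u"
      using lift_gen_eigenspace[OF u_T] by blast
    show ?thesis
    proof (cases "l = 0")
      case False
      then show ?thesis using lifted[OF U(1) gen_eigenspace_time[OF U(1)]] U(2) by simp
    next
      case True
      let ?U = "U - (U $ None) *s a"
      have "a \<in> gen_eigenspace B l (Suc m')"
        by (rule eigenvector_gen_eigenspace) (use a[OF True] True in simp)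
      then have "?U \<in> gen_eigenspace B l (Suc m')"
        using gen_eigenspace_Suc[OF U(1)] by (simp only: gen_eigenspace_iff shift_power_simps) simp
      then have "proj ?U \<in> vec.span ?Z" using a[OF True] by (intro lifted) auto
      moreover have "proj a \<in> vec.span ?Z" using True by (intro vec.span_base) blast
      ultimately have "proj ?U + (U $ None) *s proj a \<in> vec.span ?Z"
        by (intro vec.span_add vec.span_scale)
      then show ?thesis by (simp add: U(2))
    qed
  qed
  show ?thesis
  proof (cases "l = \<kappa>")
    case False
    then show ?thesis using tangential u gen_eigenspace_tangential by blast
  next
    case True
    let ?s = "bdot w u / bdot w t"
    have "u - ?s *s t \<in> vec.span ?Z"
      using gen_eigenspace_transversal_split[of t u m] t u True by (intro tangential) auto
    moreover have "t \<in> vec.span ?Z" using True by (intro vec.span_base) blast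
    ultimately have "(u - ?s *s t) + ?s *s t \<in> vec.span ?Z"
      by (intro vec.span_add vec.span_scale)
    then show ?thesis by simp
  qed
qed

lemma shift_mu_span_v: "shift B \<mu> (s *s v) = 0"
  by (simp only: vec.scale shift_apply) (simp add: Bv)

lemma shift_commute: "shift B l (shift B l' u) = shift B l' (shift B l u)"
proof -
  have "l *s (l' *s u) = l' *s (l *s u)" by (simp add: vector_smult_assoc mult.commute)
  then show ?thesis
    unfolding shift_apply vec.diff vec.scale vec.scale_right_diff_distrib by simp
qed

lemma shift_power_commute: "shift B l' ((shift B l ^^ m) u) = (shift B l ^^ m) (shift B l' u)"
  by (rule funpow_intertwine) (rule shift_commute)

text \<open>
  As \<open>(I - P) (B - l)\<^sup>m u = (J - l)\<^sup>m (I - P) u = 0\<close>, the vector \<open>(B - l)\<^sup>m u\<close> is a multiple of \<open>v\<close>, and \<open>B - \<mu>\<close>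
  annihilates it. If \<open>B - \<mu>\<close> annihilated \<open>u\<close> itself, then \<open>(I - P) u\<close> would be an eigenvector of \<open>J\<close> for \<open>\<mu>\<close>,
  which forces \<open>l = \<mu>\<close>.
\<close>

lemma gen_eigenvector_shift:
  assumes u: "gen_eigenvector J l m (proj u)" and l: "l \<noteq> \<mu> \<or> shift B \<mu> u \<noteq> 0"
  shows "gen_eigenvector B l m (shift B \<mu> u)"
proof -
  have "proj ((shift B l ^^ m) u) = 0"
    using u by (simp add: gen_eigenvector_iff gen_eigenspace_iff proj_shift_power[symmetric])
  then have "shift B \<mu> ((shift B l ^^ m) u) = 0" using shift_mu_span_v by (auto simp: proj_eq_0_iff)
  then have "shift B \<mu> u \<in> gen_eigenspace B l m"
    by (simp add: gen_eigenspace_iff shift_power_commute)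
  moreover have "shift B \<mu> u \<noteq> 0"
  proof
    assume *: "shift B \<mu> u = 0"
    then have "shift J \<mu> (proj u) = 0" by (simp only: proj_shift proj_simps)
    then have "J *v proj u = \<mu> *s proj u" by (simp add: shift_apply)
    moreover have "\<mu> \<noteq> l" using l * by blast
    ultimately show False
      using u eigenvector_in_gen_eigenspace[of "proj u" J l m \<mu>] by (simp add: gen_eigenvector_iff)
  qed
  ultimately show ?thesis using u by (simp add: gen_eigenvector_iff)
qed

text \<open>
  From \<open>J g = 0\<close> it only follows that \<open>B g\<close> is a multiple of \<open>v\<close>, so that \<open>g\<close> need not lie in the kernel of \<open>B\<close>.
  Applying \<open>B - \<mu>\<close> repairs this and keeps the time component away from zero.
\<close>

lemma eigenpair_shift_zero:
  assumes "J *v g = 0" "g $ None = 1"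
  shows "bdot w g = 0" "B *v shift B \<mu> g = 0" "shift B \<mu> g \<noteq> 0" "\<exists>s. B *v g = s *s v"
proof -
  show w: "bdot w g = 0" using wJ[of g] \<kappa>_nz assms(1) by (simp add: bdot_simps)
  have "proj (B *v g) = 0"
    using proj_shift[of 0 g] assms(1) w by (simp add: shift_apply proj_id)
  then show *: "\<exists>s. B *v g = s *s v" by (simp add: proj_eq_0_iff)
  then have "shift B \<mu> (shift B 0 g) = 0" using shift_mu_span_v by (auto simp: shift_apply)
  then show "B *v shift B \<mu> g = 0" using shift_commute[of \<mu> 0 g] by (simp add: shift_apply)
  have "shift B \<mu> g $ None = - \<mu>" by (simp add: shift_apply row assms(2))
  then show "shift B \<mu> g \<noteq> 0" using \<mu>_nz by (auto dest: arg_cong[of _ _ "\<lambda>u. u $ None"])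
qed

lemma shift_surj_on_gen_eigenspace:
  assumes "l \<noteq> \<mu>" "V \<in> gen_eigenspace B l m"
  obtains V' where "V' \<in> gen_eigenspace B l m" "shift B \<mu> V' = V"
proof -
  have "\<exists>V'\<in>gen_eigenspace B l m. shift B \<mu> V' = V"
    using assms(2)
  proof (induction m arbitrary: V)
    case 0
    then show ?case by (simp add: gen_eigenspace_def)
  next
    case (Suc m)
    have "shift B l V \<in> gen_eigenspace B l m"
      using Suc.prems by (simp add: gen_eigenspace_iff funpow_Suc_right del: funpow.simps)
    then obtain u where u: "u \<in> gen_eigenspace B l m" "shift B \<mu> u = shift B l V" using Suc.IH by blast
    have "shift B \<mu> ((1 / (l - \<mu>)) *s (V - u)) = (1 / (l - \<mu>)) *s (shift B \<mu> V - shift B \<mu> u)"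
      using shift_power_simps(3,4)[where M=B and l=\<mu> and m=1] by simp
    also have "shift B \<mu> V - shift B \<mu> u = (l - \<mu>) *s V"
      unfolding u(2) by (simp add: shift_apply vec.scale_left_diff_distrib)
    also have "(1 / (l - \<mu>)) *s \<dots> = V" using assms(1) by (simp only: vector_smult_assoc) simp
    finally have "shift B \<mu> ((1 / (l - \<mu>)) *s (V - u)) = V" .
    moreover have "(1 / (l - \<mu>)) *s (V - u) \<in> gen_eigenspace B l (Suc m)"
      using Suc.prems gen_eigenspace_Suc[OF u(1)]
      by (simp only: gen_eigenspace_iff shift_power_simps) simp
    ultimately show ?case by blast
  qed
  then show ?thesis using that by blast
qed

text \<open>
  The completeness of correspondence (II). For \<open>l \<noteq> \<mu>\<close> the map \<open>B - \<mu>\<close> is onto the generalized eigenspace,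
  so that each of its elements is \<open>(B - \<mu>) W\<close> with \<open>(I - P) W\<close> in the generalized eigenspace of \<open>J\<close>. For
  \<open>l = \<mu>\<close> the map \<open>B - \<mu>\<close> loses information, and the assumption on the spectrum of \<open>J\<close> leaves only the
  multiples of \<open>v\<close>.
\<close>

lemma gen_eigenspace_B_span:
  assumes V: "V \<in> gen_eigenspace B l m"
    and g: "l = 0 \<Longrightarrow> J *v g = 0 \<and> g $ None = 1"
    and \<mu>: "l = \<mu> \<Longrightarrow> \<mu> \<notin> spec J"
  shows "V \<in> vec.span {V'. (l = \<mu> \<and> V' = v) \<or> (l = 0 \<and> V' = shift B \<mu> g) \<or>
     (\<exists>m' u. gen_eigenvector J l m' (proj (ext 0 u)) \<and> V' = shift B \<mu> (ext 0 u))}"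
    (is "_ \<in> vec.span ?Z")
proof -
  have image: "shift B \<mu> W \<in> vec.span ?Z" if W: "proj W \<in> gen_eigenspace J l m" "W $ None = 0" for W m
  proof (cases "proj W = 0")
    case True
    then have "shift B \<mu> W = 0" using shift_mu_span_v by (auto simp: proj_eq_0_iff)
    then show ?thesis using vec.span_zero by simp
  next
    case False
    have "m \<noteq> 0" using W(1) False by (intro notI) (simp add: gen_eigenspace_def)
    then have "gen_eigenvector J l m (proj W)" using W(1) False by (simp add: gen_eigenvector_iff)
    moreover obtain W' where "W = ext 0 W'" using W(2) ext_0_iff by blast
    ultimately have "shift B \<mu> W \<in> ?Z" by blast
    then show ?thesis by (rule vec.span_base)
  qed
  show ?thesis
  proof (cases "l = \<mu>")
    case True
    have "proj V = 0"
    proof (rule ccontr)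
      assume nz: "proj V \<noteq> 0"
      have inj: "x = 0" if "shift J \<mu> x = 0" for x
        using that \<mu>[OF True] by (auto simp: shift_apply spec_def eigenpair_def)
      have "(shift J \<mu> ^^ m) x \<noteq> 0" if "x \<noteq> 0" for x m
        by (induction m) (use that inj in auto)
      then show False using nz gen_eigenspace_proj[OF V] True by (auto simp: gen_eigenspace_iff)
    qed
    then obtain s where "V = s *s v" by (auto simp: proj_eq_0_iff)
    moreover have "v \<in> vec.span ?Z" using True by (intro vec.span_base) blast
    ultimately show ?thesis by (simp add: vec.span_scale)
  next
    case l: False
    obtain W where W: "W \<in> gen_eigenspace B l m" "shift B \<mu> W = V"
      using shift_surj_on_gen_eigenspace[OF l V] .
    show ?thesis
    proof (cases "l = 0")
      case False
      then show ?thesis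
        using image[OF gen_eigenspace_proj[OF W(1)] gen_eigenspace_time[OF W(1)]] W(2) by simp
    next
      case True
      let ?W = "W - (W $ None) *s g"
      have "J *v proj g = 0"
        using g[OF True] eigenpair_shift_zero(1)[of g] by (simp add: proj_id)
      then have "proj g \<in> gen_eigenspace J l (Suc m)" using True by (intro eigenvector_gen_eigenspace) simp
      then have "proj ?W \<in> gen_eigenspace J l (Suc m)"
        using gen_eigenspace_Suc[OF gen_eigenspace_proj[OF W(1)]]
        by (simp only: gen_eigenspace_iff shift_power_simps proj_simps) simp
      then have "shift B \<mu> ?W \<in> vec.span ?Z" using g[OF True] by (intro image) auto
      moreover have "shift B \<mu> g \<in> vec.span ?Z" using True by (intro vec.span_base) blast
      ultimately have "shift B \<mu> ?W + (W $ None) *s shift B \<mu> g \<in> vec.span ?Z"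
        by (intro vec.span_add vec.span_scale)
      moreover have "shift B \<mu> ?W + (W $ None) *s shift B \<mu> g = V"
        using shift_power_simps(3,4)[where M=B and l=\<mu> and m=1] W(2) by simp
      ultimately show ?thesis by simp
    qed
  qed
qed

end

section \<open>Derivatives at a boundary point\<close>

lemma diag_powr_nth [simp]: "(diag_powr s a *v z) $ i = s powr a i * z $ i"
  by (simp add: diag_powr_def diagm_def matrix_vector_mult_def if_distrib[of "\<lambda>x. x * _"] cong: if_cong)

lemma diagm_nth [simp]: "(diagm a *v z) $ i = a i * z $ i" for a :: "'i::finite \<Rightarrow> 'a::comm_semiring_1"
  by (simp add: diagm_def matrix_vector_mult_def if_distrib[of "\<lambda>x. x * _"] cong: if_cong)

lemma spat_nth [simp]: "spat z $ i = z $ Some i"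
  by (simp add: spat_def)

lemma ext_nth [simp]: "ext t x $ None = t" "ext t x $ Some i = x $ i"
  by (simp_all add: ext_def)

lemma alpha_ext_simps [simp]: "alpha_ext \<alpha> None = 0" "alpha_ext \<alpha> (Some i) = real (\<alpha> i)"
  by (simp_all add: alpha_ext_def)

lemma spat_ext [simp]: "spat (ext t x) = x"
  by (simp add: vec_eq_iff)

lemma has_derivative_nth: "((\<lambda>z. z $ i) has_derivative (\<lambda>h. h $ i)) (at z within S)"
  by (rule bounded_linear_imp_has_derivative) (rule bounded_linear_vec_nth)

lemma has_derivative_vecI:
  fixes F :: "'a::real_normed_vector \<Rightarrow> real ^ 'i::finite"
  assumes "\<And>i. ((\<lambda>z. F z $ i) has_derivative (\<lambda>h. F' h $ i)) (at z within S)"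
  shows "(F has_derivative F') (at z within S)"
  using assms by (subst has_derivative_componentwise_within) (auto simp: Basis_vec_def inner_axis)

lemma has_derivative_vecD:
  fixes F :: "'a::real_normed_vector \<Rightarrow> real ^ 'i::finite"
  assumes "(F has_derivative F') (at z within S)"
  shows "((\<lambda>z. F z $ i) has_derivative (\<lambda>h. F' h $ i)) (at z within S)"
  using bounded_linear.has_derivative[OF bounded_linear_vec_nth assms] .

text \<open>
  A function bounded by a power greater than 1 of a differentiable function \<open>d\<close> with \<open>d z0 = 0\<close> is
  \<open>o(|z - z0|)\<close>, since \<open>d z = O(|z - z0|)\<close>. It applies to the residual field, and to the time component of the
  rescaled field when \<open>k > 1\<close>, both with \<open>d = 1 - q\<close>.
\<close>

lemma has_derivative_zero_of_powr_bound:
  fixes u d :: "'a::real_normed_vector \<Rightarrow> real"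
  assumes bound: "\<forall>\<^sub>F z in at z0 within S. 0 \<le> d z \<and> \<bar>u z\<bar> \<le> M * d z powr p" and p: "p > 1"
    and u0: "u z0 = 0" and d: "(d has_derivative d') (at z0 within S)" "d z0 = 0"
  shows "(u has_derivative (\<lambda>_. 0)) (at z0 within S)"
proof -
  obtain K where "K > 0" "\<forall>h. norm (d' h) \<le> norm h * K"
    using bounded_linear.pos_bounded[OF has_derivative_bounded_linear[OF d(1)]] by blast
  then have K: "K > 0" "\<And>h. \<bar>d' h\<bar> \<le> norm h * K" by simp_all
  have "\<forall>\<^sub>F z in at z0 within S. norm (d z - d z0 - d' (z - z0)) \<le> 1 * norm (z - z0)"
    using d(1) unfolding has_derivative_within_alt2 by (elim conjE allE[of _ 1]) simp
  then have d_bound: "\<forall>\<^sub>F z in at z0 within S. \<bar>d z\<bar> \<le> (K + 1) * norm (z - z0)"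
  proof (eventually_elim, goal_cases)
    case (1 z)
    then show ?case using K(2)[of "z - z0"] by (simp add: d(2) algebra_simps)
  qed
  have lim: "((\<lambda>z. \<bar>M\<bar> * (K + 1) powr p * norm (z - z0) powr (p - 1)) \<longlongrightarrow> 0) (at z0 within S)"
  proof -
    have "((\<lambda>z. norm (z - z0)) \<longlongrightarrow> 0) (at z0 within S)"
      by (auto intro!: tendsto_eq_intros)
    then have "((\<lambda>z. norm (z - z0) powr (p - 1)) \<longlongrightarrow> 0 powr (p - 1)) (at z0 within S)"
      using p by (intro tendsto_powr') (auto simp: eventually_at_filter)
    from tendsto_mult_left[OF this, of "\<bar>M\<bar> * (K + 1) powr p"] show ?thesis by simp
  qed
  have "((\<lambda>z. u z / norm (z - z0)) \<longlongrightarrow> 0) (at z0 within S)"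
  proof (rule Lim_null_comparison[OF _ lim])
    show "\<forall>\<^sub>F z in at z0 within S. norm (u z / norm (z - z0)) \<le> \<bar>M\<bar> * (K + 1) powr p * norm (z - z0) powr (p - 1)"
      using bound d_bound
    proof (eventually_elim, goal_cases)
      case (1 z)
      show ?case
      proof (cases "z = z0")
        case False
        have "\<bar>u z\<bar> \<le> M * d z powr p" using 1(1) by blast
        also have "\<dots> \<le> \<bar>M\<bar> * d z powr p" by (intro mult_right_mono) auto
        also have "\<dots> \<le> \<bar>M\<bar> * ((K + 1) * norm (z - z0)) powr p"
          using 1 p by (intro mult_left_mono powr_mono2) auto
        also have "((K + 1) * norm (z - z0)) powr p = (K + 1) powr p * norm (z - z0) powr p"
          by (rule powr_mult)
        also have "norm (z - z0) powr p = norm (z - z0) * norm (z - z0) powr (p - 1)"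
          using powr_mult_base[of "norm (z - z0)" "p - 1"] by simp
        finally have "\<bar>u z\<bar> \<le> norm (z - z0) * (\<bar>M\<bar> * (K + 1) powr p * norm (z - z0) powr (p - 1))"
          by (simp only: mult_ac)
        then show ?thesis using False by (simp add: divide_le_eq mult.commute)
      qed (simp add: u0)
    qed
  qed
  then show ?thesis
    by (auto simp: has_derivative_within u0 divide_inverse mult.commute)
qed

text \<open>
  Uniqueness of the derivative within a set such as a domain with smooth boundary. The coordinate
  directions need not point into the set, which rules out the usual criterion. The directions \<open>u\<close> with
  \<open>L u < 0\<close> do point into it and form an open half-space, and a linear map is determined by its values
  there.
\<close>

lemma derivative_unique_of_cone:
  fixes f :: "'a::real_normed_vector \<Rightarrow> 'b::real_normed_vector"
  assumes D: "(f has_derivative D1) (at z0 within S)" "(f has_derivative D2) (at z0 within S)"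
    and L: "linear L" "L u0 < (0 :: real)"
    and inside: "\<And>u. L u < 0 \<Longrightarrow> \<exists>\<delta>>0. \<forall>s\<in>{0..\<delta>}. z0 + s *\<^sub>R u \<in> S"
  shows "D1 = D2"
proof -
  have lin: "linear D1" "linear D2" using D has_derivative_linear by blast+
  have eq: "D1 u = D2 u" if u: "L u < 0" for u :: 'a
  proof -
    obtain \<delta> where \<delta>: "\<delta> > 0" "\<And>s. s \<in> {0..\<delta>} \<Longrightarrow> z0 + s *\<^sub>R u \<in> S" using inside[OF u] by meson
    have path: "((\<lambda>s. f (z0 + s *\<^sub>R u)) has_vector_derivative D' u) (at 0 within {0..\<delta>})"
      if D': "(f has_derivative D') (at z0 within S)" for D'
    proof -
      have "((\<lambda>s. z0 + s *\<^sub>R u) has_derivative (\<lambda>s. s *\<^sub>R u)) (at 0 within {0..\<delta>})"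
        by (auto intro!: derivative_eq_intros)
      moreover have "(f has_derivative D') (at (z0 + 0 *\<^sub>R u) within (\<lambda>s. z0 + s *\<^sub>R u) ` {0..\<delta>})"
      proof (rule has_derivative_subset)
        show "(f has_derivative D') (at (z0 + 0 *\<^sub>R u) within S)" using D' by simp
      qed (use \<delta>(2) in blast)
      ultimately have "(f \<circ> (\<lambda>s. z0 + s *\<^sub>R u) has_derivative D' \<circ> (\<lambda>s. s *\<^sub>R u)) (at 0 within {0..\<delta>})"
        by (rule diff_chain_within)
      then show ?thesis
        by (simp add: has_vector_derivative_def comp_def linear_cmul[OF has_derivative_linear[OF D']])
    qed
    show ?thesis
      using vector_derivative_unique_within_closed_interval[of 0 \<delta> 0, OF _ _ path[OF D(1), folded cbox_interval]
          path[OF D(2), folded cbox_interval]] \<delta>(1) by simp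
  qed
  show ?thesis
  proof
    fix e
    obtain t where t: "t > 0" "L (u0 + t *\<^sub>R e) < 0"
    proof (cases "L e \<le> 0")
      case True
      then show ?thesis using that[of 1] L by (simp add: linear_add)
    next
      case False
      let ?t = "- L u0 / (2 * L e)"
      have "L (u0 + ?t *\<^sub>R e) = L u0 / 2" using False by (simp add: linear_add[OF L(1)] linear_diff[OF L(1)] linear_cmul[OF L(1)])
      then show ?thesis using that[of ?t] L(2) False by (simp add: divide_neg_pos)
    qed
    have "D1 (u0 + t *\<^sub>R e) - D1 u0 = D2 (u0 + t *\<^sub>R e) - D2 u0" using eq[OF t(2)] eq[OF L(2)] by simp
    then show "D1 e = D2 e" using t(1) by (simp add: linear_add lin linear_cmul)
  qed
qed

section \<open>Quasi-homogeneous fields near the horizon\<close>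

lemma c_lcm_pos: "c_lcm \<alpha> > 0" for \<alpha> :: "'n::finite \<Rightarrow> nat"
proof -
  have "c_lcm \<alpha> \<noteq> 0" unfolding c_lcm_def by (subst Lcm_0_iff_nat) (auto simp: I_set_def)
  then show ?thesis by simp
qed

lemma alpha_mult_beta: "i \<in> I_set \<alpha> \<Longrightarrow> \<alpha> i * beta \<alpha> i = c_lcm \<alpha>"
  for \<alpha> :: "'n::finite \<Rightarrow> nat"
  by (auto simp: beta_def c_lcm_def intro!: dvd_mult_div_cancel dvd_Lcm)

lemma beta_pos: "i \<in> I_set \<alpha> \<Longrightarrow> beta \<alpha> i > 0" for \<alpha> :: "'n::finite \<Rightarrow> nat"
  using alpha_mult_beta[of i \<alpha>] c_lcm_pos[of \<alpha>] by (cases "beta \<alpha> i") auto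

lemma one_div_powr_minus: "(1 / x) powr (- a) = x powr a" if "x > 0" for x a :: real
  using that by (simp add: powr_minus powr_divide)

lemma powr_minus_mult_cancel: "s > 0 \<Longrightarrow> s powr (- a) * (s powr a * y) = y" for s a y :: real
  by (simp add: powr_minus)

locale quasi_homogeneous_field =
  fixes \<alpha> :: "'n::finite \<Rightarrow> nat" and U :: "(real ^ 'n) set"
    and f f\<alpha> :: "real \<Rightarrow> real ^ 'n \<Rightarrow> real ^ 'n" and k :: real
  assumes domain: "phase_domain \<alpha> U"
    and f_C1: "C1_on {z. spat z \<in> U} (\<lambda>z. f (z $ None) (spat z))"
    and homogeneous: "\<And>t y s i. y \<in> U \<Longrightarrow> s > 0 \<Longrightarrow>
      f\<alpha> t (diag_powr s (\<lambda>i. real (\<alpha> i)) *v y) $ i = s powr (k + real (\<alpha> i)) * f\<alpha> t y $ i"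
    and R: "residual_assumption \<alpha> k U f f\<alpha>"
begin

abbreviation c :: nat where "c \<equiv> c_lcm \<alpha>"
abbreviation F where "F \<equiv> f\<alpha>_ext f\<alpha>"
abbreviation D where "D \<equiv> domD \<alpha> U"
abbreviation H where "H \<equiv> horizon \<alpha> U"

abbreviation dilate :: "real \<Rightarrow> real ^ 'n option \<Rightarrow> real ^ 'n option" where
  "dilate s z \<equiv> diag_powr s (alpha_ext \<alpha>) *v z"

text \<open>
  The polynomial \<open>p\<^sup>2\<^sup>c\<close>. It replaces \<open>p\<close> throughout, being smooth everywhere.
\<close>

definition q :: "real ^ 'n option \<Rightarrow> real" where
  "q z = (\<Sum>i\<in>I_set \<alpha>. z $ Some i ^ (2 * beta \<alpha> i))"

lemma k_ge_1: "k \<ge> 1"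
  using R by (simp add: residual_assumption_def)

lemma F_simps [simp]: "F z $ None = 0" "F z $ Some i = f\<alpha> (z $ None) (spat z) $ i"
  by (simp_all add: f\<alpha>_ext_def)

lemma spat_dilate: "spat (dilate s z) = diag_powr s (\<lambda>i. real (\<alpha> i)) *v spat z"
  by (simp add: vec_eq_iff)

lemma dilate_in_U:
  assumes "spat z \<in> U" "s > 0"
  shows "spat (dilate s z) \<in> U"
proof -
  have "\<forall>j. j \<notin> I_set \<alpha> \<longrightarrow> spat (dilate s z) $ j = spat z $ j"
    using assms(2) by (auto simp: I_set_def)
  then show ?thesis using domain assms(1) unfolding phase_domain_def by blast
qed

lemma F_dilate:
  assumes "spat z \<in> U" "s > 0"
  shows "F (dilate s z) $ j = s powr (k + alpha_ext \<alpha> j) * F z $ j"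
  using homogeneous[OF assms] assms(2) by (cases j) (simp_all add: spat_dilate)

lemma q_nonneg: "q z \<ge> 0"
  unfolding q_def by (intro sum_nonneg) simp

lemma q_dilate:
  assumes "s > 0"
  shows "q (dilate s z) = s ^ (2 * c) * q z"
proof -
  have "(s powr real (\<alpha> i) * z $ Some i) ^ (2 * beta \<alpha> i) = s ^ (2 * c) * z $ Some i ^ (2 * beta \<alpha> i)"
    if "i \<in> I_set \<alpha>" for i
  proof -
    have "(s ^ \<alpha> i) ^ (2 * beta \<alpha> i) = s ^ (2 * c)"
      by (simp add: power_mult[symmetric] alpha_mult_beta[OF that, symmetric] mult_ac)
    then show ?thesis using assms by (simp add: powr_realpow power_mult_distrib)
  qed
  then show ?thesis by (simp add: q_def sum_distrib_left)
qed

lemma p_alpha_power: "p_alpha \<alpha> (spat z) ^ (2 * c) = q z"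
  using c_lcm_pos[of \<alpha>] q_nonneg[of z]
  by (cases "q z = 0") (auto simp: p_alpha_def q_def powr_power)

lemma p_alpha_nonneg: "p_alpha \<alpha> x \<ge> 0"
  by (simp add: p_alpha_def)

lemma domD_iff: "z \<in> D \<longleftrightarrow> spat z \<in> U \<and> q z < 1"
  using power_less_one_iff[OF p_alpha_nonneg[of "spat z"], of "2 * c"] c_lcm_pos[of \<alpha>]
  by (simp add: domD_def p_alpha_power)

lemma horizon_iff: "z \<in> H \<longleftrightarrow> spat z \<in> U \<and> q z = 1"
  using power_eq_iff_eq_base[of "2 * c" "p_alpha \<alpha> (spat z)" 1] p_alpha_nonneg[of "spat z"] c_lcm_pos[of \<alpha>]
    p_alpha_power[of z]
  by (auto simp: horizon_def)

lemma kappa_eq: "kappa \<alpha> (spat z) = 1 / (1 - q z)"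
  by (simp add: kappa_def p_alpha_power)

lemma isCont_spat: "isCont spat z"
  unfolding isCont_def by (rule vec_tendstoI) (auto intro!: tendsto_intros)

lemma open_phase: "open {z :: real ^ 'n option. spat z \<in> U}"
proof -
  have "open (spat -` U :: (real ^ 'n option) set)"
    using domain by (intro continuous_open_vimage) (auto simp: phase_domain_def isCont_spat)
  then show ?thesis by (simp add: vimage_def)
qed

lemma isCont_q: "isCont q z"
  unfolding q_def[abs_def] by (intro continuous_intros)

lemma open_domD: "open D"
proof -
  have "open {z. q z < 1}"
    by (intro open_Collect_less continuous_intros) (simp add: continuous_at_imp_continuous_on isCont_q)
  moreover have "D = {z. spat z \<in> U} \<inter> {z. q z < 1}" by (auto simp: domD_iff)
  ultimately show ?thesis using open_phase by auto
qed

lemma isCont_f: "spat z \<in> U \<Longrightarrow> isCont (\<lambda>z. f (z $ None) (spat z)) z"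
  using f_C1 unfolding C1_on_def by (auto intro: has_derivative_continuous)

abbreviation ft where "ft \<equiv> rescaled \<alpha> k (f_ext f)"
abbreviation res where "res \<equiv> f_tilde_res \<alpha> k f f\<alpha>"

lemma ft_None: "z \<in> D \<Longrightarrow> ft z $ None = (1 - q z) powr k"
  by (simp add: rescaled_def f_ext_def kappa_eq domD_iff one_div_powr_minus)

lemma ft_Some: "z \<in> D \<Longrightarrow> ft z $ Some i = F z $ Some i + res z $ Some i"
proof -
  assume z: "z \<in> D"
  let ?\<kappa> = "kappa \<alpha> (spat z)"
  have pos: "?\<kappa> > 0" using z by (simp add: kappa_eq domD_iff)
  have "ft z $ Some i = ?\<kappa> powr - (k + \<alpha> i) * F (dilate ?\<kappa> z) $ Some i + res z $ Some i"
    by (simp add: rescaled_def f_tilde_res_def f_ext_def algebra_simps)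
  also have "F (dilate ?\<kappa> z) $ Some i = ?\<kappa> powr (k + \<alpha> i) * F z $ Some i"
    using F_dilate[of z ?\<kappa> "Some i"] z pos by (simp add: domD_iff)
  also have "?\<kappa> powr - (k + \<alpha> i) * (?\<kappa> powr (k + \<alpha> i) * F z $ Some i) = F z $ Some i"
    using pos by (rule powr_minus_mult_cancel)
  finally show ?thesis .
qed

lemma isCont_ft:
  assumes z: "z \<in> D"
  shows "isCont (\<lambda>z. ft z $ Some i) z"
proof -
  let ?\<kappa> = "\<lambda>z. kappa \<alpha> (spat z)"
  have pos: "?\<kappa> z > 0" using z by (simp add: kappa_eq domD_iff)
  have \<kappa>: "(?\<kappa> \<longlongrightarrow> ?\<kappa> z) (at z)"
    unfolding kappa_eq using z isCont_q[of z]
    by (intro tendsto_intros) (auto simp: domD_iff isCont_def)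
  have "((\<lambda>z. dilate (?\<kappa> z) z) \<longlongrightarrow> dilate (?\<kappa> z) z) (at z)"
    by (rule vec_tendstoI) (use pos in \<open>auto intro!: tendsto_intros \<kappa>\<close>)
  then have "isCont (\<lambda>z. dilate (?\<kappa> z) z) z" by (simp add: isCont_def)
  moreover have "isCont (\<lambda>z. f (z $ None) (spat z)) (dilate (?\<kappa> z) z)"
    using z pos by (intro isCont_f dilate_in_U) (auto simp: domD_iff)
  ultimately have "isCont ((\<lambda>z. f (z $ None) (spat z)) \<circ> (\<lambda>z. dilate (?\<kappa> z) z)) z"
    by (intro continuous_at_compose)
  then have "((\<lambda>z'. f (dilate (?\<kappa> z') z' $ None) (spat (dilate (?\<kappa> z') z')) $ i)
     \<longlongrightarrow> f (dilate (?\<kappa> z) z $ None) (spat (dilate (?\<kappa> z) z)) $ i) (at z)"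
    unfolding isCont_def comp_def by (rule tendsto_vec_nth)
  then have "((\<lambda>z. ?\<kappa> z powr (- (k + \<alpha> i)) * f (dilate (?\<kappa> z) z $ None) (spat (dilate (?\<kappa> z) z)) $ i)
     \<longlongrightarrow> ?\<kappa> z powr (- (k + \<alpha> i)) * f (dilate (?\<kappa> z) z $ None) (spat (dilate (?\<kappa> z) z)) $ i) (at z)"
    using pos by (intro tendsto_mult tendsto_powr \<kappa> tendsto_const) auto
  then show ?thesis by (simp add: isCont_def rescaled_def f_ext_def)
qed

lemma residual_bound:
  assumes "z0 \<in> H"
  obtains M \<epsilon> where "M > 0" "\<epsilon> > 0"
    "\<forall>i. \<forall>\<^sub>F z in at z0 within D. \<bar>res z $ Some i\<bar> \<le> M * (1 - q z) powr (1 + \<epsilon>)"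
proof -
  obtain \<epsilon> where \<epsilon>: "\<epsilon> > 0" "\<And>i. (\<lambda>z. res z $ Some i)
      \<in> O[at z0 within D](\<lambda>z. kappa \<alpha> (spat z) powr (- (1 + \<epsilon>)))"
    using R assms unfolding residual_assumption_def by blast
  have "\<forall>i. \<exists>M. M > 0 \<and> (\<forall>\<^sub>F z in at z0 within D. \<bar>res z $ Some i\<bar> \<le> M * (1 - q z) powr (1 + \<epsilon>))"
  proof
    fix i
    obtain M where M: "M > 0" "\<forall>\<^sub>F z in at z0 within D. norm (res z $ Some i)
        \<le> M * norm (kappa \<alpha> (spat z) powr (- (1 + \<epsilon>)))"
      using landau_o.bigE[OF \<epsilon>(2)] by blast
    have "\<forall>\<^sub>F z in at z0 within D. z \<in> D" by (simp add: eventually_at_filter)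
    with M(2) have "\<forall>\<^sub>F z in at z0 within D. \<bar>res z $ Some i\<bar> \<le> M * (1 - q z) powr (1 + \<epsilon>)"
    proof eventually_elim
      case (elim z)
      then have "kappa \<alpha> (spat z) powr (- (1 + \<epsilon>)) = (1 - q z) powr (1 + \<epsilon>)"
        unfolding kappa_eq by (intro one_div_powr_minus) (simp add: domD_iff)
      with elim(1) show ?case by simp
    qed
    with M(1) show "\<exists>M. M > 0 \<and> (\<forall>\<^sub>F z in at z0 within D. \<bar>res z $ Some i\<bar> \<le> M * (1 - q z) powr (1 + \<epsilon>))"
      by (intro exI[of _ M] conjI)
  qed
  from choice[OF this] obtain M where M: "\<And>i. M i > 0"
    "\<And>i. \<forall>\<^sub>F z in at z0 within D. \<bar>res z $ Some i\<bar> \<le> M i * (1 - q z) powr (1 + \<epsilon>)"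
    by blast
  show ?thesis
  proof (rule that[of "1 + (\<Sum>i\<in>UNIV. M i)" \<epsilon>])
    show "1 + (\<Sum>i\<in>UNIV. M i) > 0"
      using M(1) by (intro add_pos_nonneg sum_nonneg) (auto intro: less_imp_le)
    show "\<forall>i. \<forall>\<^sub>F z in at z0 within D. \<bar>res z $ Some i\<bar> \<le> (1 + (\<Sum>i\<in>UNIV. M i)) * (1 - q z) powr (1 + \<epsilon>)"
    proof
    fix i
    have "M i \<le> 1 + (\<Sum>i\<in>UNIV. M i)"
      using member_le_sum[of i UNIV M] M(1) by (simp add: less_imp_le)
    then show "\<forall>\<^sub>F z in at z0 within D. \<bar>res z $ Some i\<bar> \<le> (1 + (\<Sum>i\<in>UNIV. M i)) * (1 - q z) powr (1 + \<epsilon>)"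
      by (intro eventually_mono[OF M(2)[of i]]) (meson mult_right_mono order_trans powr_ge_zero)
    qed
  qed (rule \<epsilon>(1))
qed

lemma dilate_tendsto: "((\<lambda>s. dilate s z0) \<longlongrightarrow> z0) (at_left 1)"
proof (rule vec_tendstoI)
  fix i
  have "((\<lambda>s. s powr alpha_ext \<alpha> i * z0 $ i) \<longlongrightarrow> 1 powr alpha_ext \<alpha> i * z0 $ i) (at_left 1)"
    by (intro tendsto_intros) auto
  then show "((\<lambda>s. dilate s z0 $ i) \<longlongrightarrow> z0 $ i) (at_left 1)" by simp
qed

lemma dilate_in_domD:
  assumes "z \<in> H" "0 < s" "s < 1"
  shows "dilate s z \<in> D"
  using assms dilate_in_U[of z s] power_less_one_iff[of s "2 * c"] c_lcm_pos[of \<alpha>]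
  by (simp add: domD_iff horizon_iff q_dilate)

lemma eventually_at_left_1: "\<forall>\<^sub>F s in at_left 1. 0 < s \<and> s < (1 :: real)"
  unfolding eventually_at_left_field by (rule exI[of _ 0]) auto

lemma horizon_limit_point:
  assumes "z0 \<in> H"
  shows "at z0 within D \<noteq> bot"
proof -
  have "z0 islimpt D"
    unfolding islimpt_approachable
  proof (intro allI impI)
    fix e :: real assume "e > 0"
    have "\<forall>\<^sub>F s in at_left 1. dist (dilate s z0) z0 < e \<and> 0 < s \<and> s < 1"
      using tendstoD[OF dilate_tendsto \<open>e > 0\<close>] eventually_at_left_1 by eventually_elim auto
    then obtain s where s: "dist (dilate s z0) z0 < e" "0 < s" "s < 1"
      using eventually_happens[of _ "at_left (1::real)"] by (auto simp: trivial_limit_at_left_real)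
    have "dilate s z0 \<in> D" using dilate_in_domD[OF assms s(2,3)] .
    moreover have "z0 \<notin> D" using assms by (simp add: horizon_iff domD_iff)
    ultimately show "\<exists>x'\<in>D. x' \<noteq> z0 \<and> dist x' z0 < e" using s(1) by metis
  qed
  then show ?thesis by (simp add: trivial_limit_within)
qed

text \<open>
  By homogeneity, a component of \<open>f\<^sub>\<alpha>\<close> near a point of the horizon is a multiple of the same component near
  the dilated point, for a factor \<open>s < 1\<close> close to 1. That point lies inside the domain, where \<open>f\<^sub>\<alpha>\<close> differs from the continuous
  rescaled field by at most \<open>M (1 - q)\<^sup>1\<^sup>+\<^sup>\<epsilon>\<close>. This error tends to 0 as \<open>s\<close> tends to 1, so that the oscillation of
  \<open>f\<^sub>\<alpha>\<close> at the point of the horizon is arbitrarily small.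
\<close>

lemma isCont_F_horizon:
  assumes z0: "z0 \<in> H"
  shows "isCont (\<lambda>z. F z $ Some i) z0"
proof -
  obtain M \<epsilon> where M: "M > 0" "\<epsilon> > 0"
    "\<forall>i. \<forall>\<^sub>F z in at z0 within D. \<bar>res z $ Some i\<bar> \<le> M * (1 - q z) powr (1 + \<epsilon>)"
    using residual_bound[OF z0] .
  define b where "b z = M * (1 - q z) powr (1 + \<epsilon>)" for z
  obtain \<delta> where "\<delta> > 0" "\<forall>z\<in>D. z \<noteq> z0 \<and> dist z z0 < \<delta> \<longrightarrow> \<bar>res z $ Some i\<bar> \<le> b z"
    using M(3)[rule_format, of i] unfolding eventually_at b_def by blast
  moreover have "z0 \<notin> D" using z0 by (simp add: domD_iff horizon_iff)
  ultimately have \<delta>: "\<delta> > 0" "\<And>z. z \<in> D \<Longrightarrow> dist z z0 < \<delta> \<Longrightarrow> \<bar>res z $ Some i\<bar> \<le> b z"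
    by auto
  define a where "a = k + real (\<alpha> i)"
  have "((\<lambda>z. F z $ Some i) \<longlongrightarrow> F z0 $ Some i) (at z0)"
  proof (rule tendstoI)
    fix e :: real assume e: "e > 0"
    have "((\<lambda>s. 1 - s ^ (2 * c)) \<longlongrightarrow> 1 - 1 ^ (2 * c)) (at_left (1::real))"
      by (intro tendsto_intros)
    moreover have "\<forall>\<^sub>F s in at_left (1::real). 0 \<le> 1 - s ^ (2 * c)"
      using eventually_at_left_1 by eventually_elim (simp add: power_le_one)
    ultimately have lim_b: "((\<lambda>s. (1 - s ^ (2 * c)) powr (1 + \<epsilon>)) \<longlongrightarrow> (1 - 1 ^ (2 * c)) powr (1 + \<epsilon>)) (at_left 1)"
      using M(2) by (intro tendsto_powr' tendsto_const) auto
    have "((\<lambda>s. s powr (- a)) \<longlongrightarrow> 1 powr (- a)) (at_left (1::real))"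
      by (intro tendsto_powr tendsto_const tendsto_ident_at) auto
    then have "((\<lambda>s. s powr (- a) * (2 * (M * (1 - s ^ (2 * c)) powr (1 + \<epsilon>)))) \<longlongrightarrow>
        1 powr (- a) * (2 * (M * (1 - 1 ^ (2 * c)) powr (1 + \<epsilon>)))) (at_left 1)"
      by (intro tendsto_mult[OF _ tendsto_mult[OF tendsto_const tendsto_mult[OF tendsto_const lim_b]]])
    then have "\<forall>\<^sub>F s in at_left 1. s powr (- a) * (2 * (M * (1 - s ^ (2 * c)) powr (1 + \<epsilon>))) < e"
      using e by (intro order_tendstoD(2)) auto
    then have "\<forall>\<^sub>F s in at_left 1. s powr (- a) * (2 * (M * (1 - s ^ (2 * c)) powr (1 + \<epsilon>))) < e
        \<and> dist (dilate s z0) z0 < \<delta> \<and> 0 < s \<and> s < 1"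
      using tendstoD[OF dilate_tendsto \<delta>(1)] eventually_at_left_1 by eventually_elim auto
    then obtain s where s: "s powr (- a) * (2 * (M * (1 - s ^ (2 * c)) powr (1 + \<epsilon>))) < e"
        "dist (dilate s z0) z0 < \<delta>" "0 < s" "s < 1"
      using eventually_happens[of _ "at_left (1::real)"] by (auto simp: trivial_limit_at_left_real)
    define zs where "zs = dilate s z0"
    have zs: "zs \<in> D" unfolding zs_def using dilate_in_domD[OF z0 s(3,4)] .
    have q_zs: "q zs = s ^ (2 * c)" using z0 s(3) by (simp add: zs_def q_dilate horizon_iff)
    have dil: "((\<lambda>z. dilate s z) \<longlongrightarrow> zs) (at z0)"
      unfolding zs_def using matrix_vector_mult_linear_continuous_at[of z0] by (simp add: isCont_def)
    \<comment> \<open>a continuous majorant of the oscillation, whose value at \<open>z0\<close> is smaller than \<open>e\<close>\<close>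
    define E where "E z = s powr (- a) * (\<bar>ft (dilate s z) $ Some i - ft zs $ Some i\<bar> + b (dilate s z) + b zs)" for z
    have "isCont b zs"
      unfolding b_def using zs isCont_q[of zs] by (intro continuous_intros) (auto simp: domD_iff)
    then have b_lim: "((\<lambda>z. b (dilate s z)) \<longlongrightarrow> b zs) (at z0)"
      by (rule isCont_tendsto_compose[OF _ dil])
    have "(E \<longlongrightarrow> s powr (- a) * (\<bar>ft zs $ Some i - ft zs $ Some i\<bar> + b zs + b zs)) (at z0)"
      unfolding E_def
      by (intro tendsto_intros b_lim isCont_tendsto_compose[OF isCont_ft[OF zs] dil])
    then have "\<forall>\<^sub>F z in at z0. E z < e"
      using s(1) by (intro order_tendstoD(2)) (auto simp: b_def q_zs)
    moreover have "\<forall>\<^sub>F z in at z0. dilate s z \<in> D"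
      by (rule topological_tendstoD[OF dil open_domD zs])
    moreover have "\<forall>\<^sub>F z in at z0. dilate s z \<in> ball z0 \<delta>"
      by (rule topological_tendstoD[OF dil open_ball]) (use s(2) in \<open>simp add: zs_def dist_commute\<close>)
    moreover have "\<forall>\<^sub>F z in at z0. z \<in> {z. spat z \<in> U}"
      by (rule topological_tendstoD[OF tendsto_ident_at open_phase]) (use z0 in \<open>simp add: horizon_iff\<close>)
    ultimately show "\<forall>\<^sub>F z in at z0. dist (F z $ Some i) (F z0 $ Some i) < e"
    proof eventually_elim
      case (elim z)
      have F_eq: "F x $ Some i = s powr (- a) * (ft (dilate s x) $ Some i - res (dilate s x) $ Some i)"
        if "spat x \<in> U" "dilate s x \<in> D" for x
      proof -
        have "ft (dilate s x) $ Some i - res (dilate s x) $ Some i = s powr a * F x $ Some i"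
          using F_dilate[OF that(1) s(3), of "Some i"] ft_Some[OF that(2), of i] by (simp add: a_def)
        then show ?thesis using powr_minus_mult_cancel[OF s(3)] by simp
      qed
      have "F z $ Some i - F z0 $ Some i = s powr (- a) *
         ((ft (dilate s z) $ Some i - ft zs $ Some i) - res (dilate s z) $ Some i + res zs $ Some i)"
        using F_eq[of z] F_eq[of z0] elim(2,4) z0 zs
        by (simp add: horizon_iff zs_def algebra_simps del: F_simps)
      then have "\<bar>F z $ Some i - F z0 $ Some i\<bar> = s powr (- a) *
         \<bar>(ft (dilate s z) $ Some i - ft zs $ Some i) - res (dilate s z) $ Some i + res zs $ Some i\<bar>"
        by (simp only: abs_mult) simp
      also have "\<dots> \<le> E z"
        unfolding E_def
      proof (rule mult_left_mono)
        have "\<bar>res (dilate s z) $ Some i\<bar> \<le> b (dilate s z)"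
          using elim(2,3) by (intro \<delta>(2)) (auto simp: dist_commute)
        moreover have "\<bar>res zs $ Some i\<bar> \<le> b zs" using s(2) zs by (intro \<delta>(2)) (auto simp: zs_def)
        ultimately show "\<bar>(ft (dilate s z) $ Some i - ft zs $ Some i) - res (dilate s z) $ Some i + res zs $ Some i\<bar>
           \<le> \<bar>ft (dilate s z) $ Some i - ft zs $ Some i\<bar> + b (dilate s z) + b zs"
          by linarith
      qed simp
      finally show ?case using elim(1) by (simp add: dist_real_def)
    qed
  qed
  then show ?thesis by (simp add: isCont_def)
qed

lemma one_minus_q_powr_tendsto_0:
  assumes "z0 \<in> H" "p > 0"
  shows "((\<lambda>z. (1 - q z) powr p) \<longlongrightarrow> 0) (at z0 within D)"
proof -
  have "(q \<longlongrightarrow> q z0) (at z0 within D)"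
    using isCont_q unfolding isCont_def by (rule tendsto_within_subset) simp
  from tendsto_diff[OF tendsto_const this, of 1]
  have "((\<lambda>z. 1 - q z) \<longlongrightarrow> 0) (at z0 within D)" using assms(1) by (simp add: horizon_iff)
  then have "((\<lambda>z. (1 - q z) powr p) \<longlongrightarrow> 0 powr p) (at z0 within D)"
    using assms(2) by (intro tendsto_powr' tendsto_const) (auto simp: eventually_at_filter domD_iff)
  then show ?thesis by simp
qed

text \<open>
  The limit that defines the extension exists by the continuity of \<open>f\<^sub>\<alpha>\<close> at the horizon.
\<close>

lemma f_tilde_horizon:
  assumes z0: "z0 \<in> H"
  shows "f_tilde \<alpha> k U f z0 = F z0"
proof -
  have "(ft \<longlongrightarrow> F z0) (at z0 within D)"
  proof (rule vec_tendstoI)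
    fix j
    have ev: "\<forall>\<^sub>F z in at z0 within D. z \<in> D" by (simp add: eventually_at_filter)
    show "((\<lambda>z. ft z $ j) \<longlongrightarrow> F z0 $ j) (at z0 within D)"
    proof (cases j)
      case None
      have "((\<lambda>z. (1 - q z) powr k) \<longlongrightarrow> 0) (at z0 within D)"
        using k_ge_1 by (intro one_minus_q_powr_tendsto_0 z0) simp
      then show ?thesis
        unfolding None F_simps by (rule Lim_transform_eventually) (use ev ft_None in \<open>auto elim!: eventually_mono\<close>)
    next
      case (Some i)
      obtain M \<epsilon> where M: "M > 0" "\<epsilon> > 0"
        "\<forall>i. \<forall>\<^sub>F z in at z0 within D. \<bar>res z $ Some i\<bar> \<le> M * (1 - q z) powr (1 + \<epsilon>)"
        using residual_bound[OF z0] .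
      have "((\<lambda>z. res z $ Some i) \<longlongrightarrow> 0) (at z0 within D)"
      proof (rule Lim_null_comparison)
        show "\<forall>\<^sub>F z in at z0 within D. norm (res z $ Some i) \<le> M * (1 - q z) powr (1 + \<epsilon>)"
          using M(3) by simp
        show "((\<lambda>z. M * (1 - q z) powr (1 + \<epsilon>)) \<longlongrightarrow> 0) (at z0 within D)"
          using M(2) by (intro tendsto_mult_right_zero one_minus_q_powr_tendsto_0[OF z0]) simp
      qed
      moreover have "((\<lambda>z. F z $ Some i) \<longlongrightarrow> F z0 $ Some i) (at z0 within D)"
        using isCont_F_horizon[OF z0] unfolding isCont_def by (rule tendsto_within_subset) simp
      ultimately have "((\<lambda>z. F z $ Some i + res z $ Some i) \<longlongrightarrow> F z0 $ Some i + 0) (at z0 within D)"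
        by (intro tendsto_add)
      then have "((\<lambda>z. ft z $ Some i) \<longlongrightarrow> F z0 $ Some i + 0) (at z0 within D)"
        by (rule Lim_transform_eventually) (use ev ft_Some in \<open>auto elim!: eventually_mono\<close>)
      then show ?thesis by (simp add: Some)
    qed
  qed
  then have "Lim (at z0 within D) ft = F z0"
    by (rule tendsto_Lim[OF horizon_limit_point[OF z0]])
  then show ?thesis using z0 by (simp add: f_tilde_def domD_iff horizon_iff)
qed

end

section \<open>The linearization at an equilibrium\<close>

lemma sum_UNIV_option: "(\<Sum>i\<in>UNIV. h i) = h None + (\<Sum>i\<in>UNIV. h (Some i))"
  for h :: "'n::finite option \<Rightarrow> 'a::comm_monoid_add"
  by (simp add: UNIV_option_conv sum.reindex)

lemma matrix_mult_of_linear: "linear h \<Longrightarrow> matrix h *v x = h x" for h :: "real ^ 'i::finite \<Rightarrow> real ^ 'j::finite"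
  by (rule matrix_works) (simp add: linear_matrix_vector_mul_eq)

text \<open>
  A single scaling factor \<open>r\<close> stands for both \<open>r\<^sub>x\<close> and \<open>r\<^sub>Y\<close>; that these agree is \<open>scaling_unique\<close> below.
\<close>

locale horizon_equilibrium = quasi_homogeneous_field \<alpha> U f f\<alpha> k
  for \<alpha> :: "'n::finite \<Rightarrow> nat" and U f f\<alpha> k +
  fixes t0 r :: real and x0 Y0 :: "real ^ 'n"
  assumes on_horizon: "ext t0 x0 \<in> H"
    and equilibrium: "g_ext \<alpha> k U f (ext t0 x0) = 0"
    and f\<alpha>_diff: "(\<lambda>z. f\<alpha> (z $ None) (spat z)) differentiable (at (ext t0 Y0))"
    and balance: "- ((1 / k) *\<^sub>R (diagm (\<lambda>i. real (\<alpha> i)) *v Y0)) + f\<alpha> t0 Y0 = 0"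
    and r_pos: "r > 0"
    and Y0_eq: "Y0 = diag_powr r (\<lambda>i. real (\<alpha> i)) *v x0"
begin

abbreviation z0 where "z0 \<equiv> ext t0 x0"
abbreviation DE where "DE \<equiv> D \<union> H"
abbreviation \<Lambda> :: "real ^ 'n option \<Rightarrow> real ^ 'n option" where "\<Lambda> h \<equiv> diagm (alpha_ext \<alpha>) *v h"

definition C :: real where "C = G \<alpha> k U f z0"
definition vE where "vE = ext 0 (diagm (\<lambda>i. real (\<alpha> i)) *v x0)"
definition wE where "wE = ext 0 (Dx_p \<alpha> x0)"
definition dF_Y0 where "dF_Y0 = frechet_derivative F (at (ext t0 Y0))"

text \<open>
  The derivative of \<open>f\<^sub>\<alpha>\<close> at the horizon, obtained from that at \<open>Y\<^sub>0\<close> by differentiating the homogeneity relation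
  along the dilation by \<open>r\<close>.
\<close>

definition dF_z0 :: "real ^ 'n option \<Rightarrow> real ^ 'n option" where
  "dF_z0 h = (\<chi> j. r powr (- (k + alpha_ext \<alpha> j)) * dF_Y0 (dilate r h) $ j)"

text \<open>
  The linear map of the matrix \<open>A\<^sub>g\<^sup>e\<^sup>x\<^sup>t\<close>, see \<open>Age_mult\<close>.
\<close>

definition B :: "real ^ 'n option \<Rightarrow> real ^ 'n option" where
  "B h = dF_z0 h - C *\<^sub>R \<Lambda> h"

definition ft' :: "real ^ 'n option \<Rightarrow> real ^ 'n option" where
  "ft' h = dF_z0 h - (if k = 1 then 2 * real c * (wE \<bullet> h) else 0) *\<^sub>R axis None 1"

definition g' :: "real ^ 'n option \<Rightarrow> real ^ 'n option" where
  "g' h = B h - (wE \<bullet> B h) *\<^sub>R vE - (C * (wE \<bullet> h)) *\<^sub>R vE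
     - (if k = 1 then 2 * real c * (wE \<bullet> h) else 0) *\<^sub>R axis None 1"

lemma z0_U: "spat z0 \<in> U" and q_z0: "q z0 = 1" and z0_not_D: "z0 \<notin> D"
  using on_horizon by (simp_all add: horizon_iff domD_iff)

lemma vE_eq: "vE = \<Lambda> z0"
proof -
  have "vE $ j = \<Lambda> z0 $ j" for j by (cases j) (simp_all add: vE_def)
  then show ?thesis by (simp add: vec_eq_iff)
qed

lemma vE_nth [simp]: "vE $ None = 0" "vE $ Some i = real (\<alpha> i) * x0 $ i"
  by (simp_all add: vE_def)

lemma wE_nth: "wE $ None = 0" "i \<in> I_set \<alpha> \<Longrightarrow> wE $ Some i = x0 $ i ^ (2 * beta \<alpha> i - 1) / real (\<alpha> i)"
  "i \<notin> I_set \<alpha> \<Longrightarrow> wE $ Some i = 0"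
proof -
  show "wE $ None = 0" by (simp add: wE_def)
  show "wE $ Some i = 0" if "i \<notin> I_set \<alpha>" using that by (simp add: wE_def Dx_p_def beta_def)
  show "wE $ Some i = x0 $ i ^ (2 * beta \<alpha> i - 1) / real (\<alpha> i)" if "i \<in> I_set \<alpha>"
    using beta_pos[OF that] that
    by (simp add: wE_def Dx_p_def alpha_mult_beta[OF that, symmetric] I_set_def)
qed

lemma inner_wE: "wE \<bullet> h = (\<Sum>i\<in>I_set \<alpha>. x0 $ i ^ (2 * beta \<alpha> i - 1) / real (\<alpha> i) * h $ Some i)"
proof -
  have "wE \<bullet> h = (\<Sum>i\<in>UNIV. wE $ Some i * h $ Some i)"
    by (simp add: inner_vec_def sum_UNIV_option wE_nth)
  also have "\<dots> = (\<Sum>i\<in>I_set \<alpha>. wE $ Some i * h $ Some i)"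
    by (rule sum.mono_neutral_right) (auto simp: wE_nth)
  finally show ?thesis by (simp add: wE_nth)
qed

lemma wE_vE: "wE \<bullet> vE = 1"
proof -
  have "wE \<bullet> vE = q z0"
    unfolding inner_wE q_def
  proof (rule sum.cong[OF refl])
    fix i assume i: "i \<in> I_set \<alpha>"
    have "x0 $ i ^ (2 * beta \<alpha> i - 1) * x0 $ i = x0 $ i ^ (2 * beta \<alpha> i)"
      using beta_pos[OF i] by (intro power_minus_mult) simp
    then show "x0 $ i ^ (2 * beta \<alpha> i - 1) / real (\<alpha> i) * vE $ Some i = z0 $ Some i ^ (2 * beta \<alpha> i)"
      using i by (simp add: I_set_def)
  qed
  then show ?thesis by (simp add: q_z0)
qed

lemma q_has_derivative: "(q has_derivative (\<lambda>h. 2 * real c * (wE \<bullet> h))) (at z0 within S)"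
proof -
  have "(q has_derivative (\<lambda>h. \<Sum>i\<in>I_set \<alpha>. real (2 * beta \<alpha> i) * h $ Some i * z0 $ Some i ^ (2 * beta \<alpha> i - 1)))
     (at z0 within S)"
    unfolding q_def[abs_def] by (intro has_derivative_sum has_derivative_power has_derivative_nth)
  moreover have "real (2 * beta \<alpha> i) * h $ Some i * z0 $ Some i ^ (2 * beta \<alpha> i - 1) =
     2 * real c * (x0 $ i ^ (2 * beta \<alpha> i - 1) / real (\<alpha> i) * h $ Some i)" if "i \<in> I_set \<alpha>" for i h
    using that by (simp add: alpha_mult_beta[OF that, symmetric] I_set_def)
  ultimately show ?thesis
    by (simp add: inner_wE sum_distrib_left cong: sum.cong)
qed

lemma dilate_z0: "dilate r z0 = ext t0 Y0"
proof -
  have "dilate r z0 $ j = ext t0 Y0 $ j" for j using r_pos by (cases j) (simp_all add: Y0_eq)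
  then show ?thesis by (simp add: vec_eq_iff)
qed

lemma F_has_derivative_Y0: "(F has_derivative dF_Y0) (at (ext t0 Y0))"
proof -
  obtain d where d: "((\<lambda>z. f\<alpha> (z $ None) (spat z)) has_derivative d) (at (ext t0 Y0))"
    using f\<alpha>_diff by (auto simp: differentiable_def)
  have "(F has_derivative (\<lambda>h. ext 0 (d h))) (at (ext t0 Y0))"
  proof (rule has_derivative_vecI)
    fix j show "((\<lambda>z. F z $ j) has_derivative (\<lambda>h. ext 0 (d h) $ j)) (at (ext t0 Y0))"
      by (cases j) (simp_all add: has_derivative_vecD[OF d])
  qed
  then have "F differentiable (at (ext t0 Y0))" by (auto simp: differentiable_def)
  then show ?thesis unfolding dF_Y0_def using frechet_derivative_works by blast
qed

lemma dF_Y0_None: "dF_Y0 h $ None = 0"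
proof -
  have "((\<lambda>z. F z $ None) has_derivative (\<lambda>h. dF_Y0 h $ None)) (at (ext t0 Y0))"
    by (rule has_derivative_vecD[OF F_has_derivative_Y0])
  moreover have "((\<lambda>z. F z $ None) has_derivative (\<lambda>h. 0)) (at (ext t0 Y0))" by simp
  ultimately have "(\<lambda>h. dF_Y0 h $ None) = (\<lambda>h. 0)" by (rule has_derivative_unique)
  then show ?thesis by (rule fun_cong)
qed

lemma dF_z0_None [simp]: "dF_z0 h $ None = 0"
  by (simp add: dF_z0_def dF_Y0_None)

lemma dF_Y0_dilate: "dF_Y0 (dilate r h) = r powr k *\<^sub>R dilate r (dF_z0 h)"
proof -
  have "r powr k * (r powr a * (r powr (- (k + a)) * y)) = y" for a y
    using powr_minus_mult_cancel[OF r_pos, of "- (k + a)" y] by (simp add: powr_add mult_ac)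
  then show ?thesis by (simp add: vec_eq_iff dF_z0_def)
qed

lemma F_has_derivative_z0: "(F has_derivative dF_z0) (at z0 within S)"
proof (rule has_derivative_vecI)
  fix j
  have "(dilate r has_derivative dilate r) (at z0)"
    by (rule bounded_linear_imp_has_derivative) simp
  from diff_chain_at[OF this, of F dF_Y0] F_has_derivative_Y0
  have "((F \<circ> dilate r) has_derivative (dF_Y0 \<circ> dilate r)) (at z0)" by (simp add: dilate_z0)
  from has_derivative_vecD[OF this, of j]
  have "((\<lambda>z. r powr (- (k + alpha_ext \<alpha> j)) * F (dilate r z) $ j) has_derivative (\<lambda>h. dF_z0 h $ j)) (at z0)"
    by (auto intro!: derivative_eq_intros simp: dF_z0_def comp_def)
  then have "((\<lambda>z. F z $ j) has_derivative (\<lambda>h. dF_z0 h $ j)) (at z0)"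
  proof (rule has_derivative_transform_within_open[OF _ open_phase])
    fix z assume "z \<in> {z. spat z \<in> U}"
    then show "r powr (- (k + alpha_ext \<alpha> j)) * F (dilate r z) $ j = F z $ j"
      by (simp only: mem_Collect_eq F_dilate r_pos powr_minus_mult_cancel[OF r_pos])
  qed (use z0_U in simp)
  then show "((\<lambda>z. F z $ j) has_derivative (\<lambda>h. dF_z0 h $ j)) (at z0 within S)"
    by (rule has_derivative_at_withinI)
qed

lemma F_z0: "F z0 = C *\<^sub>R vE"
  using equilibrium
  by (simp add: g_ext_def Let_def p_alpha_power[of z0, simplified] q_z0 f_tilde_horizon[OF on_horizon] vE_eq C_def)

lemma x0_nonzero: obtains i where "i \<in> I_set \<alpha>" "x0 $ i \<noteq> 0"
proof -
  have "\<exists>i\<in>I_set \<alpha>. x0 $ i \<noteq> 0"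
  proof (rule ccontr)
    assume "\<not> ?thesis"
    then have "q z0 = 0" unfolding q_def using beta_pos by (intro sum.neutral) (auto simp: power_0_left)
    then show False by (simp add: q_z0)
  qed
  then show ?thesis using that by blast
qed

text \<open>
  A component with \<open>\<alpha>\<^sub>i x\<^sub>i \<noteq> 0\<close> exists, as \<open>q = 1\<close> on the horizon. There the balance law compares \<open>f\<^sub>\<alpha>\<close> at \<open>Y\<^sub>0\<close> with
  \<open>f\<^sub>\<alpha> = C v\<close> at \<open>x\<^sub>0\<close>.
\<close>

lemma r_powr_k_times_kC: "r powr k * (k * C) = 1"
proof -
  obtain i where i: "i \<in> I_set \<alpha>" "x0 $ i \<noteq> 0" by (rule x0_nonzero)
  have "r powr (k + real (\<alpha> i)) * (C * (real (\<alpha> i) * x0 $ i)) = f\<alpha> t0 Y0 $ i"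
    using F_dilate[OF z0_U r_pos, of "Some i"] unfolding dilate_z0 F_z0 by simp
  also have "\<dots> = real (\<alpha> i) * (r powr real (\<alpha> i) * x0 $ i) / k"
    using arg_cong[OF balance, of "\<lambda>y. y $ i"] by (simp add: Y0_eq)
  finally have "r powr k * (k * C) * (r powr real (\<alpha> i) * (real (\<alpha> i) * x0 $ i)) = r powr real (\<alpha> i) * (real (\<alpha> i) * x0 $ i)"
    using k_ge_1 by (simp add: powr_add field_simps)
  then show ?thesis using i r_pos by (simp add: I_set_def)
qed

lemma C_pos: "C > 0"
proof -
  have "r powr k > 0" using r_pos by simp
  moreover have "0 < r powr k * (k * C)" by (simp only: r_powr_k_times_kC zero_less_one)
  ultimately have "k * C > 0" by (metis zero_less_mult_pos)
  then show ?thesis using k_ge_1 by (simp add: zero_less_mult_iff)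
qed

text \<open>
  Euler's identity: differentiating \<open>F (dilate s z0) = s\<^sup>k\<^sup>+\<^sup>a F z0\<close> at \<open>s = 1\<close> gives \<open>dF vE = (k + \<Lambda>) F z0\<close>, and
  \<open>F z0 = C vE\<close> at an equilibrium.
\<close>

lemma B_vE: "B vE = (k * C) *\<^sub>R vE"
proof -
  have "dF_z0 vE $ j = (k + alpha_ext \<alpha> j) * F z0 $ j" for j
  proof -
    have path: "((\<lambda>s. dilate s z0) has_derivative (\<lambda>s. s *\<^sub>R vE)) (at 1)"
    proof (rule has_derivative_vecI)
      fix i
      have "((\<lambda>s. s powr alpha_ext \<alpha> i * z0 $ i) has_real_derivative
          (alpha_ext \<alpha> i * 1 powr (alpha_ext \<alpha> i - 1)) * z0 $ i) (at 1)"
        by (intro DERIV_cmult_right has_real_derivative_powr) simp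
      then show "((\<lambda>s. dilate s z0 $ i) has_derivative (\<lambda>s. (s *\<^sub>R vE) $ i)) (at 1)"
        unfolding has_field_derivative_def diag_powr_nth
        by (rule has_derivative_eq_rhs) (simp add: vE_eq fun_eq_iff)
    qed
    have "dilate 1 z0 = z0" by (simp add: vec_eq_iff)
    with diff_chain_at[OF path, of F dF_z0] F_has_derivative_z0[of UNIV]
    have "((F \<circ> (\<lambda>s. dilate s z0)) has_derivative (dF_z0 \<circ> (\<lambda>s. s *\<^sub>R vE))) (at 1)" by simp
    from has_derivative_vecD[OF this, of j]
    have 1: "((\<lambda>s. F (dilate s z0) $ j) has_derivative (\<lambda>s. dF_z0 (s *\<^sub>R vE) $ j)) (at 1)" by (simp add: comp_def)
    have "((\<lambda>s. s powr (k + alpha_ext \<alpha> j) * F z0 $ j) has_real_derivative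
        ((k + alpha_ext \<alpha> j) * 1 powr (k + alpha_ext \<alpha> j - 1)) * F z0 $ j) (at 1)"
      by (intro DERIV_cmult_right has_real_derivative_powr) simp
    then have "((\<lambda>s. s powr (k + alpha_ext \<alpha> j) * F z0 $ j) has_derivative
        (\<lambda>s. s * ((k + alpha_ext \<alpha> j) * F z0 $ j))) (at 1)"
      unfolding has_field_derivative_def by (rule has_derivative_eq_rhs) (simp add: fun_eq_iff)
    then have 2: "((\<lambda>s. F (dilate s z0) $ j) has_derivative (\<lambda>s. s * ((k + alpha_ext \<alpha> j) * F z0 $ j))) (at 1)"
    proof (rule has_derivative_transform_within_open[OF _ open_greaterThan])
      fix s :: real assume "s \<in> {0<..}"
      then show "s powr (k + alpha_ext \<alpha> j) * F z0 $ j = F (dilate s z0) $ j"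
        using F_dilate[OF z0_U] by simp
    qed simp
    from fun_cong[OF has_derivative_unique[OF 1 2], of 1] show ?thesis by simp
  qed
  then show ?thesis by (simp add: B_def vec_eq_iff F_z0 algebra_simps del: F_simps)
qed

lemma ft'_None: "ft' h $ None = - (if k = 1 then 2 * real c * (wE \<bullet> h) else 0)"
  by (simp add: ft'_def axis_def)

text \<open>
  The residual part contributes nothing. The time component \<open>(1 - q)\<^sup>k\<close> contributes for \<open>k = 1\<close> only, where it
  is \<open>1 - q\<close>.
\<close>

lemma f_tilde_has_derivative: "(f_tilde \<alpha> k U f has_derivative ft') (at z0 within DE)"
proof (rule has_derivative_vecI)
  fix j
  have q1: "((\<lambda>z. 1 - q z) has_derivative (\<lambda>h. - (2 * real c * (wE \<bullet> h)))) (at z0 within DE)"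
    by (auto intro!: derivative_eq_intros q_has_derivative)
  have in_DE: "\<forall>\<^sub>F z in at z0 within DE. z \<in> DE" by (simp add: eventually_at_filter)
  have z0: "z0 \<in> DE" using on_horizon by simp
  show "((\<lambda>z. f_tilde \<alpha> k U f z $ j) has_derivative (\<lambda>h. ft' h $ j)) (at z0 within DE)"
  proof (cases j)
    case None
    have ft_eq: "f_tilde \<alpha> k U f z $ None = (1 - q z) powr k" if "z \<in> DE" for z
    proof (cases "z \<in> D")
      case False
      with that have "z \<in> H" by simp
      then show ?thesis by (simp add: f_tilde_horizon) (simp add: horizon_iff)
    qed (simp add: f_tilde_def ft_None)
    have "((\<lambda>z. (1 - q z) powr k) has_derivative (\<lambda>h. ft' h $ None)) (at z0 within DE)"
    proof (cases "k = 1")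
      case True
      have "((\<lambda>z. (1 - q z) powr k) has_derivative (\<lambda>h. - (2 * real c * (wE \<bullet> h)))) (at z0 within DE)"
        by (rule has_derivative_transform[OF z0 _ q1]) (auto simp: True domD_iff horizon_iff)
      moreover have "ft' h $ None = - (2 * real c * (wE \<bullet> h))" for h
        using ft'_None[of h] True by (simp only: simp_thms if_True)
      ultimately show ?thesis by presburger
    next
      case False
      have "((\<lambda>z. (1 - q z) powr k) has_derivative (\<lambda>h. 0)) (at z0 within DE)"
      proof (rule has_derivative_zero_of_powr_bound[OF _ _ _ q1, where M=1 and p=k])
        show "\<forall>\<^sub>F z in at z0 within DE. 0 \<le> 1 - q z \<and> \<bar>(1 - q z) powr k\<bar> \<le> 1 * (1 - q z) powr k"
          using in_DE by eventually_elim (auto simp: domD_iff horizon_iff)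
      qed (use False k_ge_1 q_z0 in auto)
      then show ?thesis using False by (simp add: ft'_def)
    qed
    from has_derivative_transform[OF z0 _ this, of "\<lambda>z. f_tilde \<alpha> k U f z $ None"] ft_eq
    show ?thesis unfolding None by blast
  next
    case (Some i)
    define R where "R z = (if z \<in> D then res z $ Some i else 0)" for z
    have ft_eq: "f_tilde \<alpha> k U f z $ Some i = F z $ Some i + R z" if "z \<in> DE" for z
    proof (cases "z \<in> D")
      case False
      with that show ?thesis by (simp add: f_tilde_horizon R_def)
    qed (simp add: f_tilde_def ft_Some R_def)
    obtain M \<epsilon> where M: "M > 0" "\<epsilon> > 0"
      "\<forall>i. \<forall>\<^sub>F z in at z0 within D. \<bar>res z $ Some i\<bar> \<le> M * (1 - q z) powr (1 + \<epsilon>)"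
      using residual_bound[OF on_horizon] .
    have "(R has_derivative (\<lambda>_. 0)) (at z0 within DE)"
    proof (rule has_derivative_zero_of_powr_bound[OF _ _ _ q1, where M=M and p="1 + \<epsilon>"])
      have "\<forall>\<^sub>F z in at z0 within DE. z \<in> D \<longrightarrow> \<bar>res z $ Some i\<bar> \<le> M * (1 - q z) powr (1 + \<epsilon>)"
        using M(3)[rule_format, of i] unfolding eventually_at_filter by eventually_elim auto
      then show "\<forall>\<^sub>F z in at z0 within DE. 0 \<le> 1 - q z \<and> \<bar>R z\<bar> \<le> M * (1 - q z) powr (1 + \<epsilon>)"
        using in_DE
      proof eventually_elim
        case (elim z)
        then show ?case using M(1) by (auto simp: R_def domD_iff horizon_iff)
      qed
    qed (use M(2) q_z0 z0_not_D in \<open>auto simp: R_def\<close>)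
    from has_derivative_add[OF has_derivative_vecD[OF F_has_derivative_z0] this, of "Some i"]
    have "((\<lambda>z. F z $ Some i + R z) has_derivative (\<lambda>h. ft' h $ Some i)) (at z0 within DE)"
      by (simp add: ft'_def axis_def)
    from has_derivative_transform[OF z0 _ this, of "\<lambda>z. f_tilde \<alpha> k U f z $ Some i"] ft_eq
    show ?thesis unfolding Some by blast
  qed
qed

lemma f_tilde_z0: "f_tilde \<alpha> k U f z0 = C *\<^sub>R vE"
  by (simp only: f_tilde_horizon[OF on_horizon] F_z0)

text \<open>
  The derivative of the coefficient \<open>x\<^sup>2\<^sup>\<beta>\<^sup>-\<^sup>1 / \<alpha>\<close> times \<open>f_tilde = C \<alpha> x\<close> equals \<open>C (2 \<beta> - 1) x\<^sup>2\<^sup>\<beta>\<^sup>-\<^sup>1\<close>, and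
  \<open>2 \<beta> - 1 = 2 c / \<alpha> - 1\<close>. This produces the two terms with \<open>wE\<close>.
\<close>

lemma G_has_derivative:
  "(G \<alpha> k U f has_derivative (\<lambda>h. C * (2 * real c * (wE \<bullet> h) - wE \<bullet> \<Lambda> h) + wE \<bullet> ft' h)) (at z0 within DE)"
proof -
  have "((\<lambda>z. z $ Some i ^ (2 * beta \<alpha> i - 1) / real (\<alpha> i) * f_tilde \<alpha> k U f z $ Some i) has_derivative
      (\<lambda>h. C * (2 * real c * (x0 $ i ^ (2 * beta \<alpha> i - 1) / real (\<alpha> i) * h $ Some i)
             - x0 $ i ^ (2 * beta \<alpha> i - 1) / real (\<alpha> i) * \<Lambda> h $ Some i)
           + x0 $ i ^ (2 * beta \<alpha> i - 1) / real (\<alpha> i) * ft' h $ Some i)) (at z0 within DE)"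
    if i: "i \<in> I_set \<alpha>" for i
  proof -
    define m where "m = 2 * beta \<alpha> i - 1"
    have \<alpha>: "real (\<alpha> i) > 0" using i by (simp add: I_set_def)
    have m: "m > 0" "real m = 2 * real (beta \<alpha> i) - 1" using beta_pos[OF i] by (simp_all add: m_def of_nat_diff)
    have pow: "x0 $ i ^ (m - 1) * x0 $ i = x0 $ i ^ m" using m(1) by (rule power_minus_mult)
    have c: "real c = real (\<alpha> i) * real (beta \<alpha> i)" by (simp add: alpha_mult_beta[OF i, symmetric])
    have "((\<lambda>z. z $ Some i ^ m / real (\<alpha> i) * f_tilde \<alpha> k U f z $ Some i) has_derivative
      (\<lambda>h. z0 $ Some i ^ m / real (\<alpha> i) * ft' h $ Some i
        + real m * h $ Some i * z0 $ Some i ^ (m - 1) / real (\<alpha> i) * f_tilde \<alpha> k U f z0 $ Some i)) (at z0 within DE)"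
      by (intro has_derivative_mult bounded_linear.has_derivative[OF bounded_linear_divide]
          has_derivative_power has_derivative_nth has_derivative_vecD[OF f_tilde_has_derivative])
    moreover have "z0 $ Some i ^ m / real (\<alpha> i) * ft' h $ Some i
        + real m * h $ Some i * z0 $ Some i ^ (m - 1) / real (\<alpha> i) * f_tilde \<alpha> k U f z0 $ Some i
        = C * (2 * real c * (x0 $ i ^ m / real (\<alpha> i) * h $ Some i)
             - x0 $ i ^ m / real (\<alpha> i) * \<Lambda> h $ Some i)
           + x0 $ i ^ m / real (\<alpha> i) * ft' h $ Some i" for h
    proof -
      have "real m * h $ Some i * z0 $ Some i ^ (m - 1) / real (\<alpha> i) * f_tilde \<alpha> k U f z0 $ Some i
        = C * real m * h $ Some i * (x0 $ i ^ (m - 1) * x0 $ i)"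
        using \<alpha> by (simp add: f_tilde_z0)
      also have "\<dots> = C * real m * h $ Some i * x0 $ i ^ m" by (simp only: pow)
      finally show ?thesis using \<alpha> by (simp add: m(2) c field_simps)
    qed
    ultimately show ?thesis unfolding m_def[symmetric] by (simp only:)
  qed
  then have "((\<lambda>z. \<Sum>i\<in>I_set \<alpha>. z $ Some i ^ (2 * beta \<alpha> i - 1) / real (\<alpha> i) * f_tilde \<alpha> k U f z $ Some i) has_derivative
      (\<lambda>h. \<Sum>i\<in>I_set \<alpha>. C * (2 * real c * (x0 $ i ^ (2 * beta \<alpha> i - 1) / real (\<alpha> i) * h $ Some i)
             - x0 $ i ^ (2 * beta \<alpha> i - 1) / real (\<alpha> i) * \<Lambda> h $ Some i)
           + x0 $ i ^ (2 * beta \<alpha> i - 1) / real (\<alpha> i) * ft' h $ Some i)) (at z0 within DE)"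
    by (rule has_derivative_sum)
  then show ?thesis
    unfolding inner_wE sum.distrib sum_subtractf sum_distrib_left[symmetric] G_def[abs_def] spat_nth .
qed

lemma wE_ft': "wE \<bullet> ft' h = wE \<bullet> B h + C * (wE \<bullet> \<Lambda> h)"
proof -
  have "wE \<bullet> ft' h = wE \<bullet> dF_z0 h" by (simp add: inner_wE ft'_def axis_def)
  then show ?thesis by (simp add: B_def inner_diff_right)
qed

text \<open>
  The contributions \<open>(2 c - 1) C vE wE\<^sup>T\<close> of the prefactor and \<open>- 2 c C vE wE\<^sup>T\<close> of \<open>G\<close> leave \<open>- C vE wE\<^sup>T\<close>.
\<close>

lemma g_has_derivative: "(g_ext \<alpha> k U f has_derivative g') (at z0 within DE)"
proof -
  let ?a = "\<lambda>z. 1 - (2 * real c - 1) / (2 * real c) * (1 - q z)"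
  have "(?a has_derivative (\<lambda>h. (2 * real c - 1) * (wE \<bullet> h))) (at z0 within DE)"
    using c_lcm_pos[of \<alpha>] by (auto intro!: derivative_eq_intros q_has_derivative simp: field_simps)
  moreover have "(\<Lambda> has_derivative \<Lambda>) (at z0 within DE)"
    by (rule bounded_linear_imp_has_derivative) simp
  ultimately have "((\<lambda>z. ?a z *\<^sub>R f_tilde \<alpha> k U f z - G \<alpha> k U f z *\<^sub>R \<Lambda> z) has_derivative
     (\<lambda>h. (?a z0 *\<^sub>R ft' h + ((2 * real c - 1) * (wE \<bullet> h)) *\<^sub>R f_tilde \<alpha> k U f z0)
       - (G \<alpha> k U f z0 *\<^sub>R \<Lambda> h + (C * (2 * real c * (wE \<bullet> h) - wE \<bullet> \<Lambda> h) + wE \<bullet> ft' h) *\<^sub>R \<Lambda> z0))) (at z0 within DE)"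
    by (intro has_derivative_diff has_derivative_scaleR f_tilde_has_derivative G_has_derivative)
  moreover have "(?a z0 *\<^sub>R ft' h + ((2 * real c - 1) * (wE \<bullet> h)) *\<^sub>R f_tilde \<alpha> k U f z0)
       - (G \<alpha> k U f z0 *\<^sub>R \<Lambda> h + (C * (2 * real c * (wE \<bullet> h) - wE \<bullet> \<Lambda> h) + wE \<bullet> ft' h) *\<^sub>R \<Lambda> z0) = g' h" for h
  proof -
    have "ft' h = B h + C *\<^sub>R \<Lambda> h - (if k = 1 then 2 * real c * (wE \<bullet> h) else 0) *\<^sub>R axis None 1"
      by (simp add: ft'_def B_def)
    then show ?thesis
      by (simp only: wE_ft' q_z0 f_tilde_z0 C_def[symmetric] vE_eq[symmetric] g'_def) (simp add: algebra_simps inner_axis wE_nth(1))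
  qed
  moreover have "g_ext \<alpha> k U f = (\<lambda>z. ?a z *\<^sub>R f_tilde \<alpha> k U f z - G \<alpha> k U f z *\<^sub>R \<Lambda> z)"
    by (simp add: g_ext_def[abs_def] Let_def p_alpha_power)
  ultimately show ?thesis by (simp only:)
qed

text \<open>
  The derivative of \<open>q\<close> is a positive multiple of \<open>wE\<close>, so that \<open>q\<close> drops below 1 along \<open>u\<close>.
\<close>

lemma inward_path:
  assumes "wE \<bullet> u < 0"
  shows "\<exists>\<delta>>0. \<forall>s\<in>{0..\<delta>}. z0 + s *\<^sub>R u \<in> DE"
proof -
  have path: "((\<lambda>s. z0 + s *\<^sub>R u) has_derivative (\<lambda>s. s *\<^sub>R u)) (at 0)"
    by (auto intro!: derivative_eq_intros)
  have "(q has_derivative (\<lambda>h. 2 * real c * (wE \<bullet> h))) (at (z0 + 0 *\<^sub>R u))"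
    using q_has_derivative[of UNIV] by simp
  from diff_chain_at[OF path this]
  have "((\<lambda>s. q (z0 + s *\<^sub>R u)) has_derivative (\<lambda>s. s * (2 * real c * (wE \<bullet> u)))) (at 0)"
    unfolding comp_def by (rule has_derivative_eq_rhs) (simp add: fun_eq_iff)
  then have "((\<lambda>s. q (z0 + s *\<^sub>R u)) has_real_derivative 2 * real c * (wE \<bullet> u)) (at 0)"
    unfolding has_field_derivative_def by (rule has_derivative_eq_rhs) (simp add: fun_eq_iff)
  moreover have "2 * real c * (wE \<bullet> u) < 0"
    using assms c_lcm_pos[of \<alpha>] by (simp add: mult_pos_neg)
  ultimately have "\<exists>d>0. \<forall>s>0. s < d \<longrightarrow> q (z0 + (0 + s) *\<^sub>R u) < q (z0 + 0 *\<^sub>R u)"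
    by (rule DERIV_neg_dec_right)
  then obtain d1 where d1: "d1 > 0" "\<And>s. 0 < s \<Longrightarrow> s < d1 \<Longrightarrow> q (z0 + s *\<^sub>R u) < q z0" by auto
  have "open ((\<lambda>s. z0 + s *\<^sub>R u) -` {z. spat z \<in> U})"
    by (intro continuous_open_vimage open_phase continuous_intros)
  moreover have "0 \<in> (\<lambda>s. z0 + s *\<^sub>R u) -` {z. spat z \<in> U}" using z0_U by simp
  ultimately obtain d2 where d2: "d2 > 0" "\<And>s. dist s 0 < d2 \<Longrightarrow> spat (z0 + s *\<^sub>R u) \<in> U"
    unfolding open_dist by blast
  have "\<forall>s\<in>{0..min d1 d2 / 2}. z0 + s *\<^sub>R u \<in> DE"
  proof
    fix s assume s: "s \<in> {0..min d1 d2 / 2}"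
    show "z0 + s *\<^sub>R u \<in> DE"
    proof (cases "s = 0")
      case True then show ?thesis using on_horizon by simp
    next
      case False
      then show ?thesis using s d1 d2(1) d2(2)[of s] q_z0 by (simp add: domD_iff dist_real_def)
    qed
  qed
  then show ?thesis using d1(1) d2(1) by (intro exI[of _ "min d1 d2 / 2"]) auto
qed

lemma jacobian_within_DE:
  fixes h :: "real ^ 'n option \<Rightarrow> real ^ 'n option"
  assumes "(h has_derivative h') (at z0 within DE)"
  shows "jacobian h (at z0 within DE) *v x = h' x"
proof -
  have "h differentiable (at z0 within DE)" using assms by (auto simp: differentiable_def)
  then have "(h has_derivative frechet_derivative h (at z0 within DE)) (at z0 within DE)"
    using frechet_derivative_works by blast
  then have "frechet_derivative h (at z0 within DE) = h'"
  proof (rule derivative_unique_of_cone[OF _ assms, where L="\<lambda>u. wE \<bullet> u" and ?u0.0="- vE"])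
    show "linear (\<lambda>u. wE \<bullet> u)" by (intro bounded_linear.linear bounded_linear_inner_right)
    show "\<exists>\<delta>>0. \<forall>s\<in>{0..\<delta>}. z0 + s *\<^sub>R u \<in> DE" if "wE \<bullet> u < 0" for u
      by (rule inward_path[OF that])
  qed (simp add: wE_vE)
  then show ?thesis
    unfolding jacobian_def using has_derivative_linear[OF assms] by (simp add: matrix_mult_of_linear)
qed

lemma jacobian_F: "jacobian F (at (ext t0 Y0)) *v x = dF_Y0 x"
  unfolding jacobian_def dF_Y0_def[symmetric]
  using has_derivative_linear[OF F_has_derivative_Y0] by (rule matrix_mult_of_linear)

end

section \<open>Complexification and block matrices\<close>

lemma cmat_cvec: "cmat M *v cvec a = cvec (M *v a)"
  by (simp add: vec_eq_iff matrix_vector_mult_def cvec_def)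

lemma bdot_cvec: "bdot (cvec a) (cvec b) = complex_of_real (a \<bullet> b)"
  by (simp add: bdot_def cvec_def inner_vec_def)

lemma cvec_simps [simp]:
  "cvec (a + b) = cvec a + cvec b" "cvec (a - b) = cvec a - cvec b" "cvec (s *\<^sub>R a) = complex_of_real s *s cvec a"
  "cvec (axis i 1) = axis i 1" "cvec 0 = 0" "cvec (- a) = - cvec a"
  by (simp_all add: vec_eq_iff cvec_def axis_def)

lemma cvec_eq_iff [simp]: "cvec a = cvec b \<longleftrightarrow> a = b"
  by (simp add: vec_eq_iff cvec_def)

lemma cvec_eq_0_iff [simp]: "cvec a = 0 \<longleftrightarrow> a = 0"
  by (simp add: vec_eq_iff cvec_def)

lemma cvec_nth [simp]: "cvec a $ i = complex_of_real (a $ i)"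
  by (simp add: cvec_def)

lemma cvec_ext: "cvec (ext t y) = ext (complex_of_real t) (cvec y)"
  by (simp add: vec_eq_iff cvec_def ext_def split: option.split)

text \<open>
  Every complex vector is \<open>a + i b\<close> with real \<open>a\<close>, \<open>b\<close>. The scalar action \<open>sc\<close> on the codomain is a
  parameter so that the rule serves both vector-valued and scalar-valued identities.
\<close>

lemma complex_linear_eqI:
  fixes Fa Fb :: "complex ^ 'i::finite \<Rightarrow> 'b::ab_group_add" and sc :: "complex \<Rightarrow> 'b \<Rightarrow> 'b"
  assumes "\<And>x y. Fa (x + y) = Fa x + Fa y" "\<And>a x. Fa (a *s x) = sc a (Fa x)"
    and "\<And>x y. Fb (x + y) = Fb x + Fb y" "\<And>a x. Fb (a *s x) = sc a (Fb x)"
    and "\<And>h. Fa (cvec h) = Fb (cvec h)"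
  shows "Fa u = Fb u"
proof -
  have "u = cvec (\<chi> i. Re (u $ i)) + \<i> *s cvec (\<chi> i. Im (u $ i))"
    by (simp add: vec_eq_iff complex_eq[symmetric])
  then show ?thesis by (metis assms)
qed

lemma mult_ext:
  "(M *v ext t y) $ Some i = block_xt M $ i * t + (block_xx M *v y) $ i"
  for M :: "'a::comm_ring_1 ^ ('n::finite option) ^ ('n option)"
  by (simp add: matrix_vector_mult_def sum_UNIV_option block_xt_def block_xx_def)

lemma lower_block_mult: "(lower_block a M *v h) $ None = 0"
  "(lower_block a M *v h) $ Some i = a $ i * h $ None + (M *v spat h) $ i"
  for M :: "real ^ 'n::finite ^ 'n"
  by (simp_all add: matrix_vector_mult_def sum_UNIV_option lower_block_def)

lemma ext_spat: "ext (h $ None) (spat h) = h"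
  by (simp add: vec_eq_iff ext_def split: option.split)

lemma ext_eq_iff [simp]: "ext t y = ext t' y' \<longleftrightarrow> t = t' \<and> y = y'"
proof
  assume *: "ext t y = ext t' y'"
  have "y $ i = y' $ i" for i using arg_cong[OF *, of "\<lambda>u. u $ Some i"] by simp
  then show "t = t' \<and> y = y'" using arg_cong[OF *, of "\<lambda>u. u $ None"] by (simp add: vec_eq_iff)
qed simp

lemma outer_mult: "outer a b *v u = bdot b u *s a" for a b :: "'a::comm_ring_1 ^ 'i::finite"
  by (simp add: vec_eq_iff matrix_vector_mult_def outer_def bdot_def sum_distrib_left mult_ac)

lemma cmat_simps:
  "cmat (M - N) = cmat M - cmat N" "cmat (mat a) = mat (complex_of_real a)"
  "cmat (outer v w) = outer (cvec v) (cvec w)"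
  by (simp_all add: vec_eq_iff mat_def outer_def)

lemma cmat_diag_powr_nth: "(cmat (diag_powr s a) *v u) $ i = complex_of_real (s powr a i) * u $ i"
  by (simp add: matrix_vector_mult_def diag_powr_def diagm_def if_distrib[of "\<lambda>x. x * _"]
      if_distrib[of complex_of_real] cong: if_cong)

context horizon_equilibrium begin

definition Dg where "Dg = jacobian (g_ext \<alpha> k U f) (at z0 within DE)"
definition Dft where "Dft = jacobian (f_tilde \<alpha> k U f) (at z0 within DE)"
definition Ag where "Ag = - (C *\<^sub>R diagm (\<lambda>i. real (\<alpha> i))) + block_xx Dft"
definition Age where "Age = - (C *\<^sub>R diagm (alpha_ext \<alpha>)) + lower_block (block_xt Dft) (block_xx Dft)"
definition Ae where "Ae = - ((1 / k) *\<^sub>R diagm (alpha_ext \<alpha>)) + jacobian F (at (ext t0 Y0))"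

abbreviation \<mu> :: complex where "\<mu> \<equiv> complex_of_real (k * C)"
abbreviation RR where "RR \<equiv> cmat (diag_powr r (alpha_ext \<alpha>))"
abbreviation RI where "RI \<equiv> cmat (diag_powr r (\<lambda>i. - alpha_ext \<alpha> i))"

lemma Dg_mult: "Dg *v h = g' h"
  unfolding Dg_def by (rule jacobian_within_DE[OF g_has_derivative])

lemma Dft_mult: "Dft *v h = ft' h"
  unfolding Dft_def by (rule jacobian_within_DE[OF f_tilde_has_derivative])

lemma Age_mult: "Age *v h = B h"
proof -
  have "Age *v h = lower_block (block_xt Dft) (block_xx Dft) *v h - C *\<^sub>R \<Lambda> h"
    unfolding Age_def add.commute[of "- _"] diff_conv_add_uminus[symmetric]
    by (simp add: matrix_vector_mult_diff_rdistrib scaleR_matrix_vector_assoc)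
  moreover have "lower_block (block_xt Dft) (block_xx Dft) *v h = dF_z0 h"
  proof -
    have "(lower_block (block_xt Dft) (block_xx Dft) *v h) $ j = dF_z0 h $ j" for j
    proof (cases j)
      case (Some i)
      have "(lower_block (block_xt Dft) (block_xx Dft) *v h) $ Some i = (Dft *v ext (h $ None) (spat h)) $ Some i"
        by (simp only: lower_block_mult mult_ext)
      also have "\<dots> = dF_z0 h $ Some i" by (simp add: ext_spat Dft_mult ft'_def axis_def)
      finally show ?thesis by (simp only: Some)
    qed (simp add: lower_block_mult)
    then show ?thesis by (simp add: vec_eq_iff)
  qed
  ultimately show ?thesis by (simp add: B_def)
qed

lemma block_Age: "block_xx Age = Ag" "block_xt Age = block_xt Dft"
  by (auto simp: vec_eq_iff block_xx_def block_xt_def Age_def Ag_def lower_block_def diagm_def)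

lemma Ae_mult: "Ae *v h = dF_Y0 h - (1 / k) *\<^sub>R \<Lambda> h"
  unfolding Ae_def add.commute[of "- _"] diff_conv_add_uminus[symmetric]
  by (simp add: matrix_vector_mult_diff_rdistrib scaleR_matrix_vector_assoc jacobian_F)

lemma one_div_k: "1 / (k * C) = r powr k" "r powr (- k) = k * C" "1 / k = r powr k * C"
  using r_powr_k_times_kC C_pos k_ge_1 r_pos by (auto simp: powr_minus field_simps)

lemma Ae_dilate: "Ae *v dilate r h = (1 / (k * C)) *\<^sub>R dilate r (B h)"
proof -
  have "\<Lambda> (dilate r h) = dilate r (\<Lambda> h)" by (simp add: vec_eq_iff)
  then show ?thesis
    unfolding Ae_mult dF_Y0_dilate one_div_k B_def
    by (simp add: vec.diff matrix_vector_mult_diff_distrib matrix_vector_mult_scaleR scaleR_diff_right)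
qed

lemma Dg_complex: "cmat Dg *v u = cmat Age *v u - bdot (cvec wE) (cmat Age *v u) *s cvec vE
    - (complex_of_real C * bdot (cvec wE) u) *s cvec vE
    - (if k = 1 then 2 * of_nat c * bdot (cvec wE) u else 0) *s axis None 1"
  by (rule complex_linear_eqI[where sc="(*s)"])
    (simp_all add: cmat_cvec bdot_cvec Dg_mult Age_mult g'_def bdot_simps vec.add vec.scale
      vec.scale_right_distrib vec.scale_left_distrib vec.scale_right_diff_distrib distrib_left
      vector_smult_assoc mult.left_commute)

lemma g'_tangential: "wE \<bullet> h = 0 \<Longrightarrow> g' h = B h - (wE \<bullet> B h) *\<^sub>R vE"
  by (simp add: g'_def)

lemma wE_g': "wE \<bullet> g' h = - C * (wE \<bullet> h)"
  by (simp add: g'_def inner_diff_right wE_vE inner_axis wE_nth)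

lemma RR_RI: "RR *v (RI *v u) = u" "RI *v (RR *v u) = u"
proof -
  have "complex_of_real (r powr a) * complex_of_real (r powr (- a)) = 1" for a
    using powr_minus_mult_cancel[OF r_pos, of "- a" 1] unfolding of_real_mult[symmetric] by simp
  then have cancel: "complex_of_real (r powr a) * (complex_of_real (r powr (- a)) * y) = y" for a y
    by (simp only: mult.assoc[symmetric] mult_1)
  show "RR *v (RI *v u) = u" by (simp add: vec_eq_iff cmat_diag_powr_nth cancel)
  show "RI *v (RR *v u) = u"
    unfolding vec_eq_iff cmat_diag_powr_nth using cancel[of "- a" for a] by simp
qed

sublocale conj: scaled_conjugation "cmat Ae" "cmat Age" "(*v) RR" "(*v) RI" "1 / \<mu>"
proof
  show "cmat Ae *v (RR *v u) = (1 / \<mu>) *s (RR *v (cmat Age *v u))" for u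
    by (rule complex_linear_eqI[where sc="(*s)"])
      (simp_all add: vec.add vec.scale vec.scale_right_distrib cmat_cvec Ae_dilate Age_mult
        vector_smult_assoc mult.commute)
  show "1 / \<mu> \<noteq> 0" using C_pos k_ge_1 by simp
qed (simp_all add: RR_RI vec.add vec.scale)

sublocale defl: time_deflation "cmat Age" "cmat Dg" "cvec vE" "cvec wE" \<mu> "- complex_of_real C"
proof
  have "C + k * C > 0" using C_pos k_ge_1 by (intro add_pos_nonneg) auto
  then show "- complex_of_real C \<noteq> \<mu>"
    unfolding neg_eq_iff_add_eq_0 of_real_add[symmetric] of_real_eq_0_iff by simp
  show "bdot (cvec wE) (cvec vE) = 1" by (simp add: bdot_cvec wE_vE)
  show "cmat Age *v cvec vE = \<mu> *s cvec vE" by (simp only: cmat_cvec Age_mult B_vE cvec_simps)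
  show "cmat Dg *v (u - bdot (cvec wE) u *s cvec vE) =
      cmat Age *v u - bdot (cvec wE) (cmat Age *v u) *s cvec vE" for u
  proof (rule complex_linear_eqI[where sc="(*s)" and Fa="\<lambda>u. cmat Dg *v (u - bdot (cvec wE) u *s cvec vE)"
        and Fb="\<lambda>u. cmat Age *v u - bdot (cvec wE) (cmat Age *v u) *s cvec vE"])
    fix h :: "real ^ 'n option"
    have w: "wE \<bullet> (h - (wE \<bullet> h) *\<^sub>R vE) = 0" by (simp add: inner_diff_right wE_vE)
    have "B (h - (wE \<bullet> h) *\<^sub>R vE) = B h - (wE \<bullet> h) *\<^sub>R B vE"
      by (simp only: Age_mult[symmetric] matrix_vector_mult_diff_distrib matrix_vector_mult_scaleR)
    then have Bh: "B (h - (wE \<bullet> h) *\<^sub>R vE) = B h - ((wE \<bullet> h) * (k * C)) *\<^sub>R vE" by (simp add: B_vE)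
    have "g' (h - (wE \<bullet> h) *\<^sub>R vE) = B h - (wE \<bullet> B h) *\<^sub>R vE"
      unfolding g'_tangential[OF w] Bh by (simp add: inner_diff_right wE_vE algebra_simps)
    then have "cvec (Dg *v (h - (wE \<bullet> h) *\<^sub>R vE)) = cvec (Age *v h - (wE \<bullet> (Age *v h)) *\<^sub>R vE)"
      by (simp only: Dg_mult Age_mult)
    then show "cmat Dg *v (cvec h - bdot (cvec wE) (cvec h) *s cvec vE) =
      cmat Age *v cvec h - bdot (cvec wE) (cmat Age *v cvec h) *s cvec vE"
      by (simp only: cmat_cvec[symmetric] bdot_cvec[symmetric] cvec_simps)
  qed (simp_all add: bdot_simps vec.add vec.scale vec.diff vec.scale_left_distrib vec.scale_right_diff_distrib
      vector_smult_assoc)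
  show "bdot (cvec wE) (cmat Dg *v u) = - complex_of_real C * bdot (cvec wE) u" for u
    by (rule complex_linear_eqI[where sc="(*)"])
      (simp_all add: bdot_simps vec.add vec.scale cmat_cvec bdot_cvec Dg_mult wE_g' distrib_left)
  show "(cmat Age *v u) $ None = 0" for u
    by (rule complex_linear_eqI[where sc="(*)"])
      (simp_all add: vec.add vec.scale cmat_cvec Age_mult B_def)
qed (use C_pos k_ge_1 wE_nth in simp_all)

end

section \<open>The two correspondences\<close>

lemma block_solve:
  fixes M :: "real ^ ('n::finite option) ^ ('n option)"
  assumes "invertible (block_xx M)"
  shows "(M *v ext 1 (- (matrix_inv (block_xx M) *v block_xt M))) $ Some i = 0"
proof -
  have "block_xx M ** matrix_inv (block_xx M) = mat 1"
    using assms unfolding invertible_def matrix_inv_def by (rule someI2_ex) simp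
  then have "block_xx M *v (- (matrix_inv (block_xx M) *v block_xt M)) = - block_xt M"
    by (simp add: vec.neg matrix_vector_mul_assoc)
  then show ?thesis unfolding mult_ext by simp
qed

lemma block_kernel:
  fixes M :: "real ^ ('n::finite option) ^ ('n option)"
  assumes "invertible (block_xx M)" "h $ None = 0" "\<And>i. (M *v h) $ Some i = 0"
  shows "h = 0"
proof -
  have "ext 0 (spat h) = h" using ext_spat[of h] assms(2) by simp
  then have "(block_xx M *v spat h) $ i = 0" for i
    using mult_ext[of M 0 "spat h" i] assms(3)[of i] by simp
  then have "block_xx M *v spat h = 0" by (simp add: vec_eq_iff)
  then have "spat h = 0"
    using assms(1) invertible_left_inverse matrix_left_invertible_ker by blast
  then have "h $ j = 0" for j
    using assms(2) by (cases j) (simp_all flip: spat_nth)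
  then show ?thesis by (simp add: vec_eq_iff)
qed

context horizon_equilibrium begin

definition v0e where "v0e = cvec (ext 0 (diagm (\<lambda>i. real (\<alpha> i)) *v Y0))"
definition uA where "uA = ext 1 (- (matrix_inv (block_xx Ae) *v block_xt Ae))"
definition ug where "ug = ext 1 (- (matrix_inv (block_xx Dg) *v block_xt Dg))"

abbreviation IP where "IP \<equiv> cmat (mat 1 - outer vE wE)"
abbreviation S where "S \<equiv> cmat (Age - mat (k * C))"

lemma \<mu>_nz: "\<mu> \<noteq> 0"
  using C_pos k_ge_1 by simp

lemma IP_mult: "IP *v u = defl.proj u"
  by (simp add: defl.proj_def cmat_simps matrix_vector_mult_diff_rdistrib outer_mult mat_mult_vec)

lemma S_mult: "S *v u = shift (cmat Age) \<mu> u"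
  by (simp add: cmat_simps)

lemma v0e_eq: "v0e = RR *v cvec vE"
proof -
  have "dilate r vE = ext 0 (diagm (\<lambda>i. real (\<alpha> i)) *v Y0)"
    using r_pos by (simp add: vec_eq_iff Y0_eq vE_def ext_def split: option.split)
  then show ?thesis by (simp add: v0e_def cmat_cvec)
qed

lemma v0e_eigenpair: "eigenpair (cmat Ae) 1 v0e"
  using conj.eigenpair_conj[of \<mu> "cvec vE"] \<mu>_nz defl.Bv defl.v_nz
  by (simp add: v0e_eq eigenpair_def del: of_real_mult)

lemma Ae_None: "(Ae *v h) $ None = 0"
  by (simp add: Ae_mult dF_Y0_None)

lemma Ae_uA: "invertible (block_xx Ae) \<Longrightarrow> Ae *v uA = 0"
proof -
  assume "invertible (block_xx Ae)"
  from block_solve[OF this] have "(Ae *v uA) $ j = 0" for j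
    by (cases j) (simp_all add: uA_def Ae_None)
  then show ?thesis by (simp add: vec_eq_iff)
qed

text \<open>
  The spatial rows vanish by the choice of \<open>ug\<close>. The time row of \<open>Dg\<close> is a multiple of \<open>wE\<close>, and \<open>wE\<close> annihilates
  \<open>ug\<close> because it is a left eigenvector of \<open>Dg\<close> for \<open>- C \<noteq> 0\<close>.
\<close>

lemma Dg_ug: "invertible (block_xx Dg) \<Longrightarrow> Dg *v ug = 0"
proof -
  assume "invertible (block_xx Dg)"
  from block_solve[OF this] have *: "(Dg *v ug) $ Some i = 0" for i by (simp add: ug_def)
  then have "wE \<bullet> g' ug = 0" unfolding Dg_mult inner_wE by simp
  then have w: "wE \<bullet> ug = 0" using C_pos by (simp add: wE_g')
  have "(Dg *v ug) $ j = 0" for j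
  proof (cases j)
    case None
    then show ?thesis unfolding Dg_mult g'_tangential[OF w] by (simp add: B_def)
  qed (simp add: *)
  then show ?thesis by (simp add: vec_eq_iff)
qed

text \<open>
  A kernel vector \<open>h\<close> of \<open>Age\<close> with vanishing time component is projected to a kernel vector of \<open>Dg\<close> of the
  same kind. The latter vanishes, so that \<open>h\<close> is a multiple of \<open>vE\<close>, on which \<open>Age\<close> acts as \<open>k C \<noteq> 0\<close>. The
  conjugation by the dilation transfers this to \<open>Ae\<close>.
\<close>

lemma invertible_block_Ae:
  assumes "invertible (block_xx Dg)"
  shows "invertible (block_xx Ae)" "\<And>h. h $ None = 0 \<Longrightarrow> Age *v h = 0 \<Longrightarrow> h = 0"
proof -
  show B_inj: "h = 0" if h: "h $ None = 0" "Age *v h = 0" for h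
  proof -
    let ?h = "h - (wE \<bullet> h) *\<^sub>R vE"
    have "cmat Dg *v (cvec h - bdot (cvec wE) (cvec h) *s cvec vE) = 0"
      unfolding defl.J_proj by (simp add: cmat_cvec h bdot_simps)
    then have "cvec (Dg *v ?h) = 0" by (simp add: bdot_cvec cmat_cvec[symmetric])
    then have "Dg *v ?h = 0" by (simp only: cvec_eq_0_iff)
    then have "?h = 0" using h(1) by (intro block_kernel[OF assms]) auto
    then have "h = (wE \<bullet> h) *\<^sub>R vE" by simp
    then have "Age *v h = ((wE \<bullet> h) * (k * C)) *\<^sub>R vE"
      by (metis Age_mult B_vE matrix_vector_mult_scaleR scaleR_scaleR)
    then have "(wE \<bullet> h) *\<^sub>R vE = 0" using h(2) C_pos k_ge_1 by simp
    then show "h = 0" using \<open>h = (wE \<bullet> h) *\<^sub>R vE\<close> by simp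
  qed
  have "x = 0" if x: "block_xx Ae *v x = 0" for x
  proof -
    have "(Ae *v ext 0 x) $ j = 0" for j
      using x by (cases j) (simp_all add: Ae_None mult_ext)
    then have Ae0: "Ae *v ext 0 x = 0" by (simp add: vec_eq_iff)
    define h where "h = diag_powr r (\<lambda>i. - alpha_ext \<alpha> i) *v ext 0 x"
    have "dilate r h = ext 0 x"
      using powr_minus_mult_cancel[OF r_pos, of "- a" for a] by (simp add: h_def vec_eq_iff)
    then have "(1 / (k * C)) *\<^sub>R dilate r (B h) = 0" using Ae_dilate[of h] Ae0 by simp
    then have "Age *v h = 0"
      using C_pos k_ge_1 r_pos by (simp add: Age_mult vec_eq_iff)
    moreover have "h $ None = 0" by (simp add: h_def)
    ultimately have "h = 0" by (rule B_inj[rotated])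
    then have "ext 0 x = 0" using \<open>dilate r h = ext 0 x\<close> by simp
    from arg_cong[OF this, of "\<lambda>u. u $ Some i" for i] have "x $ i = 0" for i by simp
    then show "x = 0" by (simp add: vec_eq_iff)
  qed
  then show "invertible (block_xx Ae)"
    using invertible_left_inverse matrix_left_invertible_ker by blast
qed

lemma RI_uA:
  assumes "invertible (block_xx Ae)"
  shows "cmat Age *v (RI *v cvec uA) = 0" "(RI *v cvec uA) $ None = 1" "eigenpair (cmat Ae) 0 (cvec uA)"
proof -
  have nz: "cvec uA \<noteq> 0" by (auto simp: uA_def dest: arg_cong[of _ _ "\<lambda>u. u $ None"])
  show *: "eigenpair (cmat Ae) 0 (cvec uA)" using nz by (simp add: eigenpair_def cmat_cvec Ae_uA[OF assms])
  show "cmat Age *v (RI *v cvec uA) = 0"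
    using conj.eigenpair_conj[of 0 "RI *v cvec uA"] * by (simp add: RR_RI eigenpair_def)
  show "(RI *v cvec uA) $ None = 1" using r_pos by (simp add: cmat_diag_powr_nth uA_def)
qed

lemma Dg_ug_complex:
  assumes "invertible (block_xx Dg)"
  shows "cmat Dg *v cvec ug = 0" "cvec ug $ None = 1"
  using Dg_ug[OF assms] by (simp_all add: cmat_cvec) (simp add: ug_def)

text \<open>
  Both sides express that the kernel vectors of \<open>Age\<close> and of \<open>Dg\<close> with time component 1 coincide: each of
  them is unique, and on the hyperplane of \<open>wE\<close> the two matrices agree modulo \<open>vE\<close>.
\<close>

lemma ug_eigenpair_iff:
  assumes "invertible (block_xx Dg)"
  shows "eigenpair (cmat Ae) 0 (RR *v cvec ug) \<longleftrightarrow> bdot (cvec wE) (RI *v cvec uA) = 0"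
proof -
  let ?a = "diag_powr r (\<lambda>i. - alpha_ext \<alpha> i) *v uA"
  have a: "RI *v cvec uA = cvec ?a" by (rule cmat_cvec)
  note A = invertible_block_Ae[OF assms]
  have "cvec (Age *v ?a) = 0" "?a $ None = 1"
    using RI_uA(1)[OF A(1)] r_pos unfolding a cmat_cvec by (simp_all add: uA_def)
  then have Ba: "Age *v ?a = 0" "?a $ None = 1" by simp_all
  have None: "(?a - ug) $ None = 0" using Ba by (simp add: ug_def)
  have "eigenpair (cmat Ae) 0 (RR *v cvec ug) \<longleftrightarrow> Age *v ug = 0"
  proof -
    have "ug \<noteq> 0" by (auto simp: ug_def dest: arg_cong[of _ _ "\<lambda>u. u $ None"])
    then show ?thesis
      using conj.eigenpair_conj[of 0 "cvec ug"] by (simp add: eigenpair_def[of "cmat Age"] cmat_cvec)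
  qed
  also have "\<dots> \<longleftrightarrow> ug = ?a"
  proof
    assume "Age *v ug = 0"
    then have "Age *v (?a - ug) = 0" using Ba by (simp add: matrix_vector_mult_diff_distrib)
    then have "?a - ug = 0" using A(2) None by blast
    then show "ug = ?a" by simp
  qed (simp add: Ba)
  also have "\<dots> \<longleftrightarrow> wE \<bullet> ?a = 0"
  proof
    assume "ug = ?a"
    moreover have "wE \<bullet> g' ug = 0" using Dg_ug[OF assms] by (simp add: Dg_mult)
    ultimately show "wE \<bullet> ?a = 0" using C_pos by (simp add: wE_g')
  next
    assume "wE \<bullet> ?a = 0"
    then have "Dg *v ?a = 0" using Ba by (simp add: Dg_mult g'_tangential Age_mult)
    then have "Dg *v (?a - ug) = 0" using Dg_ug[OF assms] by (simp add: matrix_vector_mult_diff_distrib)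
    then have "?a - ug = 0" using None by (intro block_kernel[OF assms]) auto
    then show "ug = ?a" by simp
  qed
  finally show ?thesis unfolding a bdot_cvec by simp
qed

lemma transversal_k_gt_1:
  assumes "k > 1"
  shows "cmat Dg *v cvec vE = - complex_of_real C *s cvec vE"
  unfolding Dg_complex defl.Bv using assms defl.wv by (simp add: bdot_simps)

text \<open>
  The time row of the eigenvalue equation for \<open>(1, \<xi>)\<close> reads \<open>- 2 c w\<^sup>T \<xi> = - C\<close>. The coefficient \<open>d\<close> is chosen
  such that \<open>\<xi>\<close> satisfies it. In the spatial rows \<open>(A\<^sub>g + C) T = id\<close> turns \<open>d T v - T b\<close> into \<open>d v - b\<close>; the multiples
  of \<open>v\<close> cancel by \<open>w\<^sup>T b = 0\<close> and \<open>A\<^sub>g v = C v\<close>.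
\<close>

lemma transversal_k_eq_1:
  assumes k: "k = 1" and def: "tilde_v_defined Ag C (Dx_p \<alpha> x0) (diagm (\<lambda>i. real (\<alpha> i)) *v x0) (block_xt Dg)"
  defines "t \<equiv> tilde_v c Ag C (Dx_p \<alpha> x0) (diagm (\<lambda>i. real (\<alpha> i)) *v x0) (block_xt Dg)"
  shows "cmat Dg *v t = - complex_of_real C *s t" "bdot (cvec wE) t \<noteq> 0"
proof -
  define v w b a where "v = cvec (diagm (\<lambda>i. real (\<alpha> i)) *v x0)" and "w = cvec (Dx_p \<alpha> x0)"
    and "b = cvec (block_xt Dg)" and "a = cvec (block_xt Dft)"
  define X l where "X = cmat Ag" and "l = - complex_of_real C"
  define T where "T = reduced_inverse X l"
  define d where "d = bdot w (T b) / bdot w (T v)"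
  define C' where "C' = complex_of_real C"
  define \<xi> where "\<xi> = (C' / (2 * of_nat c)) *s v + d *s T v - T b"
  have c: "of_nat c \<noteq> (0 :: complex)" using c_lcm_pos[of \<alpha>] by simp
  have t: "t = ext 1 \<xi>"
    by (simp add: t_def tilde_v_def Let_def \<xi>_def d_def T_def X_def l_def v_def w_def b_def C'_def)
  have mem: "v \<in> reduced_space X l" "b \<in> reduced_space X l" "bdot w (T v) \<noteq> 0"
    using def by (simp_all add: tilde_v_defined_def Let_def X_def l_def v_def w_def b_def T_def)
  have XT: "X *v T y = y - C' *s T y" if "y \<in> reduced_space X l" for y
  proof -
    have "shift X l (T y) = y" unfolding T_def by (rule reduced_inverse(2)[OF that])
    then have "X *v T y - l *s T y = y" by (simp only: shift_apply)
    then show ?thesis by (simp add: l_def C'_def eq_diff_eq)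
  qed
  have vE: "cvec vE = ext 0 v" and wE: "cvec wE = ext 0 w" by (simp_all add: vE_def wE_def cvec_ext v_def w_def)
  have bdot_ext: "bdot (ext 0 w) (ext y u) = bdot w u" for y u
    by (simp add: bdot_def sum_UNIV_option)
  have wv: "bdot w v = 1" using defl.wv unfolding vE wE bdot_ext .
  have Age_ext: "cmat Age *v ext y u = ext 0 (y *s a + X *v u)" for y u
  proof -
    have "(cmat Age *v ext y u) $ j = ext 0 (y *s a + X *v u) $ j" for j
    proof (cases j)
      case (Some i)
      have "block_xx (cmat Age) = X" "block_xt (cmat Age) = a"
        by (simp_all add: X_def a_def vec_eq_iff block_Age[symmetric]) (simp_all add: block_xx_def block_xt_def)
      then show ?thesis by (simp add: Some mult_ext mult.commute)
    qed (simp add: defl.row)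
    then show ?thesis by (simp add: vec_eq_iff)
  qed
  have Xv: "X *v v = C' *s v"
  proof -
    have "cmat Age *v ext 0 v = ext 0 (C' *s v)"
      using defl.Bv unfolding vE by (simp add: k C'_def vec_eq_iff ext_def split: option.split)
    then show ?thesis unfolding Age_ext by simp
  qed
  have Dg_ext: "cmat Dg *v ext y u = ext (- 2 * of_nat c * bdot w u)
      (y *s a + X *v u - bdot w (y *s a + X *v u) *s v - (C' * bdot w u) *s v)" for y u
    unfolding Dg_complex Age_ext vE wE bdot_ext using k
    by (simp add: vec_eq_iff ext_def axis_def C'_def split: option.split)
  have b: "b = a - bdot w a *s v"
  proof -
    have "b $ i = (cmat Dg *v ext 1 0) $ Some i" for i
      unfolding mult_ext by (simp add: b_def block_xt_def)
    then show ?thesis unfolding Dg_ext by (simp add: vec_eq_iff bdot_simps)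
  qed
  have wb: "bdot w b = 0" by (simp add: b bdot_simps wv)
  have w\<xi>: "bdot w \<xi> = C' / (2 * of_nat c)"
    using mem(3) by (simp add: \<xi>_def bdot_simps wv d_def)
  have X\<xi>: "X *v \<xi> = (C' * (C' / of_nat c) + d) *s v - b - C' *s \<xi>"
    by (simp add: \<xi>_def vec.add vec.diff vec.scale Xv XT mem vec_eq_iff algebra_simps)
  have wX\<xi>: "bdot w (X *v \<xi>) = C' * (C' / (2 * of_nat c)) + d"
    using c by (simp add: X\<xi> bdot_simps wv wb w\<xi> field_simps)
  have spatial: "1 *s a + X *v \<xi> - bdot w (1 *s a + X *v \<xi>) *s v - (C' * bdot w \<xi>) *s v = - C' *s \<xi>"
  proof -
    have "1 *s a = b + bdot w a *s v" by (simp add: b)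
    then have "1 *s a + X *v \<xi> - bdot w (1 *s a + X *v \<xi>) *s v - (C' * bdot w \<xi>) *s v
      = b + bdot w a *s v + ((C' * (C' / of_nat c) + d) *s v - b - C' *s \<xi>)
        - (bdot w a + (C' * (C' / (2 * of_nat c)) + d)) *s v - (C' * (C' / (2 * of_nat c))) *s v"
      by (simp add: bdot_simps wX\<xi> w\<xi> X\<xi> wv wb)
    also have "\<dots> = - C' *s \<xi>" using c by (simp add: vec_eq_iff field_simps)
    finally show ?thesis .
  qed
  show "cmat Dg *v t = - complex_of_real C *s t"
    unfolding t Dg_ext spatial unfolding w\<xi> using c
    by (simp add: vec_eq_iff ext_def C'_def split: option.split)
  show "bdot (cvec wE) t \<noteq> 0"
    unfolding wE t bdot_ext w\<xi> using c C_pos by (simp add: C'_def)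
qed

lemma scaling_unique:
  assumes "x0 = diag_powr s (\<lambda>i. - real (\<alpha> i)) *v Y0" "s > 0"
  shows "s = r"
proof -
  obtain i where i: "i \<in> I_set \<alpha>" "x0 $ i \<noteq> 0" by (rule x0_nonzero)
  define a where "a = real (\<alpha> i)"
  have a: "a > 0" using i(1) by (simp add: a_def I_set_def)
  have "s powr (- a) * (r powr a * x0 $ i) = x0 $ i"
    using arg_cong[OF assms(1), of "\<lambda>x. x $ i"] by (simp add: Y0_eq a_def)
  then have "s powr (- a) * r powr a = 1" using i(2) by simp
  then have "r powr a = s powr a" using assms(2) by (simp add: powr_minus field_simps)
  then have "(r powr a) powr (1 / a) = (s powr a) powr (1 / a)" by simp
  then show ?thesis using a r_pos assms(2) by (simp add: powr_powr)
qed

lemma r_powr_k_complex: "complex_of_real (r powr k) = 1 / \<mu>" "complex_of_real (r powr (- k)) = \<mu>"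
  by (simp_all add: one_div_k(2) flip: one_div_k(1))

lemma RI_in_span_iff: "RI *v V \<in> vec.span {cvec vE} \<longleftrightarrow> V \<in> vec.span {v0e}"
proof -
  have "RI *v V = s *s cvec vE \<longleftrightarrow> V = s *s v0e" for s
  proof
    assume "RI *v V = s *s cvec vE"
    then have "RR *v (RI *v V) = RR *v (s *s cvec vE)" by (rule arg_cong)
    then show "V = s *s v0e" by (simp only: RR_RI vec.scale v0e_eq)
  qed (simp only: v0e_eq vec.scale RR_RI)
  then show ?thesis by (auto simp: vec.span_singleton)
qed

lemma gen_eigenvector_A_to_g:
  assumes "gen_eigenvector (cmat Ae) l m V" "V \<notin> vec.span {v0e}"
  shows "gen_eigenvector (cmat Dg) (complex_of_real (r powr (- k)) * l) m (IP *v (RI *v V))"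
    "bdot (cvec wE) (IP *v (RI *v V)) = 0"
proof -
  have "gen_eigenvector (cmat Age) (\<mu> * l) m (RI *v V)"
    using conj.gen_eigenvector_conj[of "\<mu> * l" m "RI *v V"] assms(1) \<mu>_nz
    by (simp add: RR_RI del: of_real_mult)
  then show "gen_eigenvector (cmat Dg) (complex_of_real (r powr (- k)) * l) m (IP *v (RI *v V))"
    unfolding IP_mult r_powr_k_complex using assms(2)
    by (intro defl.gen_eigenvector_proj) (simp_all only: RI_in_span_iff not_False_eq_True simp_thms)
  show "bdot (cvec wE) (IP *v (RI *v V)) = 0" by (simp add: IP_mult)
qed

lemma gen_eigenvector_g_span:
  assumes "gen_eigenvector (cmat Dg) l m u" "l = 0 \<Longrightarrow> invertible (block_xx Ae)"
    and "l = - complex_of_real C \<Longrightarrow> cmat Dg *v t = - complex_of_real C *s t \<and> bdot (cvec wE) t \<noteq> 0"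
  shows "u \<in> vec.span {u'. (l = - complex_of_real C \<and> u' = t) \<or> (l = 0 \<and> u' = IP *v (RI *v cvec uA)) \<or>
     (\<exists>l' m' U'. gen_eigenvector (cmat Ae) l' m' (ext 0 U') \<and> ext 0 U' \<notin> vec.span {v0e} \<and>
        l = complex_of_real (r powr (- k)) * l' \<and> u' = IP *v (RI *v ext 0 U'))}"
    (is "_ \<in> vec.span ?Z")
proof -
  have "u \<in> vec.span {u'. (l = - complex_of_real C \<and> u' = t) \<or> (l = 0 \<and> u' = defl.proj (RI *v cvec uA)) \<or>
     (\<exists>m' U'. gen_eigenvector (cmat Age) l m' (ext 0 U') \<and> ext 0 U' \<notin> vec.span {cvec vE} \<and> u' = defl.proj (ext 0 U'))}"
    using assms(1) RI_uA(1,2)[OF assms(2)] assms(3)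
    by (intro defl.gen_eigenspace_J_span[of u l m]) (auto simp: gen_eigenvector_iff)
  also have "\<dots> \<subseteq> vec.span ?Z"
  proof (rule vec.span_mono, rule subsetI, drule CollectD, elim disjE exE conjE)
    fix u' m' U' assume U': "gen_eigenvector (cmat Age) l m' (ext 0 U')" "ext 0 U' \<notin> vec.span {cvec vE}"
      "u' = defl.proj (ext 0 U')"
    have "(RR *v ext 0 U') $ None = 0" by (simp add: cmat_diag_powr_nth)
    then obtain W where W: "RR *v ext 0 U' = ext 0 W" using defl.ext_0_iff by blast
    then have RI_W: "RI *v ext 0 W = ext 0 U'" by (metis RR_RI(2))
    have "gen_eigenvector (cmat Ae) (1 / \<mu> * l) m' (ext 0 W)"
      unfolding W[symmetric] using U'(1) by (simp only: conj.gen_eigenvector_conj)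
    moreover have "ext 0 W \<notin> vec.span {v0e}" using U'(2) RI_in_span_iff[of "ext 0 W"] unfolding RI_W by blast
    moreover have "l = complex_of_real (r powr (- k)) * (1 / \<mu> * l)"
      unfolding r_powr_k_complex using \<mu>_nz by (simp del: of_real_mult)
    moreover have "u' = IP *v (RI *v ext 0 W)" by (simp only: IP_mult RI_W U'(3))
    ultimately show "u' \<in> ?Z" by blast
  qed (auto simp: IP_mult)
  finally show ?thesis .
qed

lemma gen_eigenvector_g_to_A:
  assumes "gen_eigenvector (cmat Dg) l m (IP *v u)" "l \<noteq> \<mu> \<or> S *v u \<noteq> 0"
  shows "bdot (cvec wE) (IP *v u) = 0"
    "gen_eigenvector (cmat Ae) (complex_of_real (r powr k) * l) m (RR *v (S *v u))"
proof -
  show "bdot (cvec wE) (IP *v u) = 0" by (simp add: IP_mult)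
  have "gen_eigenvector (cmat Age) l m (S *v u)"
    using assms defl.gen_eigenvector_shift unfolding IP_mult S_mult by blast
  then show "gen_eigenvector (cmat Ae) (complex_of_real (r powr k) * l) m (RR *v (S *v u))"
    unfolding r_powr_k_complex by (simp only: conj.gen_eigenvector_conj)
qed

lemma ug_to_A:
  assumes "invertible (block_xx Dg)"
  shows "eigenpair (cmat Dg) 0 (cvec ug)" "bdot (cvec wE) (cvec ug) = 0"
    "eigenpair (cmat Ae) 0 (RR *v (S *v cvec ug))"
proof -
  note ug = Dg_ug_complex[OF assms]
  have "cvec ug \<noteq> 0" using ug(2) by (auto dest: arg_cong[of _ _ "\<lambda>u. u $ None"])
  then show "eigenpair (cmat Dg) 0 (cvec ug)" using ug by (simp add: eigenpair_def)
  note * = defl.eigenpair_shift_zero[OF ug]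
  show "bdot (cvec wE) (cvec ug) = 0" by (rule *(1))
  have "eigenpair (cmat Age) 0 (S *v cvec ug)"
    using *(2,3) unfolding S_mult by (simp add: eigenpair_def)
  then show "eigenpair (cmat Ae) 0 (RR *v (S *v cvec ug))"
    using conj.eigenpair_conj[of 0] by simp
qed

lemma gen_eigenvector_A_span:
  assumes V: "gen_eigenvector (cmat Ae) l m V" and "l = 0 \<Longrightarrow> invertible (block_xx Dg)"
    and \<mu>: "l = 1 \<Longrightarrow> \<mu> \<notin> spec (cmat Dg)"
  shows "V \<in> vec.span {V'. (l = 1 \<and> V' = v0e) \<or> (l = 0 \<and> V' = RR *v (S *v cvec ug)) \<or>
     (\<exists>l' m' u. gen_eigenvector (cmat Dg) l' m' (IP *v ext 0 u) \<and>
        l = complex_of_real (r powr k) * l' \<and> V' = RR *v (S *v ext 0 u))}"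
    (is "_ \<in> vec.span ?Z")
proof -
  have l: "1 / \<mu> * (\<mu> * l) = l" "\<mu> * l = \<mu> \<longleftrightarrow> l = 1" "\<mu> * l = 0 \<longleftrightarrow> l = 0"
    using \<mu>_nz by (simp_all del: of_real_mult)
  let ?Y = "{V'. (\<mu> * l = \<mu> \<and> V' = cvec vE) \<or> (\<mu> * l = 0 \<and> V' = shift (cmat Age) \<mu> (cvec ug)) \<or>
     (\<exists>m' u. gen_eigenvector (cmat Dg) (\<mu> * l) m' (defl.proj (ext 0 u)) \<and> V' = shift (cmat Age) \<mu> (ext 0 u))}"
  have "RI *v V \<in> vec.span ?Y"
  proof (rule defl.gen_eigenspace_B_span)
    show "RI *v V \<in> gen_eigenspace (cmat Age) (\<mu> * l) m"
      using V conj.gen_eigenspace_conj[of "RI *v V" "\<mu> * l" m] unfolding l(1) RR_RI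
      by (simp add: gen_eigenvector_iff)
    show "cmat Dg *v cvec ug = 0 \<and> cvec ug $ None = 1" if "\<mu> * l = 0"
      using that Dg_ug_complex assms(2) unfolding l(3) by blast
    show "\<mu> \<notin> spec (cmat Dg)" if "\<mu> * l = \<mu>" using that \<mu> unfolding l(2) by blast
  qed
  then have "RR *v (RI *v V) \<in> (*v) RR ` vec.span ?Y" by (rule imageI)
  also have "\<dots> = vec.span ((*v) RR ` ?Y)"
    by (rule vec.linear_span_image[symmetric]) (rule matrix_vector_mul_linear_gen)
  also have "\<dots> \<subseteq> vec.span ?Z"
  proof (rule vec.span_mono, rule image_subsetI, drule CollectD, elim disjE exE conjE)
    fix V' m' u assume "gen_eigenvector (cmat Dg) (\<mu> * l) m' (defl.proj (ext 0 u))"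
      "V' = shift (cmat Age) \<mu> (ext 0 u)"
    then have "gen_eigenvector (cmat Dg) (\<mu> * l) m' (IP *v ext 0 u)" "RR *v V' = RR *v (S *v ext 0 u)"
      by (simp_all only: IP_mult S_mult)
    moreover have "l = complex_of_real (r powr k) * (\<mu> * l)" by (simp only: r_powr_k_complex l(1))
    ultimately show "RR *v V' \<in> ?Z" by blast
  next
    fix V' assume "\<mu> * l = \<mu>" "V' = cvec vE"
    then show "RR *v V' \<in> ?Z" unfolding l(2) by (simp add: v0e_eq)
  next
    fix V' assume "\<mu> * l = 0" "V' = shift (cmat Age) \<mu> (cvec ug)"
    then show "RR *v V' \<in> ?Z" unfolding l(3) S_mult by simp
  qed
  finally show ?thesis by (simp only: RR_RI)
qed

lemma dim_Ae_Age: "vec.dim (gen_eigenspace (cmat Ae) l j) = vec.dim (gen_eigenspace (cmat Age) (\<mu> * l) j)"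
  using conj.dim_gen_eigenspace_conj[of "\<mu> * l" j] \<mu>_nz by (simp del: of_real_mult)

lemma jordan_Ae_Age:
  assumes "jordan_nf (jnf_mat (cmat Ae)) bA" "jordan_nf (jnf_mat (cmat Age)) ba"
  shows "count_list ba (m, complex_of_real (r powr (- k)) * l) = count_list bA (m, l)"
  unfolding r_powr_k_complex count_jordan_blocks[OF assms(1)] count_jordan_blocks[OF assms(2)] dim_Ae_Age ..

lemma jordan_Ae_Dg:
  assumes "jordan_nf (jnf_mat (cmat Ae)) bA" "jordan_nf (jnf_mat (cmat Dg)) bg"
    and "l \<noteq> 1" "complex_of_real (r powr (- k)) * l \<noteq> - complex_of_real C"
  shows "count_list bg (m, complex_of_real (r powr (- k)) * l) = count_list bA (m, l)"
proof -
  have "\<mu> * l \<noteq> \<mu>" using assms(3) \<mu>_nz by (simp del: of_real_mult)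
  from defl.dim_gen_eigenspace_eq[OF this] assms(4) show ?thesis
    unfolding r_powr_k_complex count_jordan_blocks[OF assms(1)] count_jordan_blocks[OF assms(2)] dim_Ae_Age
    by simp
qed

text \<open>
  All kernel dimensions at \<open>- C\<close> exceed those of \<open>A\<^sup>e\<^sup>x\<^sup>t\<close> at \<open>- 1 / k\<close> by one, except that both vanish for exponent
  0. The second difference therefore changes for \<open>m = 1\<close> only, by one new block of size 1.
\<close>

lemma jordan_transversal:
  assumes "jordan_nf (jnf_mat (cmat Ae)) bA" "jordan_nf (jnf_mat (cmat Dg)) bg"
    and t: "cmat Dg *v t = - complex_of_real C *s t" "bdot (cvec wE) t \<noteq> 0"
  shows "count_list bg (m, - complex_of_real C) = count_list bA (m, - complex_of_real (1 / k)) + (if m = 1 then 1 else 0)"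
proof -
  let ?l = "- complex_of_real (1 / k)"
  let ?d = "\<lambda>j. vec.dim (gen_eigenspace (cmat Ae) ?l j)"
  have l: "\<mu> * ?l = - complex_of_real C" using k_ge_1 by simp
  have dg: "vec.dim (gen_eigenspace (cmat Dg) (- complex_of_real C) (Suc j)) = Suc (?d (Suc j))" for j
    unfolding defl.dim_gen_eigenspace_transversal[OF t] dim_Ae_Age l ..
  have d0: "vec.dim (gen_eigenspace M a 0) = 0" for M :: "complex ^ 'n option ^ 'n option" and a
    by (simp add: gen_eigenspace_def)
  \<comment> \<open>makes the natural subtraction exact when \<open>m = 1\<close>\<close>
  have concave: "?d 2 \<le> 2 * ?d 1"
  proof -
    have "sum_list (map (min 2) ns) \<le> 2 * sum_list (map (min 1) ns)" for ns :: "nat list"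
      by (induction ns) auto
    then show ?thesis
      unfolding dim_gen_eigenspace_jnf_mat[symmetric] dim_gen_eigenspace[OF assms(1)] .
  qed
  show ?thesis
  proof (cases m)
    case 0
    then show ?thesis by (simp add: count_jordan_blocks[OF assms(1)] count_jordan_blocks[OF assms(2)])
  next
    case (Suc m')
    show ?thesis
    proof (cases m')
      case 0
      then show ?thesis
        using concave unfolding Suc count_jordan_blocks[OF assms(1)] count_jordan_blocks[OF assms(2)]
        by (simp add: dg d0 numeral_2_eq_2)
    next
      case (Suc m'')
      then show ?thesis
        unfolding \<open>m = Suc m'\<close> count_jordan_blocks[OF assms(1)] count_jordan_blocks[OF assms(2)]
        by (simp add: dg)
    qed
  qed
qed

end

section \<open>Correspondence of eigenstructures\<close>

theorem theorem3p22:
  fixes \<alpha> :: "'n::finite \<Rightarrow> nat"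
    and U :: "(real ^ 'n) set"
    and f f\<alpha> :: "real \<Rightarrow> real ^ 'n \<Rightarrow> real ^ 'n"
    and k t\<^sub>s :: real
    and x\<^sub>s Y\<^sub>0 :: "real ^ 'n"
  defines "c \<equiv> c_lcm \<alpha>"
    and "\<Lambda> \<equiv> diagm (\<lambda>i. real (\<alpha> i))"
    and "\<Lambda>e \<equiv> diagm (alpha_ext \<alpha>)"
    and "z\<^sub>s \<equiv> ext t\<^sub>s x\<^sub>s"
    and "DE \<equiv> domD \<alpha> U \<union> horizon \<alpha> U"
  defines "C \<equiv> G \<alpha> k U f z\<^sub>s"
    and "w \<equiv> Dx_p \<alpha> x\<^sub>s"
    and "v \<equiv> \<Lambda> *v x\<^sub>s"
    and "r\<^sub>x \<equiv> (k * G \<alpha> k U f z\<^sub>s) powr (- 1 / k)"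
    and "r\<^sub>Y \<equiv> p_alpha \<alpha> Y\<^sub>0"
  defines "Dg \<equiv> jacobian (g_ext \<alpha> k U f) (at z\<^sub>s within DE)"
    and "Dft \<equiv> jacobian (f_tilde \<alpha> k U f) (at z\<^sub>s within DE)"
  defines "Ag \<equiv> - (C *\<^sub>R \<Lambda>) + block_xx Dft"
    and "Age \<equiv> - (C *\<^sub>R \<Lambda>e) + lower_block (block_xt Dft) (block_xx Dft)"
    and "Ae \<equiv> - ((1 / k) *\<^sub>R \<Lambda>e) + jacobian (f\<alpha>_ext f\<alpha>) (at (ext t\<^sub>s Y\<^sub>0))"
  defines "A \<equiv> block_xx Ae"
    and "Dtf \<equiv> block_xt Ae"
    and "Dxg \<equiv> block_xx Dg"
    and "Dtg \<equiv> block_xt Dg"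
  defines "we \<equiv> cvec (ext 0 w)"
    and "ve \<equiv> cvec (ext 0 v)"
    and "v0e \<equiv> cvec (ext 0 (\<Lambda> *v Y\<^sub>0))"
    and "IP \<equiv> cmat (mat 1 - outer (ext 0 v) (ext 0 w))"
    and "Rx \<equiv> cmat (diag_powr r\<^sub>x (alpha_ext \<alpha>))"
    and "RY \<equiv> cmat (diag_powr r\<^sub>Y (\<lambda>i. - alpha_ext \<alpha> i))"
    and "S \<equiv> cmat (Age - mat (k * C))"
    and "uA \<equiv> cvec (ext 1 (- (matrix_inv A *v Dtf)))"
    and "ug \<equiv> cvec (ext 1 (- (matrix_inv Dxg *v Dtg)))"
  defines "vtr \<equiv> if k > 1 then ve else tilde_v c Ag C w v Dtg"
    and "vtr_defined \<equiv> k > 1 \<or> tilde_v_defined Ag C w v Dtg"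
  assumes alpha: "\<exists>i. \<alpha> i > 0"
    and k_pos: "k > 0"
    and domain: "phase_domain \<alpha> U"
    and f_C1: "C1_on {z. spat z \<in> U} (\<lambda>z. f (z $ None) (spat z))"
    and f_aqh: "asymp_quasi_homogeneous \<alpha> k U f f\<alpha>"
    and f\<alpha>_diff: "(\<lambda>z. f\<alpha> (z $ None) (spat z)) differentiable (at (ext t\<^sub>s Y\<^sub>0))"
    and R: "residual_assumption \<alpha> k U f f\<alpha>"
    and on_horizon: "z\<^sub>s \<in> horizon \<alpha> U"
    and equilibrium: "g_ext \<alpha> k U f z\<^sub>s = 0"
    and Y_nonzero: "Y\<^sub>0 \<noteq> 0"
    and balance: "- ((1 / k) *\<^sub>R (\<Lambda> *v Y\<^sub>0)) + f\<alpha> t\<^sub>s Y\<^sub>0 = 0"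
    and rx_pos: "r\<^sub>x > 0" and rY_pos: "r\<^sub>Y > 0"
    and Y_of_x: "Y\<^sub>0 = diag_powr r\<^sub>x (\<lambda>i. real (\<alpha> i)) *v x\<^sub>s"
    and x_of_Y: "x\<^sub>s = diag_powr r\<^sub>Y (\<lambda>i. - real (\<alpha> i)) *v Y\<^sub>0"
  shows
    "\<comment> \<open>(I)(a), (II)(a)\<close>
     (eigenpair (cmat Ae) 1 v0e \<and> - complex_of_real C \<in> spec (cmat Dg) \<and>
      (vtr_defined \<longrightarrow> eigenpair (cmat Dg) (- complex_of_real C) vtr \<and> bdot we vtr \<noteq> 0))
     \<and>
     \<comment> \<open>(I)(b)\<close>
     (invertible A \<longrightarrow>
        eigenpair (cmat Ae) 0 uA \<and>
        eigenpair (cmat Dg) 0 (IP *v (RY *v uA)) \<and> bdot we (IP *v (RY *v uA)) = 0 \<and>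
        (eigenpair (cmat Dg) 0 (RY *v uA) \<longleftrightarrow> bdot we (RY *v uA) = 0))
     \<and>
     \<comment> \<open>(I)(c)\<close>
     (\<forall>l m U'. gen_eigenvector (cmat Ae) l m (ext 0 U') \<and> ext 0 U' \<notin> vec.span {v0e} \<longrightarrow>
        gen_eigenvector (cmat Dg) (complex_of_real (r\<^sub>Y powr (- k)) * l) m (IP *v (RY *v ext 0 U')) \<and>
        bdot we (IP *v (RY *v ext 0 U')) = 0)
     \<and>
     \<comment> \<open>(I) yields all (generalized) eigenpairs of Dg\<close>
     (\<forall>l m u. gen_eigenvector (cmat Dg) l m u \<and>
          (l = 0 \<longrightarrow> invertible A) \<and> (l = - complex_of_real C \<longrightarrow> vtr_defined) \<longrightarrow>
        u \<in> vec.span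
          {u'. (l = - complex_of_real C \<and> u' = vtr) \<or>
               (l = 0 \<and> u' = IP *v (RY *v uA)) \<or>
               (\<exists>l' m' U'. gen_eigenvector (cmat Ae) l' m' (ext 0 U') \<and> ext 0 U' \<notin> vec.span {v0e} \<and>
                  l = complex_of_real (r\<^sub>Y powr (- k)) * l' \<and> u' = IP *v (RY *v ext 0 U'))})
     \<and>
     \<comment> \<open>(II)(b)\<close>
     (invertible Dxg \<longrightarrow>
        eigenpair (cmat Dg) 0 ug \<and> bdot we ug = 0 \<and>
        eigenpair (cmat Ae) 0 (Rx *v (S *v ug)) \<and>
        (eigenpair (cmat Ae) 0 (Rx *v ug) \<longleftrightarrow> bdot we (RY *v uA) = 0))
     \<and>
     \<comment> \<open>(II)(c)\<close>
     (\<forall>l m u. gen_eigenvector (cmat Dg) l m (IP *v ext 0 u) \<and>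
          (l \<noteq> complex_of_real (k * C) \<or> S *v ext 0 u \<noteq> 0) \<longrightarrow>
        bdot we (IP *v ext 0 u) = 0 \<and>
        gen_eigenvector (cmat Ae) (complex_of_real (r\<^sub>x powr k) * l) m (Rx *v (S *v ext 0 u)))
     \<and>
     \<comment> \<open>(II) yields all (generalized) eigenpairs of Ae\<close>
     (\<forall>l m V. gen_eigenvector (cmat Ae) l m V \<and>
          (l = 0 \<longrightarrow> invertible Dxg) \<and> (l = 1 \<longrightarrow> complex_of_real (k * C) \<notin> spec (cmat Dg)) \<longrightarrow>
        V \<in> vec.span
          {V'. (l = 1 \<and> V' = v0e) \<or>
               (l = 0 \<and> V' = Rx *v (S *v ug)) \<or>
               (\<exists>l' m' u. gen_eigenvector (cmat Dg) l' m' (IP *v ext 0 u) \<and>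
                  l = complex_of_real (r\<^sub>x powr k) * l' \<and> V' = Rx *v (S *v ext 0 u))})
     \<and>
     \<comment> \<open>Jordan structure\<close>
     (\<forall>bA ba. jordan_nf (jnf_mat (cmat Ae)) bA \<and> jordan_nf (jnf_mat (cmat Age)) ba \<longrightarrow>
        (\<forall>l m. count_list ba (m, complex_of_real (r\<^sub>Y powr (- k)) * l) = count_list bA (m, l)))
     \<and>
     (\<forall>bA bg. jordan_nf (jnf_mat (cmat Ae)) bA \<and> jordan_nf (jnf_mat (cmat Dg)) bg \<longrightarrow>
        (\<forall>l m. l \<noteq> 1 \<and> complex_of_real (r\<^sub>Y powr (- k)) * l \<noteq> - complex_of_real C \<longrightarrow>
           count_list bg (m, complex_of_real (r\<^sub>Y powr (- k)) * l) = count_list bA (m, l)) \<and>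
        (vtr_defined \<longrightarrow> (\<forall>m.
           count_list bg (m, - complex_of_real C) =
             count_list bA (m, - complex_of_real (1 / k)) + (if m = 1 then 1 else 0))))"
proof -
  interpret he: horizon_equilibrium \<alpha> U f f\<alpha> k t\<^sub>s r\<^sub>x x\<^sub>s Y\<^sub>0
  proof unfold_locales
    show "f\<alpha> t (diag_powr s (\<lambda>i. real (\<alpha> i)) *v y) $ i = s powr (k + real (\<alpha> i)) * f\<alpha> t y $ i"
      if "y \<in> U" "s > 0" for t y s i
      using f_aqh that unfolding asymp_quasi_homogeneous_def by blast
    show "ext t\<^sub>s x\<^sub>s \<in> horizon \<alpha> U" using on_horizon unfolding z\<^sub>s_def .
    show "g_ext \<alpha> k U f (ext t\<^sub>s x\<^sub>s) = 0" using equilibrium unfolding z\<^sub>s_def .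
    show "- ((1 / k) *\<^sub>R (diagm (\<lambda>i. real (\<alpha> i)) *v Y\<^sub>0)) + f\<alpha> t\<^sub>s Y\<^sub>0 = 0"
      using balance unfolding \<Lambda>_def .
  qed (fact domain f_C1 R f\<alpha>_diff rx_pos Y_of_x)+
  have rY: "r\<^sub>Y = r\<^sub>x" using x_of_Y rY_pos by (rule he.scaling_unique)
  have C: "C = he.C" unfolding C_def he.C_def z\<^sub>s_def ..
  have Dg: "Dg = he.Dg" unfolding Dg_def he.Dg_def z\<^sub>s_def DE_def ..
  have Dft: "Dft = he.Dft" unfolding Dft_def he.Dft_def z\<^sub>s_def DE_def ..
  have Ag: "Ag = he.Ag" unfolding Ag_def he.Ag_def C Dft \<Lambda>_def ..
  have Age: "Age = he.Age" unfolding Age_def he.Age_def C Dft \<Lambda>e_def ..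
  have Ae: "Ae = he.Ae" unfolding Ae_def he.Ae_def \<Lambda>e_def ..
  have A: "A = block_xx he.Ae" unfolding A_def Ae ..
  have Dxg: "Dxg = block_xx he.Dg" unfolding Dxg_def Dg ..
  have we: "we = cvec he.wE" unfolding we_def he.wE_def w_def ..
  have ve: "ve = cvec he.vE" unfolding ve_def he.vE_def v_def \<Lambda>_def ..
  have v0e: "v0e = he.v0e" unfolding v0e_def he.v0e_def \<Lambda>_def ..
  have IP: "IP = he.IP" unfolding IP_def he.vE_def he.wE_def v_def w_def \<Lambda>_def ..
  have RY: "RY = cmat (diag_powr r\<^sub>x (\<lambda>i. - alpha_ext \<alpha> i))" unfolding RY_def rY ..
  have S: "S = he.S" unfolding S_def Age C ..
  have uA: "uA = cvec he.uA" unfolding uA_def he.uA_def A Dtf_def Ae ..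
  have ug: "ug = cvec he.ug" unfolding ug_def he.ug_def Dxg Dtg_def Dg ..
  note eqs = rY C Dg Age Ae A Dxg we v0e IP RY Rx_def S uA ug
  have vtr: "cmat he.Dg *v vtr = - complex_of_real he.C *s vtr" "bdot (cvec he.wE) vtr \<noteq> 0" if vtr_defined
  proof -
    have "cmat he.Dg *v vtr = - complex_of_real he.C *s vtr \<and> bdot (cvec he.wE) vtr \<noteq> 0"
    proof (cases "k > 1")
      case True
      then show ?thesis
        unfolding vtr_def ve using he.transversal_k_gt_1[OF True] he.defl.wv by simp
    next
      case False
      then have k: "k = 1" using he.k_ge_1 by simp
      have "tilde_v_defined he.Ag he.C (Dx_p \<alpha> x\<^sub>s) (diagm (\<lambda>i. real (\<alpha> i)) *v x\<^sub>s) (block_xt he.Dg)"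
        using that False unfolding vtr_defined_def Ag C w_def v_def \<Lambda>_def Dtg_def Dg by blast
      from he.transversal_k_eq_1[OF k this] show ?thesis
        using False unfolding vtr_def c_def Ag C w_def v_def \<Lambda>_def Dtg_def Dg by simp
    qed
    then show "cmat he.Dg *v vtr = - complex_of_real he.C *s vtr" "bdot (cvec he.wE) vtr \<noteq> 0" by auto
  qed
  show ?thesis
  proof (intro conjI allI impI)
    show "eigenpair (cmat Ae) 1 v0e" unfolding eqs by (rule he.v0e_eigenpair)
    show "- complex_of_real C \<in> spec (cmat Dg)" unfolding eqs by (rule he.defl.kappa_eigenvalue)
  next
    assume vtr_defined
    note * = vtr[OF this]
    have "vtr \<noteq> 0" using *(2) by (auto simp: bdot_simps)
    then show "eigenpair (cmat Dg) (- complex_of_real C) vtr" unfolding eqs eigenpair_def using *(1) by blast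
    show "bdot we vtr \<noteq> 0" unfolding eqs by (rule *(2))
  next
    assume "invertible A"
    then have inv: "invertible (block_xx he.Ae)" unfolding A .
    note * = he.RI_uA[OF inv]
    show "eigenpair (cmat Ae) 0 uA" unfolding eqs by (rule *(3))
    show "eigenpair (cmat Dg) 0 (IP *v (RY *v uA))"
      unfolding eqs he.IP_mult using *(1,2) by (rule he.defl.eigenpair_proj_zero)
    show "bdot we (IP *v (RY *v uA)) = 0" unfolding eqs he.IP_mult by simp
    show "eigenpair (cmat Dg) 0 (RY *v uA) \<longleftrightarrow> bdot we (RY *v uA) = 0"
      unfolding eqs using *(1,2) by (rule he.defl.eigenpair_proj_zero)
  next
    fix l m U' assume "gen_eigenvector (cmat Ae) l m (ext 0 U') \<and> ext 0 U' \<notin> vec.span {v0e}"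
    then have *: "gen_eigenvector (cmat he.Ae) l m (ext 0 U')" "ext 0 U' \<notin> vec.span {he.v0e}"
      unfolding eqs by blast+
    show "gen_eigenvector (cmat Dg) (complex_of_real (r\<^sub>Y powr (- k)) * l) m (IP *v (RY *v ext 0 U'))"
      unfolding eqs using * by (rule he.gen_eigenvector_A_to_g)
    show "bdot we (IP *v (RY *v ext 0 U')) = 0" unfolding eqs using * by (rule he.gen_eigenvector_A_to_g)
  next
    fix l m u
    assume *: "gen_eigenvector (cmat Dg) l m u \<and> (l = 0 \<longrightarrow> invertible A) \<and> (l = - complex_of_real C \<longrightarrow> vtr_defined)"
    show "u \<in> vec.span
          {u'. (l = - complex_of_real C \<and> u' = vtr) \<or> (l = 0 \<and> u' = IP *v (RY *v uA)) \<or>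
               (\<exists>l' m' U'. gen_eigenvector (cmat Ae) l' m' (ext 0 U') \<and> ext 0 U' \<notin> vec.span {v0e} \<and>
                  l = complex_of_real (r\<^sub>Y powr (- k)) * l' \<and> u' = IP *v (RY *v ext 0 U'))}"
      unfolding eqs
    proof (rule he.gen_eigenvector_g_span)
      show "gen_eigenvector (cmat he.Dg) l m u" using * unfolding Dg by blast
      show "invertible (block_xx he.Ae)" if "l = 0" using * that unfolding A by blast
      show "cmat he.Dg *v vtr = - complex_of_real he.C *s vtr \<and> bdot (cvec he.wE) vtr \<noteq> 0"
        if "l = - complex_of_real he.C"
        using * that vtr unfolding C by blast
    qed
  next
    assume "invertible Dxg"
    then have inv: "invertible (block_xx he.Dg)" unfolding Dxg .
    note * = he.ug_to_A[OF inv]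
    show "eigenpair (cmat Dg) 0 ug" "bdot we ug = 0" "eigenpair (cmat Ae) 0 (Rx *v (S *v ug))"
      unfolding eqs by (fact *)+
    show "eigenpair (cmat Ae) 0 (Rx *v ug) \<longleftrightarrow> bdot we (RY *v uA) = 0"
      unfolding eqs by (rule he.ug_eigenpair_iff[OF inv])
  next
    fix l m u
    assume "gen_eigenvector (cmat Dg) l m (IP *v ext 0 u) \<and> (l \<noteq> complex_of_real (k * C) \<or> S *v ext 0 u \<noteq> 0)"
    then have *: "gen_eigenvector (cmat he.Dg) l m (he.IP *v ext 0 u)"
      "l \<noteq> complex_of_real (k * he.C) \<or> he.S *v ext 0 u \<noteq> 0"
      unfolding eqs by blast+
    show "bdot we (IP *v ext 0 u) = 0" unfolding eqs using * by (rule he.gen_eigenvector_g_to_A)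
    show "gen_eigenvector (cmat Ae) (complex_of_real (r\<^sub>x powr k) * l) m (Rx *v (S *v ext 0 u))"
      unfolding eqs using * by (rule he.gen_eigenvector_g_to_A)
  next
    fix l m V
    assume *: "gen_eigenvector (cmat Ae) l m V \<and> (l = 0 \<longrightarrow> invertible Dxg) \<and>
      (l = 1 \<longrightarrow> complex_of_real (k * C) \<notin> spec (cmat Dg))"
    show "V \<in> vec.span
          {V'. (l = 1 \<and> V' = v0e) \<or> (l = 0 \<and> V' = Rx *v (S *v ug)) \<or>
               (\<exists>l' m' u. gen_eigenvector (cmat Dg) l' m' (IP *v ext 0 u) \<and>
                  l = complex_of_real (r\<^sub>x powr k) * l' \<and> V' = Rx *v (S *v ext 0 u))}"
      unfolding eqs
      by (rule he.gen_eigenvector_A_span[of l m]) (use * in \<open>unfold eqs, blast+\<close>)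
  next
    fix bA ba l m
    assume "jordan_nf (jnf_mat (cmat Ae)) bA \<and> jordan_nf (jnf_mat (cmat Age)) ba"
    then show "count_list ba (m, complex_of_real (r\<^sub>Y powr (- k)) * l) = count_list bA (m, l)"
      unfolding eqs using he.jordan_Ae_Age by blast
  next
    fix bA bg l m
    assume "jordan_nf (jnf_mat (cmat Ae)) bA \<and> jordan_nf (jnf_mat (cmat Dg)) bg"
      and "l \<noteq> 1 \<and> complex_of_real (r\<^sub>Y powr (- k)) * l \<noteq> - complex_of_real C"
    then show "count_list bg (m, complex_of_real (r\<^sub>Y powr (- k)) * l) = count_list bA (m, l)"
      unfolding eqs using he.jordan_Ae_Dg by blast
  next
    fix bA bg m
    assume "jordan_nf (jnf_mat (cmat Ae)) bA \<and> jordan_nf (jnf_mat (cmat Dg)) bg" and vtr_defined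
    then show "count_list bg (m, - complex_of_real C) =
        count_list bA (m, - complex_of_real (1 / k)) + (if m = 1 then 1 else 0)"
      unfolding eqs using he.jordan_transversal[OF _ _ vtr] by blast
  qed
qed

end
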